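(* Let $q$ be a power of an odd prime with $3\nmid(q+1)$, and let $H=\mathbb{F}_{q^2}(x,y)$ be the Hermitian function field over $\mathbb{F}_{q^2}$, defined by $y^q+y=x^{q+1}$. Let $a\in\mathbb{F}_{q^2}$ be a primitive $(q^2-1)$-th root of unity and $c=a-a^{q}$. Let $\sigma$ be the $\mathbb{F}_{q^2}$-automorphism of $H$ given by $\sigma(x)=\frac{ax}{a^{q+1}y+c}$, $\sigma(y)=\frac{1}{a^{q+1}y+c}$, and let $\mathcal D=\langle\sigma\rangle$. Let $m$ be a positive divisor of the order of $\sigma$ and let $\mathcal G$ be the subgroup of $\mathcal D$ of order $m$. Then $$g(H^{\mathcal G})=\frac{(q-1)(q+1-m)}{2m}.$$
   Context: $H^{\mathcal G}$ denotes the subfield of $H$ fixed by every element of $\mathcal G$, regarded as a function field over $\mathbb{F}_{q^2}$. (The order of $\sigma$ is $(q+1)/2$ if $q\equiv1\pmod 4$ and $q+1$ if $q\equiv 3\pmod 4$.) *)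

theory Defs
  imports
    "HOL-Algebra.Algebra"
    "HOL-Algebra.Algebraic_Closure_Type"
begin

text \<open>
  Algebraic function fields \<open>F/K\<close> in one variable, developed through places as in Stichtenoth's
  book.  The field \<open>F\<close> is a HOL-Algebra structure and the constant field \<open>K\<close> is a subset of its
  carrier.
\<close>

section \<open>Places and valuations\<close>

definition valuation_ring :: "('a, 'b) ring_scheme \<Rightarrow> 'a set \<Rightarrow> 'a set \<Rightarrow> bool" where
  "valuation_ring F K V \<longleftrightarrow>
     subring V F \<and> K \<subset> V \<and> V \<subset> carrier F \<and>
     (\<forall>z\<in>carrier F - {\<zero>\<^bsub>F\<^esub>}. z \<in> V \<or> inv\<^bsub>F\<^esub> z \<in> V)"

definition places :: "('a, 'b) ring_scheme \<Rightarrow> 'a set \<Rightarrow> 'a set set" where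
  "places F K = {P. \<exists>V. valuation_ring F K V \<and> maximalideal P (F\<lparr>carrier := V\<rparr>)}"

text \<open>
  A place determines its valuation ring: \<open>V = {z. z\<inverse> \<notin> P}\<close>, where \<open>0\<close> belongs to \<open>V\<close> by convention.
\<close>

definition place_ring :: "('a, 'b) ring_scheme \<Rightarrow> 'a set \<Rightarrow> ('a, 'b) ring_scheme" where
  "place_ring F P =
     F\<lparr>carrier := {z \<in> carrier F. z = \<zero>\<^bsub>F\<^esub> \<or> inv\<^bsub>F\<^esub> z \<notin> P}\<rparr>"

definition prime_element :: "('a, 'b) ring_scheme \<Rightarrow> 'a set \<Rightarrow> 'a \<Rightarrow> bool" where
  "prime_element F P t \<longleftrightarrow>
     t \<in> carrier (place_ring F P) \<and> P = PIdl\<^bsub>place_ring F P\<^esub> t"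

text \<open>
  The exponent \<open>n\<close> below is independent of the prime element \<open>t\<close>.  The definition is meant for
  nonzero \<open>z\<close> only; the value \<open>v(0) = \<infinity>\<close> is treated separately where it occurs.
\<close>

definition place_val :: "('a, 'b) ring_scheme \<Rightarrow> 'a set \<Rightarrow> 'a \<Rightarrow> int" where
  "place_val F P z =
     (THE n. \<exists>t u. prime_element F P t \<and> u \<in> Units (place_ring F P) \<and>
                   z = t [^]\<^bsub>F\<^esub> n \<otimes>\<^bsub>F\<^esub> u)"

text \<open>
  The degree \<open>[F\<^sub>P : K]\<close> of a place, where \<open>F\<^sub>P\<close> is the residue class field and \<open>K\<close> is identified
  with its image in \<open>F\<^sub>P\<close>.
\<close>

definition place_degree :: "('a, 'b) ring_scheme \<Rightarrow> 'a set \<Rightarrow> 'a set \<Rightarrow> nat" where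
  "place_degree F K P =
     ring.dim (place_ring F P Quot P)
       ((\<lambda>k. P +>\<^bsub>place_ring F P\<^esub> k) ` K)
       (carrier (place_ring F P Quot P))"

section \<open>Divisors, Riemann-Roch spaces and the genus\<close>

abbreviation divisors :: "('a, 'b) ring_scheme \<Rightarrow> 'a set \<Rightarrow> ('a set \<Rightarrow>\<^sub>0 int) set" where
  "divisors F K \<equiv> carrier (free_Abelian_group (places F K))"

definition divisor_degree ::
    "('a, 'b) ring_scheme \<Rightarrow> 'a set \<Rightarrow> ('a set \<Rightarrow>\<^sub>0 int) \<Rightarrow> int" where
  "divisor_degree F K A =
     (\<Sum>P\<in>Poly_Mapping.keys A. Poly_Mapping.lookup A P * int (place_degree F K P))"

definition riemann_roch_space ::
    "('a, 'b) ring_scheme \<Rightarrow> 'a set \<Rightarrow> ('a set \<Rightarrow>\<^sub>0 int) \<Rightarrow> 'a set" where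
  "riemann_roch_space F K A =
     {z \<in> carrier F. z = \<zero>\<^bsub>F\<^esub> \<or>
        (\<forall>P\<in>places F K. place_val F P z \<ge> - Poly_Mapping.lookup A P)}"

text \<open>
  For a function field \<open>F/K\<close> all \<open>\<ell>(A)\<close> are finite and, by Riemann's theorem, the maximum of
  \<open>deg A - \<ell>(A) + 1\<close> over all divisors \<open>A\<close> exists.
\<close>

definition genus :: "('a, 'b) ring_scheme \<Rightarrow> 'a set \<Rightarrow> int" where
  "genus F K =
     (GREATEST g. \<exists>A\<in>divisors F K.
        g = divisor_degree F K A - int (ring.dim F K (riemann_roch_space F K A)) + 1)"

section \<open>Automorphisms and fixed fields\<close>

definition aut_group ::
    "('a, 'b) ring_scheme \<Rightarrow> 'a set \<Rightarrow> ('a \<Rightarrow> 'a) monoid" where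
  "aut_group F K =
     BijGroup (carrier F)
       \<lparr>carrier := {f \<in> Bij (carrier F). f \<in> ring_hom F F \<and> (\<forall>k\<in>K. f k = k)}\<rparr>"

definition fixed_field ::
    "('a, 'b) ring_scheme \<Rightarrow> ('a \<Rightarrow> 'a) set \<Rightarrow> ('a, 'b) ring_scheme" where
  "fixed_field F G = F\<lparr>carrier := {z \<in> carrier F. \<forall>f\<in>G. f z = z}\<rparr>"

section \<open>The Hermitian function field\<close>

text \<open>
  \<open>H = K(x, y)\<close> over the field \<open>K\<close> with \<open>q\<^sup>2\<close> elements.  The polynomial \<open>Y\<^sup>q + Y - x\<^sup>q\<^sup>+\<^sup>1\<close> is
  irreducible over \<open>K(x)\<close>, so these conditions determine \<open>H\<close> up to isomorphism over \<open>K\<close>.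
\<close>

definition hermitian_function_field ::
    "nat \<Rightarrow> ('a, 'b) ring_scheme \<Rightarrow> 'a set \<Rightarrow> 'a \<Rightarrow> 'a \<Rightarrow> bool" where
  "hermitian_function_field q H K x y \<longleftrightarrow>
     field H \<and> subfield K H \<and> card K = q\<^sup>2 \<and>
     x \<in> carrier H \<and> y \<in> carrier H \<and> ring.transcendental H K x \<and>
     y [^]\<^bsub>H\<^esub> q \<oplus>\<^bsub>H\<^esub> y = x [^]\<^bsub>H\<^esub> (q + 1) \<and>
     carrier H = generate_field H (K \<union> {x, y})"

end

theory Submission
  imports Defs
begin

text \<open>
  \<open>\<sigma>\<close> acts on the span of \<open>1\<close> and \<open>y\<close>, up to a common denominator, as a linear map with eigenvectors
  \<open>A = 1 + a\<^sup>q y\<close> and \<open>B = 1 - a y\<close>. Hence \<open>s = x/A\<close> is fixed, \<open>t = B/A\<close> is multiplied by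
  \<open>\<omega> = - a\<^sup>q\<^sup>-\<^sup>1\<close>, and the curve becomes \<open>(a + a\<^sup>q) s\<^sup>q\<^sup>+\<^sup>1 = 1 - t\<^sup>q\<^sup>+\<^sup>1\<close>. Moving a rational point
  \<open>(s\<^sub>0, 0)\<close> to infinity gives \<open>v\<^sup>q\<^sup>+\<^sup>1 = u\<^sup>q + u\<close> with \<open>\<sigma> u = u\<close> and \<open>\<sigma> v = \<omega> v\<close>. With \<open>w = v\<^sup>m\<close> and
  \<open>n = (q + 1)/m\<close> the fixed field of \<open>\<G>\<close> is therefore \<open>K(u, w)\<close>, \<open>w\<^sup>n = u\<^sup>q + u\<close>, a superelliptic
  function field of genus \<open>(n - 1)(q - 1)/2\<close>.

  The genus of \<open>w\<^sup>n = f(u)\<close>, with \<open>f\<close> squarefree of degree \<open>d\<close> prime to \<open>n\<close>, rests on the single place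
  \<open>P\<^sub>\<infinity>\<close> over \<open>u = \<infinity>\<close>, where \<open>u\<close> and \<open>w\<close> have poles of the coprime orders \<open>n\<close> and \<open>d\<close>. The functions
  regular elsewhere form \<open>K[u, w]\<close>, so \<open>\<ell>(k P\<^sub>\<infinity>)\<close> counts the monomials \<open>u\<^sup>i w\<^sup>j\<close> with \<open>j < n\<close> and
  \<open>n i + d j \<le> k\<close>. Every divisor lies below some \<open>div\<^sub>0 (h(u)) + j P\<^sub>\<infinity>\<close>, which is equivalent to a multiple
  of \<open>P\<^sub>\<infinity>\<close>, and this is Riemann's inequality. As \<open>K\<close> is finite, dimensions can be computed
  by counting elements; in particular, counting polynomials bounds the residues modulo a nonzero
  element of a valuation ring, which yields discreteness and, with weak approximation, bounds the
  degree of the zero divisor of a function of \<open>u\<close>.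
\<close>

section \<open>Polynomials with coefficients in a subfield\<close>

text \<open>The curve \<open>e s^(q+1) = 1 - t^(q+1)\<close> has the same degree in both variables,
  so it offers no single place at infinity. The rational point \<open>(s0, 0)\<close> is totally
  ramified over the \<open>s\<close>-line; sending it to infinity yields the coprime exponents
  \<open>q + 1\<close> and \<open>q\<close>, and coprimality survives when \<open>q + 1\<close> is
  replaced by its divisor \<open>n\<close>. Coprimality then acts twice. It forces total
  ramification over \<open>u = \<infinity>\<close>, and it makes the pole orders of the terms
  \<open>g_j(u) w^j\<close> distinct modulo \<open>n\<close>. The second fact shows that
  \<open>1, w, ..., w^(n-1)\<close> are independent over \<open>K(u)\<close>, so the irreducibility
  of \<open>w^n = f(u)\<close> comes out as a by-product. The same locales describe \<open>H\<close>
  itself, with exponent \<open>q + 1\<close>, and the fixed field, with exponent \<open>n\<close>.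
  The fixed field is found by averaging over \<open>\<G>\<close>, which is possible because
  \<open>m\<close> divides \<open>q + 1\<close> and so is prime to \<open>p\<close>. Places come
  from arbitrary valuation rings between \<open>K\<close> and the field, hence their discreteness,
  the finiteness of their residue fields and their existence are proved, not assumed.\<close>

definition subring_set :: "'a::field set \<Rightarrow> bool" where
  "subring_set V \<longleftrightarrow> 0 \<in> V \<and> 1 \<in> V \<and> (\<forall>a\<in>V. \<forall>b\<in>V. a + b \<in> V \<and> a * b \<in> V) \<and> (\<forall>a\<in>V. - a \<in> V)"

definition subfield_set :: "'a::field set \<Rightarrow> bool" where
  "subfield_set V \<longleftrightarrow> subring_set V \<and> (\<forall>a\<in>V. inverse a \<in> V)"

lemma subring_set_closed:
  assumes "subring_set V"
  shows "0 \<in> V" "1 \<in> V" "\<And>a b. a \<in> V \<Longrightarrow> b \<in> V \<Longrightarrow> a + b \<in> V"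
    "\<And>a b. a \<in> V \<Longrightarrow> b \<in> V \<Longrightarrow> a * b \<in> V" "\<And>a. a \<in> V \<Longrightarrow> - a \<in> V"
    "\<And>a b. a \<in> V \<Longrightarrow> b \<in> V \<Longrightarrow> a - b \<in> V"
proof -
  show "a - b \<in> V" if "a \<in> V" "b \<in> V" for a b
    using assms that unfolding subring_set_def by (metis diff_conv_add_uminus)
qed (use assms in \<open>auto simp: subring_set_def\<close>)

lemma subring_set_power: "subring_set V \<Longrightarrow> a \<in> V \<Longrightarrow> a ^ k \<in> V"
  by (induction k) (auto intro: subring_set_closed)

lemma subring_set_sum: "subring_set V \<Longrightarrow> (\<And>i. i \<in> A \<Longrightarrow> g i \<in> V) \<Longrightarrow> sum g A \<in> V"
  by (induction A rule: infinite_finite_induct) (auto intro: subring_set_closed)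

lemma subring_set_prod: "subring_set V \<Longrightarrow> (\<And>i. i \<in> A \<Longrightarrow> g i \<in> V) \<Longrightarrow> prod g A \<in> V"
  by (induction A rule: infinite_finite_induct) (auto intro: subring_set_closed)

lemma subfield_set_closed:
  assumes "subfield_set V"
  shows "subring_set V" "\<And>a. a \<in> V \<Longrightarrow> inverse a \<in> V"
    "\<And>a b. a \<in> V \<Longrightarrow> b \<in> V \<Longrightarrow> a / b \<in> V"
  using assms by (auto simp: subfield_set_def divide_inverse intro: subring_set_closed)

definition polys :: "'a::field set \<Rightarrow> 'a poly set" where
  "polys K = {p. \<forall>i. Polynomial.coeff p i \<in> K}"

text \<open>With \<open>degree p < k\<close> the zero polynomial would be missing for
  \<open>k = 0\<close>; bounding the coefficients instead gives exactly \<open>card K ^ k\<close>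
  elements for every \<open>k\<close> when \<open>K\<close> is finite.\<close>

definition polys_lt :: "'a::field set \<Rightarrow> nat \<Rightarrow> 'a poly set" where
  "polys_lt K k = {p \<in> polys K. \<forall>i\<ge>k. Polynomial.coeff p i = 0}"

lemma polys_lt_mono: "k \<le> l \<Longrightarrow> polys_lt K k \<subseteq> polys_lt K l"
  by (auto simp: polys_lt_def)

lemma polys_lt_subset: "polys_lt K k \<subseteq> polys K"
  by (auto simp: polys_lt_def)

lemma polys_in_lt: "p \<in> polys K \<Longrightarrow> Polynomial.degree p < k \<Longrightarrow> p \<in> polys_lt K k"
  by (auto simp: polys_lt_def Polynomial.coeff_eq_0)

lemma polys_lt_iff:
  assumes "p \<noteq> 0"
  shows "p \<in> polys_lt K k \<longleftrightarrow> p \<in> polys K \<and> Polynomial.degree p < k"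
proof
  assume a: "p \<in> polys_lt K k"
  have "Polynomial.coeff p (Polynomial.degree p) \<noteq> 0" using assms by simp
  then show "p \<in> polys K \<and> Polynomial.degree p < k"
    using a by (metis (mono_tags, lifting) mem_Collect_eq not_le_imp_less polys_lt_def)
qed (auto intro: polys_in_lt)

lemma polys_ltE: "p \<in> polys K \<Longrightarrow> \<exists>k. p \<in> polys_lt K k"
  using polys_in_lt by blast

lemma polys_closed:
  assumes "subring_set K"
  shows "0 \<in> polys K" "1 \<in> polys K" "\<And>p q. p \<in> polys K \<Longrightarrow> q \<in> polys K \<Longrightarrow> p + q \<in> polys K"
    "\<And>p q. p \<in> polys K \<Longrightarrow> q \<in> polys K \<Longrightarrow> p * q \<in> polys K" "\<And>p. p \<in> polys K \<Longrightarrow> - p \<in> polys K"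
    "\<And>p q. p \<in> polys K \<Longrightarrow> q \<in> polys K \<Longrightarrow> p - q \<in> polys K"
    "\<And>a p. a \<in> K \<Longrightarrow> p \<in> polys K \<Longrightarrow> smult a p \<in> polys K"
    "\<And>a p. a \<in> K \<Longrightarrow> p \<in> polys K \<Longrightarrow> pCons a p \<in> polys K"
    "\<And>a i. a \<in> K \<Longrightarrow> Polynomial.monom a i \<in> polys K"
  using assms
  by (auto simp: polys_def Polynomial.coeff_1 Polynomial.coeff_mult coeff_pCons split: nat.splits
      intro!: subring_set_sum intro: subring_set_closed)

lemma polys_power: "subring_set K \<Longrightarrow> p \<in> polys K \<Longrightarrow> p ^ i \<in> polys K"
  by (induction i) (auto intro: polys_closed)

lemma polys_sum: "subring_set K \<Longrightarrow> (\<And>i. i \<in> A \<Longrightarrow> g i \<in> polys K) \<Longrightarrow> sum g A \<in> polys K"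
  by (induction A rule: infinite_finite_induct) (auto intro: polys_closed)

lemma polys_prod: "subring_set K \<Longrightarrow> (\<And>i. i \<in> A \<Longrightarrow> g i \<in> polys K) \<Longrightarrow> prod g A \<in> polys K"
  by (induction A rule: infinite_finite_induct) (auto intro: polys_closed)

lemma polys_lt_closed:
  assumes "subring_set K"
  shows "0 \<in> polys_lt K k" "\<And>p q. p \<in> polys_lt K k \<Longrightarrow> q \<in> polys_lt K k \<Longrightarrow> p + q \<in> polys_lt K k"
    "\<And>p q. p \<in> polys_lt K k \<Longrightarrow> q \<in> polys_lt K k \<Longrightarrow> p - q \<in> polys_lt K k"
  using polys_closed[OF assms] by (auto simp: polys_lt_def)

text \<open>\<open>polys_lt K (Suc k)\<close> is degree at most \<open>k\<close>; only one factor
  carries the \<open>Suc\<close>, so the bounds add up without a correction.\<close>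

lemma polys_lt_mult:
  assumes "subring_set K" "p \<in> polys_lt K (Suc k)" "q \<in> polys_lt K l"
  shows "p * q \<in> polys_lt K (k + l)"
proof (cases "p = 0 \<or> q = 0")
  case False
  then have "Polynomial.degree p < Suc k" "Polynomial.degree q < l"
    using assms polys_lt_iff by blast+
  then have "Polynomial.degree (p * q) < k + l"
    using False by (simp add: Polynomial.degree_mult_eq)
  moreover have "p * q \<in> polys K"
    using assms polys_lt_subset polys_closed(4) by blast
  ultimately show ?thesis by (rule polys_in_lt[rotated])
qed (use assms in \<open>auto intro: polys_lt_closed\<close>)

lemma polys_lt_one: "subring_set K \<Longrightarrow> 1 \<in> polys_lt K (Suc k)"
  by (auto simp: polys_lt_def polys_closed Polynomial.coeff_1)

lemma polys_lt_power:
  assumes "subring_set K" "p \<in> polys_lt K (Suc k)"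
  shows "p ^ l \<in> polys_lt K (Suc (l * k))"
proof (induction l)
  case 0
  then show ?case using polys_lt_one[OF assms(1)] by simp
next
  case (Suc l)
  then show ?case using polys_lt_mult[OF assms Suc] by simp
qed

lemma finite_card_polys_lt:
  assumes "subring_set K" "finite K"
  shows "finite (polys_lt K k) \<and> card (polys_lt K k) = card K ^ k"
proof (induction k)
  case 0
  have "polys_lt K 0 = {0}"
    using polys_closed(1)[OF assms(1)] by (auto simp: polys_lt_def poly_eq_iff)
  then show ?case by simp
next
  case (Suc k)
  have "polys_lt K (Suc k) = (\<lambda>(a, p). pCons a p) ` (K \<times> polys_lt K k)"
  proof (intro equalityI subsetI)
    fix p assume p: "p \<in> polys_lt K (Suc k)"
    obtain a r where ar: "p = pCons a r" by (cases p)
    have "Polynomial.coeff p 0 = a" "\<And>i. Polynomial.coeff p (Suc i) = Polynomial.coeff r i" by (auto simp: ar)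
    moreover have "Polynomial.coeff p i \<in> K" "i \<ge> Suc k \<Longrightarrow> Polynomial.coeff p i = 0" for i
      using p by (auto simp: polys_lt_def polys_def)
    ultimately have "a \<in> K" "Polynomial.coeff r i \<in> K" "i \<ge> k \<Longrightarrow> Polynomial.coeff r i = 0" for i
      by (metis, metis, metis Suc_le_mono)
    then have "a \<in> K" "r \<in> polys_lt K k" by (auto simp: polys_lt_def polys_def)
    then show "p \<in> (\<lambda>(a, p). pCons a p) ` (K \<times> polys_lt K k)" using ar by auto
  qed (use polys_closed(8)[OF assms(1)] in \<open>auto simp: polys_lt_def coeff_pCons split: nat.splits\<close>)
  moreover have "inj_on (\<lambda>(a, p). pCons a p) (K \<times> polys_lt K k)"
    by (auto simp: inj_on_def)
  ultimately show ?case
    using Suc assms(2) by (simp add: card_image card_cartesian_product)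
qed

text \<open>Division is carried out over \<open>K\<close> because polynomial division in the ambient
  type would not show that quotient and remainder have coefficients in \<open>K\<close>. The case of
  degree \<open>0\<close> stands apart: cancelling the leading term of a constant does not lower its
  degree.\<close>

lemma polys_div_mod_ex:
  assumes K: "subfield_set K" and "q \<in> polys K" "q \<noteq> 0" "p \<in> polys K"
  shows "\<exists>s\<in>polys K. \<exists>r\<in>polys_lt K (Polynomial.degree q). p = q * s + r"
  using assms(4)
proof (induction "Polynomial.degree p" arbitrary: p rule: less_induct)
  case less
  note Kr = subfield_set_closed(1)[OF K]
  show ?case
  proof (cases "Polynomial.degree p < Polynomial.degree q")
    case True
    then have "p \<in> polys_lt K (Polynomial.degree q)" using less(2) polys_in_lt by blast
    then show ?thesis using polys_closed(1)[OF Kr]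
      by (intro bexI[of _ 0] bexI[of _ p]) auto
  next
    case False
    show ?thesis
    proof (cases "Polynomial.degree p = 0")
      case True
      then have "Polynomial.degree q = 0" using False by simp
      then obtain a b where ab: "p = [:a:]" "q = [:b:]" "b \<noteq> 0"
        using True assms(3) by (metis degree_eq_zeroE pCons_eq_0_iff)
      have "a \<in> K" "b \<in> K"
        using less(2) assms(2) unfolding polys_def ab by (auto dest: spec[of _ 0])
      then have "[:a / b:] \<in> polys K"
        using polys_closed(8)[OF Kr _ polys_closed(1)[OF Kr]] subfield_set_closed(3)[OF K] by blast
      then show ?thesis using ab polys_lt_closed(1)[OF Kr]
        by (intro bexI[of _ "[:a/b:]"] bexI[of _ 0]) auto
    next
      case pos: False
      define c where "c = lead_coeff p / lead_coeff q"
      define m where "m = Polynomial.degree p - Polynomial.degree q"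
      have "c \<in> K" using less(2) assms(2) subfield_set_closed(3)[OF K] by (auto simp: c_def polys_def)
      then have mK: "Polynomial.monom c m \<in> polys K" by (rule polys_closed(9)[OF Kr])
      define p' where "p' = p - q * Polynomial.monom c m"
      have p'K: "p' \<in> polys K" unfolding p'_def
        using mK less(2) assms(2) polys_closed(4,6)[OF Kr] by blast
      have p0: "p \<noteq> 0" using pos by auto
      then have c0: "c \<noteq> 0" using assms(3) by (simp add: c_def)
      have deg: "Polynomial.degree (q * Polynomial.monom c m) = Polynomial.degree p"
      proof -
        have "Polynomial.monom c m \<noteq> 0" "Polynomial.degree (Polynomial.monom c m) = m"
          using c0 by (auto simp: Polynomial.degree_monom_eq)
        then show ?thesis
          using False Polynomial.degree_mult_eq[OF assms(3)] unfolding m_def by presburger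
      qed
      have "lead_coeff (q * Polynomial.monom c m) = lead_coeff p"
        unfolding Polynomial.lead_coeff_mult Polynomial.lead_coeff_monom
        using assms(3) by (simp add: c_def)
      then have "Polynomial.coeff p' (Polynomial.degree p) = 0" using deg by (simp add: p'_def)
      moreover have "Polynomial.degree p' \<le> Polynomial.degree p"
        unfolding p'_def using deg by (metis Polynomial.degree_diff_le order_refl)
      ultimately have "Polynomial.degree p' < Polynomial.degree p"
        using pos by (metis Polynomial.leading_coeff_0_iff le_neq_implies_less Polynomial.degree_0)
      from less(1)[OF this p'K] obtain s r where sr: "s \<in> polys K" "r \<in> polys_lt K (Polynomial.degree q)"
        "p' = q * s + r" by blast
      have "p = q * (Polynomial.monom c m + s) + r"
        using sr(3) by (simp add: p'_def algebra_simps)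
      then show ?thesis using sr(1,2) polys_closed(3)[OF Kr mK] by blast
    qed
  qed
qed

text \<open>The remainder is divisible by \<open>q\<close> and of smaller degree, hence
  \<open>0\<close>; thus divisibility over the ambient field already has a cofactor over
  \<open>K\<close>.\<close>

lemma polys_dvdE:
  assumes K: "subfield_set K" and "q \<in> polys K" "q \<noteq> 0" "p \<in> polys K" "q dvd p"
  shows "\<exists>s\<in>polys K. p = q * s"
proof -
  obtain s r where sr: "s \<in> polys K" "r \<in> polys_lt K (Polynomial.degree q)" "p = q * s + r"
    using polys_div_mod_ex[OF assms(1-4)] by blast
  have "q dvd r" using assms(5) sr(3) by (metis dvd_add_right_iff dvd_triv_left)
  then have "r = 0" using sr(2) polys_lt_iff[of r K] by (metis Polynomial.dvd_imp_degree_le leD)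
  then show ?thesis using sr by auto
qed

section \<open>Divisibility and root multiplicities over the algebraic closure\<close>

lemma map_poly_to_ac_mult: "map_poly to_ac (p * q) = map_poly to_ac p * map_poly to_ac q"
  by (rule poly_eqI) (simp add: Polynomial.coeff_map_poly Polynomial.coeff_mult to_ac_sum)

lemma map_poly_to_ac_0_iff [simp]: "map_poly to_ac p = 0 \<longleftrightarrow> p = 0"
  by (simp add: poly_eq_iff Polynomial.coeff_map_poly)

lemma degree_map_poly_to_ac [simp]: "Polynomial.degree (map_poly to_ac p) = Polynomial.degree p"
  by (rule Polynomial.degree_map_poly) simp

text \<open>Over an algebraically closed field divisibility is a comparison of root multiplicities;
  common linear factors are split off one at a time.\<close>

lemma dvd_of_order_le:
  fixes h g :: "'b::alg_closed_field poly"
  assumes "h \<noteq> 0" "g \<noteq> 0" "\<And>a. Polynomial.order a h \<le> Polynomial.order a g"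
  shows "h dvd g"
  using assms
proof (induction "Polynomial.degree h" arbitrary: h g)
  case 0
  then show ?case by (metis Polynomial.is_unit_iff_degree unit_imp_dvd)
next
  case (Suc k)
  then obtain a where a: "poly h a = 0" using alg_closed_imp_poly_has_root[of h] by auto
  then have "poly g a = 0"
    using Suc.prems by (metis Polynomial.order_gt_0_iff order_less_le_trans)
  then obtain h' g' where e: "h = [:-a, 1:] * h'" "g = [:-a, 1:] * g'"
    using a by (metis Polynomial.poly_eq_0_iff_dvd dvdE)
  then have n0: "h' \<noteq> 0" "g' \<noteq> 0" "[:-a, 1:] * h' \<noteq> 0" "[:-a, 1:] * g' \<noteq> 0"
    using Suc.prems by auto
  have "Polynomial.order b h' \<le> Polynomial.order b g'" for b
    using Suc.prems(3)[of b] unfolding e Polynomial.order_mult[OF n0(3)] Polynomial.order_mult[OF n0(4)]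
    by simp
  moreover have "k = Polynomial.degree h'"
    using Suc(2) Polynomial.degree_mult_eq[of "[:-a, 1:]" h'] n0(1) unfolding e by auto
  ultimately have "h' dvd g'" using Suc(1) n0 by blast
  then show ?case unfolding e by (rule mult_dvd_mono[OF dvd_refl])
qed

text \<open>Division with remainder is done before passing to the closure, and a remainder of too
  small degree must vanish there, so divisibility descends.\<close>

lemma dvd_of_dvd_map_to_ac:
  assumes "map_poly to_ac h dvd map_poly to_ac g"
  shows "h dvd g"
proof (cases "h = 0")
  case True
  then show ?thesis using assms by simp
next
  case False
  have U: "subfield_set (UNIV :: 'a set)" by (simp add: subfield_set_def subring_set_def)
  obtain s r where sr: "r \<in> polys_lt UNIV (Polynomial.degree h)" "g = h * s + r"
    using polys_div_mod_ex[OF U _ False, of g] by (auto simp: polys_def)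
  have "map_poly to_ac g = map_poly to_ac h * map_poly to_ac s + map_poly to_ac r"
    unfolding sr(2) map_poly_to_ac_mult[symmetric]
    by (rule poly_eqI) (simp add: Polynomial.coeff_map_poly)
  then have "map_poly to_ac h dvd map_poly to_ac r"
    using assms by (metis dvd_add_right_iff dvd_triv_left)
  then have "r = 0" using sr(1) polys_lt_iff[of r UNIV]
    by (metis Polynomial.dvd_imp_degree_le leD map_poly_to_ac_0_iff degree_map_poly_to_ac)
  then show ?thesis using sr by simp
qed

text \<open>
  The exponent \<open>m N\<close> of \<open>f\<close> grows at a rate below \<open>1\<close>, so it cannot cancel a simple zero of \<open>h\<close>.
\<close>

lemma dvd_of_power_dvd:
  fixes d g h f :: "'a::field poly"
  assumes h0: "h \<noteq> 0" and d0: "d \<noteq> 0" and f: "rsquarefree (map_poly to_ac f)"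
    and n: "n > 0" and m: "n * m \<le> (n - 1) * N" and N: "N > n * Polynomial.degree d"
    and dvd: "h ^ N dvd d * g ^ N * f ^ m"
  shows "h dvd g"
proof (cases "g = 0")
  case False
  let ?m = "map_poly to_ac"
  have f0: "f \<noteq> 0" using f by (auto simp: rsquarefree_def)
  have "Polynomial.order a (?m h) \<le> Polynomial.order a (?m g)" for a
  proof (rule ccontr)
    let ?o = "\<lambda>p. Polynomial.order a (?m p)"
    have opow: "?o (p ^ k) = k * ?o p" if "p \<noteq> 0" for p k
      using that by (induction k) (auto simp: map_poly_to_ac_mult Polynomial.order_mult)
    assume "\<not> ?o h \<le> ?o g"
    then have lt: "?o h \<ge> ?o g + 1" by simp
    obtain s where s: "d * g ^ N * f ^ m = h ^ N * s" using dvd by blast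
    have s0: "s \<noteq> 0" using s d0 False f0 h0 by auto
    have of1: "?o f \<le> 1" using f unfolding rsquarefree_def by (metis le_refl zero_le_one le_numeral_extra(4) order_eq_refl)
    have "?o (d * g ^ N * f ^ m) = ?o d + N * ?o g + m * ?o f"
      using d0 False f0 by (simp add: map_poly_to_ac_mult Polynomial.order_mult opow)
    moreover have "?o (h ^ N * s) = N * ?o h + ?o s"
      using h0 s0 by (simp add: map_poly_to_ac_mult Polynomial.order_mult opow)
    moreover have "?o d \<le> Polynomial.degree d"
      using Polynomial.order_degree[of "?m d" a] d0 by simp
    moreover have "m * ?o f \<le> m" using of1 by (cases "?o f") auto
    moreover have "N * ?o h \<ge> N * ?o g + N" using lt
      by (metis add_mult_distrib2 mult.right_neutral mult_le_mono2)
    ultimately have "N \<le> Polynomial.degree d + m" unfolding s by linarith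
    then have "n * N \<le> n * Polynomial.degree d + n * m"
      by (metis add_mult_distrib2 mult_le_mono2)
    then have "n * N < N + (n - 1) * N" using m N by linarith
    then show False using n by (simp add: algebra_simps flip: mult_Suc)
  qed
  then show ?thesis
    using dvd_of_dvd_map_to_ac dvd_of_order_le[of "?m h" "?m g"] h0 False by auto
qed simp

section \<open>Function fields \<open>w\<^sup>n = f(u)\<close>\<close>

locale finite_subfield =
  fixes K :: "'a::field set"
  assumes subfield_K: "subfield_set K" and finite_K: "finite K"
begin

lemma subring_K: "subring_set K"
  using subfield_K by (rule subfield_set_closed)

lemmas K_polys = polys_closed[OF subring_K] polys_power[OF subring_K]

lemma card_K_gt_1: "card K > 1"
proof -
  have "{0, 1} \<subseteq> K" using subring_set_closed(1,2)[OF subring_K] by simp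
  then have "card {0, 1::'a} \<le> card K" using finite_K card_mono by blast
  then show ?thesis by simp
qed

end

text \<open>Transcendence of \<open>u\<close> is added only in the next locale, so that
  \<open>R\<close> can first be used to derive it for the Hermitian field
  (\<open>finite_R_of_algebraic\<close>).\<close>

locale integral_ext = finite_subfield K for K :: "'a::field set" +
  fixes u w :: 'a and f :: "'a poly" and n :: nat
  assumes n_pos: "n > 0" and f_K: "f \<in> polys K" and w_pow: "w ^ n = poly f u"
begin

text \<open>Coordinates with respect to \<open>1, w, ..., w^(n-1)\<close>. Nothing is claimed yet
  about uniqueness, which appears as \<open>coord_inj\<close> once the pole orders at infinity are
  known.\<close>

definition coord :: "(nat \<Rightarrow> 'a poly) \<Rightarrow> 'a" where
  "coord g = (\<Sum>j<n. poly (g j) u * w ^ j)"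

definition R :: "'a set" where
  "R = coord ` {g. \<forall>j. g j \<in> polys K}"

text \<open>A filtration of \<open>R\<close> by finite sets. Its growth, at most
  \<open>card K ^ (k * n)\<close>, replaces the degree of \<open>F\<close> over \<open>K(u)\<close>
  in the later estimates.\<close>

definition Rlt :: "nat \<Rightarrow> 'a set" where
  "Rlt k = coord ` {g. \<forall>j. g j \<in> polys_lt K k}"

lemma coord_add: "coord (\<lambda>j. g j + h j) = coord g + coord h"
  by (simp add: coord_def sum.distrib algebra_simps)

lemma coord_diff: "coord (\<lambda>j. g j - h j) = coord g - coord h"
  by (simp add: coord_def sum_subtractf algebra_simps)

lemma coord_smult: "coord (\<lambda>j. p * g j) = poly p u * coord g"
  by (simp add: coord_def sum_distrib_left algebra_simps)

lemma coord_cong: "(\<And>j. j < n \<Longrightarrow> g j = h j) \<Longrightarrow> coord g = coord h"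
  by (simp add: coord_def)

lemma coord_single: "j < n \<Longrightarrow> coord (\<lambda>i. if i = j then p else 0) = poly p u * w ^ j"
proof -
  assume j: "j < n"
  have "coord (\<lambda>i. if i = j then p else 0) = (\<Sum>i<n. if i = j then poly p u * w ^ i else 0)"
    unfolding coord_def by (rule sum.cong) auto
  then show ?thesis using j by simp
qed

lemma w_pow_reduce: "w ^ i = poly (f ^ (i div n)) u * w ^ (i mod n)"
proof -
  have "w ^ i = w ^ (n * (i div n) + i mod n)" by simp
  also have "\<dots> = (w ^ n) ^ (i div n) * w ^ (i mod n)" by (simp only: power_add power_mult)
  finally show ?thesis by (simp add: w_pow)
qed

lemma coord_in_R: "(\<And>j. g j \<in> polys K) \<Longrightarrow> coord g \<in> R"
  by (auto simp: R_def)

lemma R_monom: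
  assumes "p \<in> polys K"
  shows "poly p u * w ^ i \<in> R"
proof -
  have "poly p u * w ^ i = poly (p * f ^ (i div n)) u * w ^ (i mod n)"
    by (subst w_pow_reduce) simp
  also have "\<dots> = coord (\<lambda>j. if j = i mod n then p * f ^ (i div n) else 0)"
    using n_pos by (intro coord_single[symmetric]) auto
  also have "\<dots> \<in> R"
    using assms f_K K_polys by (intro coord_in_R) auto
  finally show ?thesis .
qed

lemma R_add: "a \<in> R \<Longrightarrow> b \<in> R \<Longrightarrow> a + b \<in> R"
  unfolding R_def using K_polys(3) by (auto simp: coord_add[symmetric] intro!: imageI)

lemma R_poly: "p \<in> polys K \<Longrightarrow> poly p u \<in> R"
  using R_monom[of p 0] by simp

lemma R_sum: "(\<And>i. i \<in> A \<Longrightarrow> g i \<in> R) \<Longrightarrow> sum g A \<in> R"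
  by (induction A rule: infinite_finite_induct) (auto intro: R_add R_poly[of 0, simplified] K_polys)

lemma subring_R: "subring_set R"
proof -
  have "a * b \<in> R" if a: "a \<in> R" and b: "b \<in> R" for a b
  proof -
    obtain g h where gh: "a = coord g" "b = coord h" "\<And>j. g j \<in> polys K" "\<And>j. h j \<in> polys K"
      using a b by (auto simp: R_def)
    have "a * b = (\<Sum>i<n. \<Sum>j<n. poly (g i * h j) u * w ^ (i + j))"
      unfolding gh coord_def sum_product by (simp add: power_add algebra_simps)
    also have "\<dots> \<in> R"
      using gh K_polys by (intro R_sum R_monom) auto
    finally show ?thesis .
  qed
  moreover have "- a \<in> R" if a: "a \<in> R" for a
  proof -
    obtain g where g: "a = coord g" "\<And>j. g j \<in> polys K" using a by (auto simp: R_def)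
    have "- a = coord (\<lambda>j. - g j)" by (simp add: g coord_def sum_negf)
    then show ?thesis using g K_polys by (auto intro: coord_in_R)
  qed
  ultimately show ?thesis
    using R_add R_poly[of 0] R_poly[of 1] K_polys by (auto simp: subring_set_def)
qed

lemmas R_closed = subring_set_closed[OF subring_R] subring_set_power[OF subring_R]

lemma K_subset_R: "K \<subseteq> R"
proof
  fix c assume "c \<in> K"
  then have "poly [:c:] u \<in> R" using K_polys by (intro R_poly) auto
  then show "c \<in> R" by simp
qed

lemma u_in_R: "u \<in> R"
  using R_poly[of "[:0, 1:]"] K_polys subring_set_closed[OF subring_K] by simp

lemma w_in_R: "w \<in> R"
  using R_monom[of 1 1] K_polys by simp

text \<open>Only the values below \<open>n\<close> matter to \<open>coord\<close>; restricting to
  extensional functions makes the index set finite and its cardinality a product.\<close>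

lemma Rlt_PiE: "Rlt k = coord ` (PiE {..<n} (\<lambda>_. polys_lt K k))"
proof (intro equalityI subsetI)
  fix a assume "a \<in> Rlt k"
  then obtain g where "a = coord g" "\<forall>j. g j \<in> polys_lt K k" by (auto simp: Rlt_def)
  moreover have "coord g = coord (restrict g {..<n})" by (rule coord_cong) auto
  ultimately show "a \<in> coord ` (PiE {..<n} (\<lambda>_. polys_lt K k))" by auto
next
  fix a assume "a \<in> coord ` (PiE {..<n} (\<lambda>_. polys_lt K k))"
  then obtain g where g: "a = coord g" "g \<in> PiE {..<n} (\<lambda>_. polys_lt K k)" by auto
  have "coord g = coord (\<lambda>j. if j < n then g j else 0)" by (rule coord_cong) auto
  moreover have "(if j < n then g j else 0) \<in> polys_lt K k" for j
    using g polys_lt_closed(1)[OF subring_K] by auto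
  ultimately show "a \<in> Rlt k" unfolding Rlt_def g(1) by (intro image_eqI) auto
qed

lemma finite_Rlt: "finite (Rlt k)" and card_Rlt_le: "card (Rlt k) \<le> card K ^ (k * n)"
proof -
  have fin: "finite (PiE {..<n} (\<lambda>_. polys_lt K k))"
    by (intro finite_PiE) (auto simp: finite_card_polys_lt[OF subring_K finite_K])
  then show "finite (Rlt k)" unfolding Rlt_PiE by simp
  have "card (Rlt k) \<le> card (PiE {..<n} (\<lambda>_. polys_lt K k))"
    unfolding Rlt_PiE using fin by (rule card_image_le)
  also have "\<dots> = card K ^ (k * n)"
    by (simp add: card_PiE finite_card_polys_lt[OF subring_K finite_K] power_mult)
  finally show "card (Rlt k) \<le> card K ^ (k * n)" .
qed

lemma Rlt_mono: "k \<le> l \<Longrightarrow> Rlt k \<subseteq> Rlt l"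
  unfolding Rlt_def using polys_lt_mono by blast

lemma R_in_Rlt: "a \<in> R \<Longrightarrow> \<exists>k. a \<in> Rlt k"
proof -
  assume "a \<in> R"
  then obtain g where g: "a = coord g" "\<And>j. g j \<in> polys K" by (auto simp: R_def)
  have "\<exists>k. g j \<in> polys_lt K k" for j using polys_ltE g(2) by blast
  then obtain k where k: "\<And>j. g j \<in> polys_lt K (k j)" by metis
  define M where "M = (\<Sum>j<n. k j)"
  have "g j \<in> polys_lt K M" if "j < n" for j
  proof -
    have "k j \<le> M" unfolding M_def using that by (intro member_le_sum) auto
    then show ?thesis using k polys_lt_mono by blast
  qed
  then have "restrict g {..<n} \<in> PiE {..<n} (\<lambda>_. polys_lt K M)" by auto
  moreover have "coord g = coord (restrict g {..<n})" by (rule coord_cong) auto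
  ultimately show ?thesis unfolding Rlt_PiE g(1) by blast
qed

lemma Rlt_subset: "Rlt k \<subseteq> R"
  unfolding Rlt_def R_def using polys_lt_subset by blast

lemma Rlt_closed:
  "a \<in> Rlt k \<Longrightarrow> b \<in> Rlt k \<Longrightarrow> a + b \<in> Rlt k"
  "a \<in> Rlt k \<Longrightarrow> b \<in> Rlt k \<Longrightarrow> a - b \<in> Rlt k"
  "0 \<in> Rlt k"
proof -
  show "a + b \<in> Rlt k" if "a \<in> Rlt k" "b \<in> Rlt k"
    using that polys_lt_closed(2)[OF subring_K]
    unfolding Rlt_def by (auto simp: coord_add[symmetric] intro!: imageI)
  show "a - b \<in> Rlt k" if "a \<in> Rlt k" "b \<in> Rlt k"
    using that polys_lt_closed(3)[OF subring_K]
    unfolding Rlt_def by (auto simp: coord_diff[symmetric] intro!: imageI)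
  have "0 = coord (\<lambda>_. 0)" by (simp add: coord_def)
  then show "0 \<in> Rlt k" unfolding Rlt_def using polys_lt_closed(1)[OF subring_K] by auto
qed

lemma Rlt_sum: "(\<And>i. i \<in> A \<Longrightarrow> g i \<in> Rlt k) \<Longrightarrow> sum g A \<in> Rlt k"
  by (induction A rule: infinite_finite_induct) (auto intro: Rlt_closed)

lemma Rlt_mult:
  assumes "p \<in> polys_lt K (Suc k)" "a \<in> Rlt l"
  shows "poly p u * a \<in> Rlt (k + l)"
proof -
  obtain g where g: "a = coord g" "\<And>j. g j \<in> polys_lt K l" using assms(2) by (auto simp: Rlt_def)
  have "poly p u * a = coord (\<lambda>j. p * g j)" by (simp add: g coord_smult)
  then show ?thesis unfolding Rlt_def
    using polys_lt_mult[OF subring_K assms(1)] g(2) by auto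
qed

lemma Rlt_mult':
  assumes "p \<in> polys_lt K k" "a \<in> Rlt l"
  shows "poly p u * a \<in> Rlt (k + l)"
  using Rlt_mult[of p k a l] polys_lt_mono[of k "Suc k"] assms by auto

lemma common_Rlt: "finite Z \<Longrightarrow> Z \<subseteq> R \<Longrightarrow> \<exists>C. Z \<subseteq> Rlt C"
proof (induction Z rule: finite_induct)
  case (insert z Z)
  then obtain C C' where "Z \<subseteq> Rlt C" "z \<in> Rlt C'" using R_in_Rlt by force
  then show ?case using Rlt_mono[of C "max C C'"] Rlt_mono[of C' "max C C'"] by (intro exI[of _ "max C C'"]) auto
qed simp

end

section \<open>The fraction field of \<open>R\<close> and counting modulo a rational function of
  \<open>u\<close>\<close>

locale transcendental_ext = integral_ext K u w f n
  for K :: "'a::field set" and u w :: 'a and f :: "'a poly" and n :: nat +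
  assumes transcendental_u: "\<And>p. p \<in> polys K \<Longrightarrow> poly p u = 0 \<Longrightarrow> p = 0"
begin

text \<open>The fraction field of \<open>R\<close>. Denominators from \<open>K[u]\<close> suffice
  because each nonzero element of \<open>R\<close> divides a nonzero element of \<open>K[u]\<close>
  (\<open>R_norm\<close>).\<close>

definition F :: "'a set" where
  "F = {z / poly d u | z d. z \<in> R \<and> d \<in> polys K \<and> d \<noteq> 0}"

lemma poly_u_nz: "d \<in> polys K \<Longrightarrow> d \<noteq> 0 \<Longrightarrow> poly d u \<noteq> 0"
  using transcendental_u by blast

lemma FI: "z \<in> R \<Longrightarrow> d \<in> polys K \<Longrightarrow> d \<noteq> 0 \<Longrightarrow> z / poly d u \<in> F"
  unfolding F_def by blast

lemma R_subset_F: "R \<subseteq> F"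
  using FI[of _ 1] K_polys by auto

lemma F_denominator: "z \<in> F \<Longrightarrow> \<exists>d\<in>polys K. d \<noteq> 0 \<and> poly d u * z \<in> R"
  unfolding F_def using poly_u_nz by fastforce

text \<open>
  Pigeonhole: the powers \<open>1, z, \<dots>, z\<^sup>n\<close> satisfy a linear relation over \<open>K[u]\<close>, because polynomial
  combinations of them outnumber the elements of \<open>R\<close> that they can produce.
\<close>

lemma R_relation:
  assumes z: "z \<in> R"
  shows "\<exists>h. (\<forall>i. h i \<in> polys K) \<and> (\<exists>i\<le>n. h i \<noteq> 0) \<and> (\<Sum>i\<le>n. poly (h i) u * z ^ i) = 0"
proof -
  obtain C where C: "(\<lambda>i. z ^ i) ` {..n} \<subseteq> Rlt C"
    using common_Rlt[of "(\<lambda>i. z ^ i) ` {..n}"] R_closed(7)[OF z] by auto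
  define k where "k = C * n + 1"
  define D where "D = PiE {..n} (\<lambda>_. polys_lt K k)"
  define \<psi> where "\<psi> = (\<lambda>h. \<Sum>i\<le>n. poly (h i) u * z ^ i)"
  have finD: "finite D" unfolding D_def
    by (intro finite_PiE) (auto simp: finite_card_polys_lt[OF subring_K finite_K])
  have "card D = card K ^ (k * Suc n)"
    by (simp add: D_def card_PiE finite_card_polys_lt[OF subring_K finite_K] flip: power_mult power_Suc)
  moreover have "\<psi> ` D \<subseteq> Rlt (k + C)"
    unfolding \<psi>_def D_def using C by (auto intro!: Rlt_sum Rlt_mult')
  then have "card (\<psi> ` D) \<le> card K ^ ((k + C) * n)"
    using card_mono[OF finite_Rlt] card_Rlt_le order_trans by blast
  moreover have "card K ^ ((k + C) * n) < card K ^ (k * Suc n)"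
    using card_K_gt_1 by (intro power_strict_increasing) (auto simp: k_def algebra_simps)
  ultimately have "\<not> inj_on \<psi> D" using card_image[of \<psi> D] by linarith
  then obtain h1 h2 where h: "h1 \<in> D" "h2 \<in> D" "h1 \<noteq> h2" "\<psi> h1 = \<psi> h2" by (auto simp: inj_on_def)
  define h where "h i = (if i \<le> n then h1 i - h2 i else 0)" for i
  have "\<exists>i\<le>n. h i \<noteq> 0"
  proof (rule ccontr)
    assume "\<not> ?thesis"
    then have "h1 i = h2 i" if "i \<in> {..n}" for i using that by (auto simp: h_def)
    then show False using h(1-3) unfolding D_def by (metis PiE_ext)
  qed
  moreover have "h i \<in> polys K" for i
  proof -
    have "h1 i \<in> polys K \<and> h2 i \<in> polys K" if "i \<le> n"
      using h(1,2) polys_lt_subset that unfolding D_def by fast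
    then show ?thesis unfolding h_def using K_polys(1,6) by simp
  qed
  moreover have "(\<Sum>i\<le>n. poly (h i) u * z ^ i) = 0"
  proof -
    have "(\<Sum>i\<le>n. poly (h i) u * z ^ i) = \<psi> h1 - \<psi> h2"
      unfolding \<psi>_def sum_subtractf[symmetric] by (intro sum.cong) (auto simp: h_def algebra_simps)
    then show ?thesis using h(4) by simp
  qed
  ultimately show ?thesis by blast
qed

text \<open>Divide the relation of \<open>R_relation\<close> by the lowest power of \<open>z\<close>
  that occurs: the constant term that remains is a multiple of \<open>z\<close> in \<open>R\<close>.
  The cofactor plays the part of the other conjugates in a norm.\<close>

lemma R_norm:
  assumes z: "z \<in> R" "z \<noteq> 0"
  shows "\<exists>h\<in>R. \<exists>d\<in>polys K. d \<noteq> 0 \<and> z * h = poly d u"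
proof -
  obtain h where h: "\<And>i. h i \<in> polys K" "\<exists>i\<le>n. h i \<noteq> 0" "(\<Sum>i\<le>n. poly (h i) u * z ^ i) = 0"
    using R_relation[OF z(1)] by blast
  define i0 where "i0 = (LEAST i. i \<le> n \<and> h i \<noteq> 0)"
  have i0: "i0 \<le> n" "h i0 \<noteq> 0" using LeastI_ex[OF h(2)] by (auto simp: i0_def)
  have lt: "h i = 0" if "i < i0" for i
    using not_less_Least[of i "\<lambda>i. i \<le> n \<and> h i \<noteq> 0"] that i0 by (auto simp: i0_def)
  define s where "s = (\<Sum>i\<in>{Suc i0..n}. poly (h i) u * z ^ (i - Suc i0))"
  have "{..n} = {..<i0} \<union> insert i0 {Suc i0..n}" using i0 by auto
  then have "(\<Sum>i\<le>n. poly (h i) u * z ^ i) = (\<Sum>i\<in>insert i0 {Suc i0..n}. poly (h i) u * z ^ i)"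
    using lt by (subst sum.mono_neutral_right[of "{..n}" "insert i0 {Suc i0..n}"]) (auto simp: i0)
  also have "\<dots> = poly (h i0) u * z ^ i0 + (\<Sum>i\<in>{Suc i0..n}. poly (h i) u * z ^ i)"
    by simp
  also have "(\<Sum>i\<in>{Suc i0..n}. poly (h i) u * z ^ i) = (\<Sum>i\<in>{Suc i0..n}. z ^ i0 * (z * (poly (h i) u * z ^ (i - Suc i0))))"
  proof (intro sum.cong refl)
    fix i assume "i \<in> {Suc i0..n}"
    then have "z ^ i = z ^ (i0 + (1 + (i - Suc i0)))" by simp
    then have "z ^ i = z ^ i0 * (z * z ^ (i - Suc i0))" by (simp only: power_add power_one_right)
    then show "poly (h i) u * z ^ i = z ^ i0 * (z * (poly (h i) u * z ^ (i - Suc i0)))" by simp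
  qed
  also have "\<dots> = z ^ i0 * (z * s)" by (simp add: s_def sum_distrib_left)
  finally have "z ^ i0 * (poly (h i0) u + z * s) = 0" using h(3) by (simp add: algebra_simps)
  then have "z * (- s) = poly (h i0) u" using z(2) by (simp add: eq_neg_iff_add_eq_0 add.commute neg_eq_iff_add_eq_0)
  moreover have "- s \<in> R" unfolding s_def
    by (intro R_closed(5) R_sum R_closed(4) R_poly
        R_closed(7) z h(1))
  ultimately show ?thesis using h(1) i0 by blast
qed

lemma subfield_F: "subfield_set F"
proof -
  have add: "a + b \<in> F" and mul: "a * b \<in> F" if ab: "a \<in> F" "b \<in> F" for a b
  proof -
    obtain z d z' d' where zd: "a = z / poly d u" "b = z' / poly d' u" "z \<in> R" "z' \<in> R"
      "d \<in> polys K" "d' \<in> polys K" "d \<noteq> 0" "d' \<noteq> 0"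
      using ab by (auto simp: F_def)
    have n0: "poly d u \<noteq> 0" "poly d' u \<noteq> 0" using zd poly_u_nz by auto
    have "a + b = (z * poly d' u + z' * poly d u) / poly (d * d') u"
      using n0 by (simp add: zd field_simps)
    moreover have "z * poly d' u + z' * poly d u \<in> R"
      using zd by (intro R_closed(3,4) R_poly)
    moreover have dd: "d * d' \<in> polys K" "d * d' \<noteq> 0" using zd K_polys by auto
    ultimately show "a + b \<in> F" using FI[of _ "d * d'"] by simp
    have "a * b = (z * z') / poly (d * d') u" by (simp add: zd)
    then show "a * b \<in> F" using FI[OF R_closed(4)[OF zd(3,4)] dd] by simp
  qed
  have neg: "- a \<in> F" if "a \<in> F" for a
  proof -
    obtain z d where zd: "a = z / poly d u" "z \<in> R" "d \<in> polys K" "d \<noteq> 0"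
      using \<open>a \<in> F\<close> by (auto simp: F_def)
    then show ?thesis using FI[OF R_closed(5)[OF zd(2)] zd(3,4)] by simp
  qed
  have inv: "inverse a \<in> F" if a: "a \<in> F" for a
  proof (cases "a = 0")
    case False
    obtain z d where zd: "a = z / poly d u" "z \<in> R" "d \<in> polys K" "d \<noteq> 0"
      using a by (auto simp: F_def)
    then obtain h e where he: "h \<in> R" "e \<in> polys K" "e \<noteq> 0" "z * h = poly e u"
      using R_norm[of z] False by auto
    have n0: "poly d u \<noteq> 0" "poly e u \<noteq> 0" "z \<noteq> 0" using zd he poly_u_nz False by auto
    have "inverse a = (poly d u * h) / poly e u"
    proof -
      have "h \<noteq> 0" using he(4) n0 by auto
      then show ?thesis unfolding zd(1) he(4)[symmetric] using n0 by simp
    qed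
    then show ?thesis using FI[OF R_closed(4)[OF R_poly[OF zd(3)] he(1)] he(2,3)] by simp
  qed (use a in simp)
  have "0 \<in> F" "1 \<in> F" using R_closed(1,2) R_subset_F by auto
  then show ?thesis using add mul neg inv by (auto simp: subfield_set_def subring_set_def)
qed

lemma subring_F: "subring_set F"
  using subfield_F by (rule subfield_set_closed)

lemmas F_closed = subring_set_closed[OF subring_F] subring_set_power[OF subring_F]
  subring_set_sum[OF subring_F] subfield_set_closed(2,3)[OF subfield_F]

lemma common_denominator:
  assumes "finite Z" "Z \<subseteq> F"
  shows "\<exists>e\<in>polys K. e \<noteq> 0 \<and> (\<exists>C. \<forall>z\<in>Z. poly e u * z \<in> Rlt C)"
proof -
  obtain d where d: "\<And>z. z \<in> Z \<Longrightarrow> d z \<in> polys K \<and> d z \<noteq> 0 \<and> poly (d z) u * z \<in> R"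
    using F_denominator assms(2) by (metis subsetD)
  define e where "e = prod d Z"
  have "poly e u * z \<in> R" if z: "z \<in> Z" for z
  proof -
    have "e = d z * prod d (Z - {z})" using assms(1) z by (simp add: e_def prod.remove)
    then have "poly e u * z = poly (prod d (Z - {z})) u * (poly (d z) u * z)" by simp
    also have "\<dots> \<in> R"
      using d[OF z] d by (blast intro: R_closed(4) R_poly polys_prod[OF subring_K])
    finally show ?thesis .
  qed
  then obtain C where "(\<lambda>z. poly e u * z) ` Z \<subseteq> Rlt C"
    using common_Rlt[of "(\<lambda>z. poly e u * z) ` Z"] assms(1) by auto
  moreover have "e \<in> polys K" "e \<noteq> 0"
    using d assms(1) by (auto simp: e_def intro: polys_prod[OF subring_K])
  ultimately show ?thesis by blast
qed

text \<open>A constant factor cannot survive high powers: if \<open>N > M\<close>, then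
  \<open>(N / M)^L\<close> is at least \<open>1 + L / M\<close> by Bernoulli, which exceeds
  \<open>A\<close> for \<open>L = (A + 1) * M\<close>.\<close>

lemma le_of_powers_le:
  fixes M N A :: nat
  assumes "\<And>L. N ^ L \<le> A * M ^ L" "M > 0"
  shows "N \<le> M"
proof (rule ccontr)
  assume "\<not> N \<le> M"
  then have "real N / real M \<ge> 1 + 1 / real M"
    using assms(2) by (simp add: field_simps)
  define L where "L = (A + 1) * M"
  have "real N ^ L \<le> real A * real M ^ L" using assms(1)[of L]
    by (metis of_nat_le_iff of_nat_mult of_nat_power)
  then have "(real N / real M) ^ L \<le> real A"
    using assms(2) by (simp add: power_divide field_simps)
  moreover have "(real N / real M) ^ L \<ge> (1 + 1 / real M) ^ L"
    using \<open>real N / real M \<ge> 1 + 1 / real M\<close> by (intro power_mono) auto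
  moreover have "(1 + 1 / real M) ^ L \<ge> 1 + real L * (1 / real M)"
    by (intro Bernoulli_inequality) (auto intro: order_trans[of _ 0])
  moreover have "real L * (1 / real M) = A + 1" using assms(2) by (simp add: L_def)
  ultimately show False by linarith
qed

text \<open>
  The sums \<open>z\<^sub>0 + g z\<^sub>1 + \<dots> + g\<^sup>L\<^sup>-\<^sup>1 z\<^sub>L\<^sub>-\<^sub>1\<close> with digits \<open>z\<^sub>i \<in> Z\<close> are pairwise distinct, and after
  clearing denominators their numerators have degree at most \<open>L\<delta> + O(1)\<close>.
\<close>

lemma incongruent_card_le:
  assumes V: "subring_set V" "V \<subseteq> F" and Z: "finite Z" "Z \<subseteq> V"
    and g: "g = poly f1 u / poly f2 u" "g \<noteq> 0" "g \<in> V"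
    and f12: "f1 \<in> polys_lt K (Suc \<delta>)" "f2 \<in> polys_lt K (Suc \<delta>)"
    and incong: "\<And>z z'. z \<in> Z \<Longrightarrow> z' \<in> Z \<Longrightarrow> (z - z') / g \<in> V \<Longrightarrow> z = z'"
  shows "card Z \<le> card K ^ (n * \<delta>)"
proof -
  obtain e C where e: "e \<in> polys K" "e \<noteq> 0" "\<And>z. z \<in> Z \<Longrightarrow> poly e u * z \<in> Rlt C"
    using common_denominator[OF Z(1)] Z(2) V(2) by blast
  have f2nz: "poly f2 u \<noteq> 0" using g by auto
  have enz: "poly e u \<noteq> 0" using e poly_u_nz by auto
  have "card Z ^ L \<le> card K ^ (C * n) * (card K ^ (n * \<delta>)) ^ L" for L
  proof -
    define D where "D = PiE {..<L} (\<lambda>_. Z)"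
    define \<psi> where "\<psi> = (\<lambda>h. poly e u * poly f2 u ^ L * (\<Sum>l<L. g ^ l * h l))"
    have inj: "inj_on \<psi> D"
    proof (rule inj_onI, rule ccontr)
      fix h h' assume hh: "h \<in> D" "h' \<in> D" "\<psi> h = \<psi> h'" "h \<noteq> h'"
      have hZ: "h l \<in> Z" "h' l \<in> Z" if "l < L" for l using hh(1,2) that by (auto simp: D_def)
      have "\<exists>l. l < L \<and> h l \<noteq> h' l" using hh(1,2,4) unfolding D_def by (metis PiE_ext lessThan_iff)
      define l0 where "l0 = (LEAST l. l < L \<and> h l \<noteq> h' l)"
      have l0: "l0 < L" "h l0 \<noteq> h' l0"
        using LeastI_ex[OF \<open>\<exists>l. l < L \<and> h l \<noteq> h' l\<close>] by (auto simp: l0_def)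
      have lt: "h l = h' l" if "l < l0" for l
        using not_less_Least[of l "\<lambda>l. l < L \<and> h l \<noteq> h' l"] that l0 by (auto simp: l0_def)
      have "(\<Sum>l<L. g ^ l * (h l - h' l)) = 0"
        using hh(3) enz f2nz by (simp add: \<psi>_def algebra_simps sum_subtractf)
      moreover have "(\<Sum>l<L. g ^ l * (h l - h' l)) = (\<Sum>l\<in>insert l0 {Suc l0..<L}. g ^ l * (h l - h' l))"
        using lt l0 by (intro sum.mono_neutral_right) auto
      ultimately have "g ^ l0 * (h l0 - h' l0) + (\<Sum>l\<in>{Suc l0..<L}. g ^ l * (h l - h' l)) = 0"
        by simp
      also have "(\<Sum>l\<in>{Suc l0..<L}. g ^ l * (h l - h' l))
          = (\<Sum>l\<in>{Suc l0..<L}. g ^ l0 * (g * (g ^ (l - Suc l0) * (h l - h' l))))"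
      proof (intro sum.cong refl)
        fix l assume "l \<in> {Suc l0..<L}"
        then have "g ^ l = g ^ (l0 + (1 + (l - Suc l0)))" by simp
        then have "g ^ l = g ^ l0 * (g * g ^ (l - Suc l0))" by (simp only: power_add power_one_right)
        then show "g ^ l * (h l - h' l) = g ^ l0 * (g * (g ^ (l - Suc l0) * (h l - h' l)))" by simp
      qed
      also have "\<dots> = g ^ l0 * (g * (\<Sum>l\<in>{Suc l0..<L}. g ^ (l - Suc l0) * (h l - h' l)))"
        by (simp add: sum_distrib_left)
      finally have "g ^ l0 * ((h l0 - h' l0) + g * (\<Sum>l\<in>{Suc l0..<L}. g ^ (l - Suc l0) * (h l - h' l))) = 0"
        by (simp add: algebra_simps)
      then have "h l0 - h' l0 = g * - (\<Sum>l\<in>{Suc l0..<L}. g ^ (l - Suc l0) * (h l - h' l))"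
        using g(2) by (simp add: add_eq_0_iff2)
      then have "(h l0 - h' l0) / g = - (\<Sum>l\<in>{Suc l0..<L}. g ^ (l - Suc l0) * (h l - h' l))"
        using g(2) by (simp add: field_simps)
      also have "\<dots> \<in> V"
        using hZ Z(2) g(3) by (intro subring_set_closed(4-6)[OF V(1)] subring_set_sum[OF V(1)] subring_set_power[OF V(1)]) auto
      finally show False using incong hZ l0 by blast
    qed
    have "\<psi> ` D \<subseteq> Rlt (L * \<delta> + C)"
    proof (rule image_subsetI)
      fix h assume h: "h \<in> D"
      have "\<psi> h = (\<Sum>l<L. poly (f1 ^ l * f2 ^ (L - l)) u * (poly e u * h l))"
        unfolding \<psi>_def sum_distrib_left
      proof (intro sum.cong refl)
        fix l assume "l \<in> {..<L}"
        then have "poly f2 u ^ L = poly f2 u ^ l * poly f2 u ^ (L - l)" by (simp flip: power_add)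
        then show "poly e u * poly f2 u ^ L * (g ^ l * h l) = poly (f1 ^ l * f2 ^ (L - l)) u * (poly e u * h l)"
          using f2nz by (simp add: g(1) power_divide)
      qed
      also have "\<dots> \<in> Rlt (L * \<delta> + C)"
      proof (intro Rlt_sum Rlt_mult)
        fix l assume l: "l \<in> {..<L}"
        have "f1 ^ l * f2 ^ (L - l) \<in> polys_lt K (l * \<delta> + Suc ((L - l) * \<delta>))"
          using f12 by (intro polys_lt_mult polys_lt_power subring_K)
        then show "f1 ^ l * f2 ^ (L - l) \<in> polys_lt K (Suc (L * \<delta>))"
          using l by (simp add: diff_mult_distrib)
        show "poly e u * h l \<in> Rlt C" using h l e(3) by (auto simp: D_def)
      qed
      finally show "\<psi> h \<in> Rlt (L * \<delta> + C)" .
    qed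
    then have "card D \<le> card (Rlt (L * \<delta> + C))"
      using inj finite_Rlt by (metis card_image card_mono)
    also have "\<dots> \<le> card K ^ ((L * \<delta> + C) * n)" by (rule card_Rlt_le)
    also have "\<dots> = card K ^ (C * n) * (card K ^ (n * \<delta>)) ^ L"
      by (simp add: algebra_simps flip: power_mult power_add)
    finally show ?thesis by (simp add: D_def card_PiE)
  qed
  moreover have "card K ^ (n * \<delta>) > 0" using card_K_gt_1 by simp
  ultimately show ?thesis by (rule le_of_powers_le)
qed

end

section \<open>Valuation rings are discrete\<close>

context transcendental_ext
begin

definition valr :: "'a set \<Rightarrow> bool" where
  "valr V \<longleftrightarrow> subring_set V \<and> K \<subseteq> V \<and> V \<subset> F \<and> (\<forall>z\<in>F. z \<in> V \<or> inverse z \<in> V)"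

text \<open>The nonunits, that is, the place belonging to \<open>V\<close>. Zero is listed
  separately because \<open>inverse 0 = 0\<close> lies in \<open>V\<close>.\<close>

definition mx :: "'a set \<Rightarrow> 'a set" where
  "mx V = {z \<in> V. z = 0 \<or> inverse z \<notin> V}"

lemma R_subset_subring:
  assumes S: "subring_set S" "K \<subseteq> S" "u \<in> S" "w \<in> S"
  shows "R \<subseteq> S"
proof -
  have "poly p u \<in> S" if "p \<in> polys K" for p
    unfolding poly_altdef using that S
    by (intro subring_set_sum subring_set_closed(4) subring_set_power) (auto simp: polys_def)
  then show ?thesis
    unfolding R_def coord_def using S
    by (auto intro!: subring_set_sum subring_set_closed(4)[OF S(1)] subring_set_power)
qed

context
  fixes V assumes V: "valr V"
begin

lemma valr_subring: "subring_set V" and valr_K: "K \<subseteq> V" and valr_F: "V \<subseteq> F"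
  and valr_proper: "V \<noteq> F" and valr_inverse: "z \<in> F \<Longrightarrow> z \<notin> V \<Longrightarrow> inverse z \<in> V"
  using V by (auto simp: valr_def)

lemmas V_closed = subring_set_closed[OF valr_subring] subring_set_power[OF valr_subring]
  subring_set_sum[OF valr_subring]

lemma mx_subset: "mx V \<subseteq> V" and zero_in_mx: "0 \<in> mx V" and one_notin_mx: "1 \<notin> mx V"
  using V_closed by (auto simp: mx_def)

lemma unit_inverse: "z \<in> V \<Longrightarrow> z \<notin> mx V \<Longrightarrow> inverse z \<in> V \<and> z \<noteq> 0"
  by (auto simp: mx_def)

lemma mx_inverse: "z \<in> F \<Longrightarrow> z \<notin> V \<Longrightarrow> inverse z \<in> mx V"
  using valr_inverse V_closed by (auto simp: mx_def)

lemma mx_mult: "a \<in> V \<Longrightarrow> b \<in> mx V \<Longrightarrow> a * b \<in> mx V"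
proof -
  assume ab: "a \<in> V" "b \<in> mx V"
  have "inverse (a * b) \<notin> V" if nz: "a * b \<noteq> 0"
  proof
    assume "inverse (a * b) \<in> V"
    then have "a * inverse (a * b) \<in> V" using ab V_closed(4) by blast
    then have "inverse b \<in> V" using nz by (simp add: field_simps)
    then show False using ab nz by (auto simp: mx_def)
  qed
  then show ?thesis using ab V_closed(4) by (auto simp: mx_def)
qed

lemma mx_neg: "a \<in> mx V \<Longrightarrow> - a \<in> mx V"
  using mx_mult[of "-1" a] V_closed by simp

lemma mx_add: "a \<in> mx V \<Longrightarrow> b \<in> mx V \<Longrightarrow> a + b \<in> mx V"
proof -
  have aux: "a + b \<in> mx V" if ab: "a \<in> mx V" "b \<in> mx V" "b \<noteq> 0" "a / b \<in> V" for a b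
  proof -
    have "a + b = (a / b + 1) * b" using ab(3) by (simp add: field_simps)
    then show ?thesis using mx_mult[of "a / b + 1" b] ab V_closed by simp
  qed
  assume ab: "a \<in> mx V" "b \<in> mx V"
  show ?thesis
  proof (cases "a = 0 \<or> b = 0")
    case False
    have "a \<in> F" "b \<in> F" using ab mx_subset valr_F by auto
    then have "a / b \<in> F" by (rule F_closed(10))
    then consider "a / b \<in> V" | "inverse (a / b) \<in> V" using valr_inverse by blast
    then show ?thesis
      using aux[of a b] aux[of b a] ab False by cases (auto simp: add.commute)
  qed (use ab in auto)
qed

lemma mx_diff: "a \<in> mx V \<Longrightarrow> b \<in> mx V \<Longrightarrow> a - b \<in> mx V"
  using mx_add[of a "-b"] mx_neg by simp

lemma unit_mult: "a \<in> V - mx V \<Longrightarrow> b \<in> V - mx V \<Longrightarrow> a * b \<in> V - mx V"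
proof -
  assume ab: "a \<in> V - mx V" "b \<in> V - mx V"
  then have "inverse a * inverse b \<in> V" "a * b \<noteq> 0" "a * b \<in> V"
    using unit_inverse V_closed(4) by auto
  then show ?thesis by (simp add: mx_def)
qed

lemma unit_power: "a \<in> V - mx V \<Longrightarrow> a ^ k \<in> V - mx V"
  using one_notin_mx V_closed(2) by (induction k) (simp_all add: unit_mult del: Diff_iff, simp)

lemma mx_prime: "a * b \<in> mx V \<Longrightarrow> a \<in> V \<Longrightarrow> b \<in> V \<Longrightarrow> a \<in> mx V \<or> b \<in> mx V"
  using unit_mult[of a b] by auto

text \<open>Otherwise \<open>1 / z\<close> is a nonunit, and \<open>1 = z^k * (1 / z)^k\<close>
  would be one too. This much integral closedness suffices for \<open>w\<close>, whose
  \<open>n\<close>-th power is a polynomial in \<open>u\<close>.\<close>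

lemma integrally_closed_power:
  assumes "z \<in> F" "z ^ k \<in> V" "k > 0"
  shows "z \<in> V"
proof (rule ccontr)
  assume "z \<notin> V"
  then have i: "inverse z \<in> mx V" "z \<noteq> 0" using mx_inverse assms V_closed by auto
  then have "z ^ k * (inverse z ^ (k - 1) * inverse z) \<in> mx V"
    using mx_mult[OF assms(2) mx_mult[OF V_closed(7) i(1)]] i(1) mx_subset by blast
  moreover have "z ^ k * (inverse z ^ (k - 1) * inverse z) = 1"
  proof -
    obtain l where "k = Suc l" using assms(3) gr0_implies_Suc by blast
    then show ?thesis using i by (simp add: field_simps)
  qed
  ultimately show False using one_notin_mx by simp
qed

lemma w_in_V: "u \<in> V \<Longrightarrow> w \<in> V"
proof -
  assume u: "u \<in> V"
  have "poly f u \<in> V" unfolding poly_altdef using f_K u valr_K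
    by (intro V_closed) (auto simp: polys_def)
  then show "w \<in> V" using integrally_closed_power[of w n] w_pow n_pos w_in_R R_subset_F by auto
qed

lemma R_subset_V: "u \<in> V \<Longrightarrow> R \<subseteq> V"
  using R_subset_subring[OF valr_subring valr_K] w_in_V by blast

text \<open>The functions whose pole at \<open>V\<close> is bounded by a power of \<open>u\<close>
  form a subring containing \<open>K\<close> and \<open>u\<close>. It contains \<open>w\<close>
  because the \<open>n\<close>-th power of \<open>w / u^(degree f)\<close> is a polynomial in
  \<open>1 / u\<close>.\<close>

lemma pole_bound:
  assumes "u \<notin> V" "h \<in> R"
  shows "\<exists>N. h / u ^ N \<in> V"
proof -
  have uF: "u \<in> F" using u_in_R R_subset_F by blast
  have iu: "inverse u \<in> V" using valr_inverse uF assms(1) by blast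
  have u0: "u \<noteq> 0" using assms(1) V_closed(1) by blast
  define S where "S = {h \<in> F. \<exists>N. h / u ^ N \<in> V}"
  have up: "h / u ^ M \<in> V" if "h / u ^ N \<in> V" "N \<le> M" for h N M
  proof -
    have "h / u ^ M = (h / u ^ N) * inverse u ^ (M - N)"
      using that(2) u0 by (simp add: power_diff field_simps)
    then show ?thesis using V_closed(4)[OF that(1) V_closed(7)[OF iu]] by simp
  qed
  have "subring_set S" unfolding subring_set_def
  proof (intro conjI ballI)
    fix a b assume "a \<in> S" "b \<in> S"
    then obtain N M where NM: "a / u ^ N \<in> V" "b / u ^ M \<in> V" "a \<in> F" "b \<in> F" by (auto simp: S_def)
    have "(a + b) / u ^ (N + M) \<in> V"
      using up[OF NM(1), of "N + M"] up[OF NM(2), of "N + M"] V_closed(3) by (simp add: add_divide_distrib)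
    then show "a + b \<in> S" using NM F_closed unfolding S_def by blast
    have "(a * b) / u ^ (N + M) = (a / u ^ N) * (b / u ^ M)" by (simp add: power_add)
    then have "(a * b) / u ^ (N + M) \<in> V" using NM V_closed(4) by metis
    then show "a * b \<in> S" using NM F_closed unfolding S_def by blast
  next
    fix a assume "a \<in> S"
    then obtain N where "a / u ^ N \<in> V" "a \<in> F" by (auto simp: S_def)
    then have "- a / u ^ N \<in> V" using V_closed(5) by (metis minus_divide_left)
    then show "- a \<in> S" using \<open>a \<in> F\<close> F_closed unfolding S_def by blast
  next
    have "0 / u ^ 0 \<in> V" "1 / u ^ 0 \<in> V" using V_closed by auto
    then show "0 \<in> S" "1 \<in> S" unfolding S_def using F_closed by blast+
  qed
  moreover have "K \<subseteq> S"
  proof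
    fix a assume "a \<in> K"
    then have "a / u ^ 0 \<in> V" using valr_K by auto
    then show "a \<in> S" using \<open>a \<in> K\<close> K_subset_R R_subset_F unfolding S_def by blast
  qed
  moreover have "u \<in> S"
  proof -
    have "u / u ^ 1 \<in> V" using V_closed u0 by simp
    then show ?thesis using uF unfolding S_def by blast
  qed
  moreover have "w \<in> S"
  proof -
    define M where "M = Polynomial.degree f"
    have "(w / u ^ M) ^ n = (\<Sum>i\<le>M. Polynomial.coeff f i * (u ^ i / u ^ (M * n)))"
      by (simp add: power_divide w_pow poly_altdef M_def sum_divide_distrib flip: power_mult)
    also have "\<dots> = (\<Sum>i\<le>M. Polynomial.coeff f i * inverse u ^ (M * n - i))"
    proof (intro sum.cong refl)
      fix i assume "i \<in> {..M}"
      then have "i \<le> M * n" using n_pos by (cases n) auto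
      then have "u ^ i / u ^ (M * n) = inverse u ^ (M * n - i)" using u0 by (simp add: power_diff field_simps)
      then show "Polynomial.coeff f i * (u ^ i / u ^ (M * n)) = Polynomial.coeff f i * inverse u ^ (M * n - i)" by simp
    qed
    also have "\<dots> \<in> V" using f_K valr_K
      by (intro V_closed(8) V_closed(4) V_closed(7)[OF iu]) (auto simp: polys_def)
    finally have wn: "(w / u ^ M) ^ n \<in> V" .
    have "w \<in> F" using w_in_R R_subset_F by blast
    then have "w / u ^ M \<in> V"
      using integrally_closed_power[OF _ wn n_pos] F_closed(10) F_closed(7)[OF uF] by blast
    then show ?thesis using w_in_R R_subset_F unfolding S_def by blast
  qed
  ultimately show ?thesis using R_subset_subring[of S] assms(2) unfolding S_def by blast
qed

text \<open>Replaces an arbitrary modulus \<open>z\<close> by a multiple that is a rational function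
  of \<open>u\<close>, the only kind to which \<open>incongruent_card_le\<close> applies. Clearing
  the denominator of \<open>1 / z\<close> provides it; where \<open>u\<close> has a pole, dividing
  by a power of \<open>u\<close> restores integrality.\<close>

lemma rational_multiple:
  assumes z: "z \<in> V" "z \<noteq> 0"
  shows "\<exists>f1\<in>polys K. \<exists>f2\<in>polys K. poly f1 u / poly f2 u \<noteq> 0 \<and> poly f1 u / poly f2 u \<in> V \<and>
           (poly f1 u / poly f2 u) / z \<in> V"
proof -
  have "inverse z \<in> F" using F_closed(9) z valr_F by blast
  then obtain d where d: "d \<in> polys K" "d \<noteq> 0" "poly d u * inverse z \<in> R" using F_denominator by blast
  have dR: "poly d u \<in> R" using d R_poly by blast
  have nz: "poly d u \<noteq> 0" using d poly_u_nz by blast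
  show ?thesis
  proof (cases "u \<in> V")
    case True
    then have "poly d u \<in> V" "poly d u * inverse z \<in> V" using R_subset_V dR d(3) by auto
    then show ?thesis using nz d(1) K_polys(2)
      by (intro bexI[of _ d] bexI[of _ 1]) (auto simp: divide_inverse)
  next
    case False
    then have u0: "u \<noteq> 0" using V_closed by auto
    obtain N M where NM: "poly d u / u ^ N \<in> V" "poly d u * inverse z / u ^ M \<in> V"
      using pole_bound[OF False] dR d(3) by meson
    have iu: "inverse u \<in> V" using valr_inverse u_in_R R_subset_F False by blast
    have "poly d u / u ^ (N + M) = (poly d u / u ^ N) * inverse u ^ M"
      "poly d u / u ^ (N + M) / z = (poly d u * inverse z / u ^ M) * inverse u ^ N"
      by (simp_all add: power_add field_simps)
    then have "poly d u / u ^ (N + M) \<in> V" "poly d u / u ^ (N + M) / z \<in> V"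
      using NM V_closed(4,7) iu by metis+
    then show ?thesis using nz d(1) u0 K_polys(9)[OF subring_set_closed(2)[OF subring_K]]
      by (intro bexI[of _ d] bexI[of _ "Polynomial.monom 1 (N + M)"]) (auto simp: Polynomial.poly_monom)
  qed
qed

text \<open>Finiteness of \<open>V / zV\<close>, expressed by systems of incongruent elements: these
  stay incongruent modulo every multiple of \<open>z\<close>.\<close>

lemma incongruent_bounded:
  assumes z: "z \<in> V" "z \<noteq> 0"
  shows "\<exists>B. \<forall>Z. finite Z \<longrightarrow> Z \<subseteq> V \<longrightarrow> (\<forall>x\<in>Z. \<forall>y\<in>Z. (x - y) / z \<in> V \<longrightarrow> x = y) \<longrightarrow> card Z \<le> B"
proof -
  obtain f1 f2 g where g: "f1 \<in> polys K" "f2 \<in> polys K" "g = poly f1 u / poly f2 u" "g \<noteq> 0" "g \<in> V" "g / z \<in> V"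
    using rational_multiple[OF z] by blast
  define \<delta> where "\<delta> = max (Polynomial.degree f1) (Polynomial.degree f2)"
  have f12: "f1 \<in> polys_lt K (Suc \<delta>)" "f2 \<in> polys_lt K (Suc \<delta>)"
    using g by (auto intro!: polys_in_lt simp: \<delta>_def)
  have "card Z \<le> card K ^ (n * \<delta>)" if Z: "finite Z" "Z \<subseteq> V" "\<forall>x\<in>Z. \<forall>y\<in>Z. (x - y) / z \<in> V \<longrightarrow> x = y" for Z
  proof (rule incongruent_card_le[OF valr_subring valr_F Z(1,2) g(3,4,5) f12])
    fix x y assume xy: "x \<in> Z" "y \<in> Z" "(x - y) / g \<in> V"
    have "(x - y) / z = (x - y) / g * (g / z)" using g(4) by simp
    then have "(x - y) / z \<in> V" using xy g(6) V_closed(4) by metis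
    then show "x = y" using Z xy by blast
  qed
  then show ?thesis by blast
qed

text \<open>A strictly ascending chain of principal ideals between \<open>zV\<close> and \<open>V\<close> yields incongruent elements.\<close>

lemma chain_bounded:
  assumes z: "z \<in> V" "z \<noteq> 0"
  shows "\<exists>B::nat. \<nexists>T. (\<forall>i\<le>B. T i \<in> V \<and> T i \<noteq> 0 \<and> z / T i \<in> mx V) \<and>
           (\<forall>i j. i < j \<and> j \<le> B \<longrightarrow> T i / T j \<in> mx V)"
proof -
  obtain B where B: "\<And>Z. finite Z \<Longrightarrow> Z \<subseteq> V \<Longrightarrow> (\<forall>x\<in>Z. \<forall>y\<in>Z. (x - y) / z \<in> V \<longrightarrow> x = y) \<Longrightarrow> card Z \<le> B"
    using incongruent_bounded[OF z] by blast
  have main: False if T: "\<And>i. i \<le> B \<Longrightarrow> T i \<in> V" "\<And>i. i \<le> B \<Longrightarrow> T i \<noteq> 0" "\<And>i. i \<le> B \<Longrightarrow> z / T i \<in> mx V"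
    and lt: "\<And>i j. i < j \<Longrightarrow> j \<le> B \<Longrightarrow> T i / T j \<in> mx V" for T :: "nat \<Rightarrow> 'a"
  proof -
    have key: False if ij: "i < j" "j \<le> B" "(T i - T j) / z \<in> V" for i j
    proof -
      define r where "r = T i / T j - 1"
      have "r \<in> V" unfolding r_def using lt[OF ij(1,2)] mx_subset V_closed(2,6) by blast
      moreover have "r \<notin> mx V"
        using mx_diff[OF lt[OF ij(1,2)], of r] one_notin_mx by (auto simp: r_def)
      ultimately have r: "inverse r \<in> V" "r \<noteq> 0" using unit_inverse by blast+
      have "T i - T j = T j * r" using T(2)[OF ij(2)] by (simp add: r_def field_simps)
      then have "T j * r / z \<in> V" using ij(3) by simp
      then have "T j * r / z * inverse r \<in> V" using r(1) by (rule V_closed(4))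
      moreover have "T j * r / z * inverse r = T j / z" using r(2) by (simp add: field_simps)
      ultimately have "T j / z \<in> V" by (simp only:)
      then show False using T(2,3)[OF ij(2)] z(2) by (simp add: mx_def)
    qed
    have inc: "i = j" if ij: "i \<le> B" "j \<le> B" "(T i - T j) / z \<in> V" for i j
    proof -
      have "(T j - T i) / z \<in> V" using V_closed(5)[OF ij(3)] by (simp add: minus_divide_left)
      then show ?thesis using key[of i j] key[of j i] ij by (cases i j rule: linorder_cases) auto
    qed
    then have inj: "inj_on T {..B}" using V_closed(1) by (auto simp: inj_on_def)
    have "card (T ` {..B}) \<le> B" using T(1) inc by (intro B) auto
    then show False using inj by (simp add: card_image)
  qed
  show ?thesis
  proof (intro exI[of _ B] notI, elim exE conjE)
    fix T :: "nat \<Rightarrow> 'a"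
    assume "\<forall>i\<le>B. T i \<in> V \<and> T i \<noteq> 0 \<and> z / T i \<in> mx V"
      and "\<forall>i j. i < j \<and> j \<le> B \<longrightarrow> T i / T j \<in> mx V"
    then show False by (intro main[of T]) simp_all
  qed
qed

text \<open>If nothing generates the maximal ideal, every nonzero nonunit \<open>t\<close> has a
  nonzero nonunit \<open>t'\<close> with \<open>t / t'\<close> again a nonunit. Iterating gives an
  endless ascending chain of ideals above the first element, against
  \<open>chain_bounded\<close>.\<close>

lemma principal_mx: "\<exists>t. t \<in> mx V \<and> t \<noteq> 0 \<and> (\<forall>z\<in>mx V. z / t \<in> V)"
proof (rule ccontr)
  assume nex: "\<not> (\<exists>t. t \<in> mx V \<and> t \<noteq> 0 \<and> (\<forall>z\<in>mx V. z / t \<in> V))"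
  have step: "\<exists>t'. t' \<in> mx V \<and> t' \<noteq> 0 \<and> t / t' \<in> mx V" if t: "t \<in> mx V" "t \<noteq> 0" for t
  proof -
    obtain z where z: "z \<in> mx V" "z / t \<notin> V" using nex t by blast
    have "z \<in> F" "t \<in> F" using z t mx_subset valr_F by auto
    then have "inverse (z / t) \<in> mx V" using mx_inverse F_closed(10) z(2) by blast
    moreover have "z \<noteq> 0" using z V_closed(1) by auto
    ultimately show ?thesis using z by auto
  qed
  obtain z1 where z1: "z1 \<in> F" "z1 \<notin> V" using valr_F valr_proper by blast
  define z0 where "z0 = inverse z1"
  have z0: "z0 \<in> mx V" "z0 \<noteq> 0" using mx_inverse z1 V_closed(1) by (auto simp: z0_def)
  have "\<exists>T. T 0 = z0 \<and> (\<forall>i. (T i \<in> mx V \<and> T i \<noteq> 0) \<and> T i / T (Suc i) \<in> mx V)"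
  proof -
    have "\<exists>T. \<forall>i. (T i \<in> mx V \<and> T i \<noteq> 0 \<and> (i = 0 \<longrightarrow> T i = z0)) \<and> T i / T (Suc i) \<in> mx V"
    proof (rule dependent_nat_choice)
      show "\<exists>x. x \<in> mx V \<and> x \<noteq> 0 \<and> (0 = (0::nat) \<longrightarrow> x = z0)" using z0 by blast
    qed (use step in blast)
    then show ?thesis by blast
  qed
  then obtain T where T: "T 0 = z0" "\<And>i. T i \<in> mx V" "\<And>i. T i \<noteq> 0" "\<And>i. T i / T (Suc i) \<in> mx V" by blast
  have TV: "T i \<in> V" for i using T(2) mx_subset by blast
  have lt: "T i / T j \<in> mx V" if "i < j" for i j
    using that
  proof (induction j)
    case (Suc j)
    show ?case
    proof (cases "i = j")
      case False
      then have "T i / T j \<in> V" using Suc mx_subset by force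
      then have "T i / T j * (T j / T (Suc j)) \<in> mx V" using T(4) mx_mult by blast
      then show ?thesis using T(3) by simp
    qed (use T in simp)
  qed simp
  have "z0 \<in> V" using z0(1) mx_subset by blast
  from chain_bounded[OF this z0(2)] obtain B :: nat where
    B: "\<nexists>T. (\<forall>i\<le>B. T i \<in> V \<and> T i \<noteq> 0 \<and> z0 / T i \<in> mx V) \<and> (\<forall>i j. i < j \<and> j \<le> B \<longrightarrow> T i / T j \<in> mx V)"
    by (rule exE)
  \<comment> \<open>The chain is used from index \<open>1\<close> on: \<open>z0 / T 0 = 1\<close> is
    not in \<open>mx V\<close>, as \<open>chain_bounded\<close> would require.\<close>
  have "z0 / T (Suc i) \<in> mx V" for i using lt[of 0 "Suc i"] T(1) by simp
  then show False
    using TV T(3) lt by - (rule notE[OF B], rule exI[of _ "\<lambda>i. T (Suc i)"], simp)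
qed

end

section \<open>Normalized discrete valuations\<close>

definition unif :: "'a set \<Rightarrow> 'a" where
  "unif V = (SOME t. t \<in> mx V \<and> t \<noteq> 0 \<and> (\<forall>z\<in>mx V. z / t \<in> V))"

definition val :: "'a set \<Rightarrow> 'a \<Rightarrow> int" where
  "val V z = (THE k. z / unif V powi k \<in> V - mx V)"

text \<open>\<open>val\<close> is unspecified at \<open>0\<close>; unlike \<open>val V z \<ge> k\<close>, the following also covers \<open>z = 0\<close>.\<close>

definition vge :: "'a set \<Rightarrow> int \<Rightarrow> 'a \<Rightarrow> bool" where
  "vge V k z \<longleftrightarrow> z / unif V powi k \<in> V"

context
  fixes V assumes V: "valr V"
begin

lemma unif: "unif V \<in> mx V" "unif V \<noteq> 0" "\<And>z. z \<in> mx V \<Longrightarrow> z / unif V \<in> V"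
  using someI_ex[OF principal_mx[OF V]] unfolding unif_def by blast+

lemma mx_iff_unif: "z \<in> mx V \<longleftrightarrow> z / unif V \<in> V"
proof
  assume "z / unif V \<in> V"
  then have "z / unif V * unif V \<in> mx V" using mx_mult[OF V] unif by blast
  then show "z \<in> mx V" using unif by simp
qed (rule unif)

lemma unif_V: "unif V \<in> V"
  using unif(1) mx_subset[OF V] by blast

lemma unif_power_mx: "k > 0 \<Longrightarrow> unif V ^ k \<in> mx V"
proof -
  assume "k > 0"
  then obtain l where l: "k = Suc l" using gr0_implies_Suc by blast
  show ?thesis unfolding l power_Suc2
    using mx_mult[OF V V_closed(7)[OF V unif_V]] unif by blast
qed

lemma unif_powi_V: "k \<ge> 0 \<Longrightarrow> unif V powi k \<in> V"
  using V_closed(7)[OF V unif_V] by (simp add: power_int_def)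

lemma unif_powi_mx: "k > 0 \<Longrightarrow> unif V powi k \<in> mx V"
  using unif_power_mx[of "nat k"] by (simp add: power_int_def)

text \<open>If every power of the uniformizer \<open>t\<close> divided \<open>z\<close>, then
  \<open>t^B, ..., t, 1\<close> would be an ascending chain above \<open>z\<close> that is longer
  than \<open>chain_bounded\<close> permits.\<close>

lemma val_ex_V:
  assumes z: "z \<in> V" "z \<noteq> 0"
  shows "\<exists>k. z / unif V ^ k \<in> V - mx V"
proof -
  let ?t = "unif V"
  from chain_bounded[OF V z] obtain B :: nat where
    B: "\<nexists>T. (\<forall>i\<le>B. T i \<in> V \<and> T i \<noteq> 0 \<and> z / T i \<in> mx V) \<and> (\<forall>i j. i < j \<and> j \<le> B \<longrightarrow> T i / T j \<in> mx V)"
    by (rule exE)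
  have ex: "\<exists>k. z / ?t ^ k \<notin> V"
  proof (rule ccontr)
    assume "\<not> ?thesis"
    then have all: "z / ?t ^ Suc k \<in> V" for k by blast
    show False
    proof (rule notE[OF B], rule exI[of _ "\<lambda>i. ?t ^ (B - i)"], intro conjI allI impI)
      show "?t ^ (B - i) \<in> V" "?t ^ (B - i) \<noteq> 0" "z / ?t ^ (B - i) \<in> mx V" for i
        using V_closed(7)[OF V unif_V] unif(2) all[of "B - i"] mx_iff_unif[of "z / ?t ^ (B - i)"]
        by (simp_all add: mult.commute)
      fix i j assume ij: "i < j \<and> j \<le> B"
      then have "?t ^ (B - i) = ?t ^ (B - j) * ?t ^ (j - i)" by (simp flip: power_add)
      then show "?t ^ (B - i) / ?t ^ (B - j) \<in> mx V" using unif_power_mx[of "j - i"] unif(2) ij by simp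
    qed
  qed
  define k where "k = (LEAST k. z / ?t ^ k \<notin> V)"
  have k: "z / ?t ^ k \<notin> V" unfolding k_def using ex by (rule LeastI_ex)
  then have "k > 0" using z by (cases k) auto
  then obtain l where l: "k = Suc l" using gr0_implies_Suc by blast
  have "z / ?t ^ l \<in> V" using not_less_Least[of l "\<lambda>k. z / ?t ^ k \<notin> V"] l by (simp add: k_def)
  moreover have "z / ?t ^ l \<notin> mx V" using k mx_iff_unif[of "z / ?t ^ l"] by (simp add: l mult.commute)
  ultimately show ?thesis by blast
qed

lemma val_ex:
  assumes z: "z \<in> F" "z \<noteq> 0"
  shows "\<exists>k. z / unif V powi k \<in> V - mx V"
proof (cases "z \<in> V")
  case True
  then obtain k where "z / unif V ^ k \<in> V - mx V" using val_ex_V z by blast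
  then show ?thesis by (intro exI[of _ "int k"]) simp
next
  case False
  then obtain k where k: "inverse z / unif V ^ k \<in> V - mx V"
    using val_ex_V[of "inverse z"] valr_inverse[OF V] z by auto
  have "inverse (inverse z / unif V ^ k) \<in> V - mx V"
    using k unit_inverse[OF V, of "inverse z / unif V ^ k"] unfolding mx_def by auto
  moreover have "inverse (inverse z / unif V ^ k) = z / unif V powi (- int k)"
    by (simp add: power_int_minus field_simps)
  ultimately show ?thesis by metis
qed

lemma unit_shift_unique:
  assumes "z / unif V powi k \<in> V - mx V" "z / unif V powi l \<in> V - mx V"
  shows "k = l"
proof -
  have aux: False if k: "z / unif V powi k \<in> V" and l: "z / unif V powi l \<in> V - mx V" and "l < k" for k l
  proof -
    have "z / unif V powi l = z / unif V powi k * unif V powi (k - l)"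
      using unif(2) by (simp add: power_int_diff)
    moreover have "z / unif V powi k * unif V powi (k - l) \<in> mx V"
      using mx_mult[OF V k unif_powi_mx] that(3) by simp
    ultimately show False using l by simp
  qed
  show ?thesis using aux[of k l] aux[of l k] assms by (cases k l rule: linorder_cases) auto
qed

lemma valI: "z / unif V powi k \<in> V - mx V \<Longrightarrow> val V z = k"
  unfolding val_def using unit_shift_unique by (intro the_equality) blast+

lemma val_unit: "z \<in> F \<Longrightarrow> z \<noteq> 0 \<Longrightarrow> z / unif V powi val V z \<in> V - mx V"
  using val_ex valI by metis

lemma val_mult:
  assumes "a \<in> F" "a \<noteq> 0" "b \<in> F" "b \<noteq> 0"
  shows "val V (a * b) = val V a + val V b"
proof (rule valI)
  have "(a * b) / unif V powi (val V a + val V b) = (a / unif V powi val V a) * (b / unif V powi val V b)"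
    using unif(2) by (simp add: power_int_add)
  then show "(a * b) / unif V powi (val V a + val V b) \<in> V - mx V"
    using unit_mult[OF V] val_unit assms by metis
qed

lemma val_1: "val V 1 = 0"
  using V_closed(2)[OF V] one_notin_mx[OF V] by (intro valI) simp

lemma val_power: "a \<in> F \<Longrightarrow> a \<noteq> 0 \<Longrightarrow> val V (a ^ k) = int k * val V a"
  by (induction k) (auto simp: val_1 val_mult F_closed(7) algebra_simps)

lemma val_inverse:
  assumes "a \<in> F" "a \<noteq> 0" shows "val V (inverse a) = - val V a"
  using val_mult[of a "inverse a"] assms F_closed(9) val_1 by simp

lemma vge_iff:
  assumes "z \<in> F"
  shows "vge V k z \<longleftrightarrow> z = 0 \<or> val V z \<ge> k"
proof (cases "z = 0")
  case False
  have eq: "z / unif V powi k = (z / unif V powi val V z) * unif V powi (val V z - k)"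
    using unif(2) by (simp add: power_int_diff)
  note u = val_unit[OF assms False]
  show ?thesis
  proof
    assume v: "vge V k z"
    show "z = 0 \<or> val V z \<ge> k"
    proof (rule ccontr)
      assume n: "\<not> (z = 0 \<or> val V z \<ge> k)"
      have "unif V powi (k - val V z) * (z / unif V powi k) \<in> mx V"
        using mx_mult[OF V, of "z / unif V powi k" "unif V powi (k - val V z)"] v n unif_powi_mx[of "k - val V z"]
        unfolding vge_def by (simp add: mult.commute)
      moreover have "unif V powi (k - val V z) * (z / unif V powi k) = z / unif V powi val V z"
        using unif(2) by (simp add: power_int_diff)
      ultimately show False using u by simp
    qed
  next
    assume "z = 0 \<or> val V z \<ge> k"
    then have "unif V powi (val V z - k) \<in> V" using False unif_powi_V by simp
    then show "vge V k z" unfolding vge_def eq using u V_closed(4)[OF V] by blast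
  qed
qed (use V_closed[OF V] in \<open>auto simp: vge_def\<close>)

lemma V_iff_val: "z \<in> F \<Longrightarrow> z \<in> V \<longleftrightarrow> z = 0 \<or> val V z \<ge> 0"
  using vge_iff[of z 0] by (simp add: vge_def)

lemma mx_iff_val: "z \<in> F \<Longrightarrow> z \<in> mx V \<longleftrightarrow> z = 0 \<or> val V z \<ge> 1"
  using vge_iff[of z 1] mx_iff_unif[of z] by (simp add: vge_def)

lemma val_unif: "val V (unif V) = 1"
  using V_closed(2)[OF V] one_notin_mx[OF V] unif(2) by (intro valI) simp

lemma unif_F: "unif V \<in> F"
  using unif_V valr_F[OF V] by blast

lemma vge_add: "vge V k a \<Longrightarrow> vge V k b \<Longrightarrow> vge V k (a + b)"
  and vge_diff: "vge V k a \<Longrightarrow> vge V k b \<Longrightarrow> vge V k (a - b)"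
  unfolding vge_def using V_closed(3,6)[OF V] by (auto simp: add_divide_distrib diff_divide_distrib)

lemma vge_0: "vge V k 0"
  unfolding vge_def using V_closed(1)[OF V] by simp

lemma vge_sum: "(\<And>i. i \<in> A \<Longrightarrow> vge V k (g i)) \<Longrightarrow> vge V k (sum g A)"
  by (induction A rule: infinite_finite_induct) (auto intro: vge_add vge_0)

lemma vge_mult: "vge V k a \<Longrightarrow> vge V l b \<Longrightarrow> vge V (k + l) (a * b)"
proof -
  assume "vge V k a" "vge V l b"
  then have "(a / unif V powi k) * (b / unif V powi l) \<in> V" unfolding vge_def by (rule V_closed(4)[OF V])
  then show ?thesis using unif(2) by (simp add: vge_def power_int_add)
qed

lemma vge_mono: "vge V k a \<Longrightarrow> l \<le> k \<Longrightarrow> vge V l a"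
proof -
  assume a: "vge V k a" "l \<le> k"
  have e: "a / unif V powi l = (a / unif V powi k) * unif V powi (k - l)"
    using unif(2) by (simp add: power_int_diff)
  have "unif V powi (k - l) \<in> V" using a(2) by (intro unif_powi_V) simp
  with a(1) show ?thesis unfolding vge_def e by (rule V_closed(4)[OF V])
qed

text \<open>Digits of a \<open>unif V\<close>-adic expansion are unique: the lowest nonzero term has
  too small a value to be cancelled. In the application \<open>d\<close> is the difference of two
  sequences of residue representatives, whence the second assumption.\<close>

lemma sum_unif_zero:
  assumes d: "\<And>i. i < m \<Longrightarrow> d i \<in> V" "\<And>i. i < m \<Longrightarrow> d i \<in> mx V \<Longrightarrow> d i = 0"
    and s: "vge V (int m) (\<Sum>i<m. d i * unif V ^ i)"
  shows "\<forall>i<m. d i = 0"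
proof (rule ccontr)
  let ?t = "unif V"
  assume "\<not> ?thesis"
  then have ex: "\<exists>i. i < m \<and> d i \<noteq> 0" by blast
  define i0 where "i0 = (LEAST i. i < m \<and> d i \<noteq> 0)"
  have i0: "i0 < m" "d i0 \<noteq> 0" using LeastI_ex[OF ex] by (auto simp: i0_def)
  have lt: "d i = 0" if "i < i0" for i
    using not_less_Least[of i "\<lambda>i. i < m \<and> d i \<noteq> 0"] that i0 by (auto simp: i0_def)
  have "(\<Sum>i<m. d i * ?t ^ i) = (\<Sum>i\<in>insert i0 {Suc i0..<m}. d i * ?t ^ i)"
    using lt i0 by (intro sum.mono_neutral_right) auto
  then have "(\<Sum>i<m. d i * ?t ^ i) - (\<Sum>i\<in>{Suc i0..<m}. d i * ?t ^ i) = d i0 * ?t ^ i0" by simp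
  moreover have "vge V (int (Suc i0)) (\<Sum>i<m. d i * ?t ^ i)" using s i0 by (intro vge_mono[OF s]) auto
  moreover have "vge V (int (Suc i0)) (\<Sum>i\<in>{Suc i0..<m}. d i * ?t ^ i)"
  proof (intro vge_sum)
    fix i assume i: "i \<in> {Suc i0..<m}"
    then have "vge V (0 + int i) (d i * ?t ^ i)"
      using d(1) V_closed(2)[OF V] unif(2) by (intro vge_mult) (auto simp: vge_def)
    then show "vge V (int (Suc i0)) (d i * ?t ^ i)" using i by - (rule vge_mono[of "0 + int i"], auto)
  qed
  ultimately have "vge V (int (Suc i0)) (d i0 * ?t ^ i0)" using vge_diff by metis
  then have "d i0 / ?t \<in> V" using unif(2) unfolding vge_def by (simp add: power_int_add field_simps)
  then show False using d(2)[OF i0(1)] i0(2) mx_iff_unif by blast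
qed

text \<open>These cosets are literally the elements of the quotient ring of \<open>V\<close> by
  \<open>mx V\<close>, which lets \<open>card_resid_degree\<close> read off the degree of the
  place.\<close>

definition resid :: "'a set set" where
  "resid = (\<lambda>z. {z' \<in> V. z' - z \<in> mx V}) ` V"

lemma resid_class_eq: "a \<in> V \<Longrightarrow> b \<in> V \<Longrightarrow>
   {z \<in> V. z - a \<in> mx V} = {z \<in> V. z - b \<in> mx V} \<longleftrightarrow> a - b \<in> mx V"
proof
  assume ab: "a \<in> V" "b \<in> V" "{z \<in> V. z - a \<in> mx V} = {z \<in> V. z - b \<in> mx V}"
  have "a \<in> {z \<in> V. z - a \<in> mx V}" using ab(1) zero_in_mx[OF V] by simp
  then show "a - b \<in> mx V" unfolding ab(3) by blast
next
  assume ab: "a \<in> V" "b \<in> V" "a - b \<in> mx V"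
  have "z - a \<in> mx V \<longleftrightarrow> z - b \<in> mx V" for z
    using mx_add[OF V _ ab(3), of "z - a"] mx_diff[OF V _ ab(3), of "z - b"] by auto
  then show "{z \<in> V. z - a \<in> mx V} = {z \<in> V. z - b \<in> mx V}" by simp
qed

lemma finite_resid: "finite resid"
  and resid_reps: "\<exists>Z. finite Z \<and> Z \<subseteq> V \<and> card Z = card resid \<and> (\<forall>x\<in>Z. \<forall>y\<in>Z. x - y \<in> mx V \<longrightarrow> x = y)"
proof -
  obtain B where B: "\<And>Z. finite Z \<Longrightarrow> Z \<subseteq> V \<Longrightarrow> (\<forall>x\<in>Z. \<forall>y\<in>Z. (x - y) / unif V \<in> V \<longrightarrow> x = y) \<Longrightarrow> card Z \<le> B"
    using incongruent_bounded[OF V unif_V unif(2)] by blast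
  define r where "r = inv_into V (\<lambda>z. {z' \<in> V. z' - z \<in> mx V})"
  have r: "r C \<in> V" "{z' \<in> V. z' - r C \<in> mx V} = C" if "C \<in> resid" for C
    using that inv_into_into[of C "\<lambda>z. {z' \<in> V. z' - z \<in> mx V}" V]
      f_inv_into_f[of C "\<lambda>z. {z' \<in> V. z' - z \<in> mx V}" V] unfolding resid_def r_def by auto
  have inc: "x = y" if xy: "x \<in> r ` S" "y \<in> r ` S" "S \<subseteq> resid" "x - y \<in> mx V" for x y S
  proof -
    obtain C D where CD: "x = r C" "y = r D" "C \<in> resid" "D \<in> resid"
      using xy(1-3) by auto
    have "{z' \<in> V. z' - x \<in> mx V} = {z' \<in> V. z' - y \<in> mx V}"
      using resid_class_eq[of x y] r(1) CD xy(4) by simp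
    then have "C = D" using r(2) CD by simp
    then show ?thesis using CD by simp
  qed
  have inj: "inj_on r S" if "S \<subseteq> resid" for S
  proof (rule inj_onI)
    fix C D assume CD: "C \<in> S" "D \<in> S" "r C = r D"
    then have "C \<in> resid" "D \<in> resid" using that by auto
    from r(2)[OF this(1)] r(2)[OF this(2)] show "C = D" unfolding CD(3) by (rule trans[OF sym])
  qed
  have le: "card S \<le> B" if "finite S" "S \<subseteq> resid" for S
  proof -
    have "card (r ` S) \<le> B"
      using that r(1) inc[OF _ _ that(2)] mx_iff_unif by (intro B) auto
    then show ?thesis using card_image[OF inj[OF that(2)]] by simp
  qed
  show fin: "finite resid"
  proof (rule ccontr)
    assume "infinite resid"
    then obtain S where "S \<subseteq> resid" "finite S" "card S = Suc B" using infinite_arbitrarily_large by blast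
    then show False using le[of S] by simp
  qed
  show "\<exists>Z. finite Z \<and> Z \<subseteq> V \<and> card Z = card resid \<and> (\<forall>x\<in>Z. \<forall>y\<in>Z. x - y \<in> mx V \<longrightarrow> x = y)"
    using fin r(1) card_image[OF inj] inc by (intro exI[of _ "r ` resid"]) auto
qed

text \<open>Among \<open>a^0, ..., a^N\<close> with \<open>N = card resid\<close> two are congruent,
  so some \<open>a^i\<close> with \<open>0 < i \<le> N\<close> is congruent to \<open>1\<close>;
  \<open>fact N\<close> is a multiple of every such \<open>i\<close>.\<close>

lemma unit_power_congruent_1: "\<exists>k>0. \<forall>a\<in>V - mx V. a ^ k - 1 \<in> mx V"
proof -
  define N where "N = card resid"
  have "a ^ fact N - 1 \<in> mx V" if a: "a \<in> V - mx V" for a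
  proof -
    define g where "g i = {z \<in> V. z - a ^ i \<in> mx V}" for i
    have aV: "a ^ i \<in> V" for i using a V_closed(7)[OF V] by blast
    have "g ` {..N} \<subseteq> resid" using aV unfolding g_def resid_def by blast
    then have "card (g ` {..N}) \<le> N" unfolding N_def using finite_resid card_mono by blast
    then have "\<not> inj_on g {..N}" using card_image[of g "{..N}"] by auto
    then obtain i j where "i \<le> N" "j \<le> N" "i \<noteq> j" "g i = g j" unfolding inj_on_def by auto
    then obtain i j where ij: "i < j" "j \<le> N" "g i = g j"
      by (metis linorder_neqE_nat)
    then have "a ^ j - a ^ i \<in> mx V" using resid_class_eq[OF aV[of j] aV[of i]] ij(3) unfolding g_def by simp
    moreover have "a ^ j = a ^ i * a ^ (j - i)" using ij(1) by (simp flip: power_add)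
    ultimately have "a ^ i * (a ^ (j - i) - 1) \<in> mx V" by (simp add: algebra_simps)
    then have b: "a ^ (j - i) - 1 \<in> mx V"
      using mx_prime[OF V _ aV[of i] V_closed(6)[OF V aV V_closed(2)[OF V]]] unit_power[OF V a, of i] by blast
    have "j - i dvd fact N" using ij by (intro dvd_fact) auto
    then obtain l where l: "fact N = (j - i) * l" by blast
    have "a ^ fact N - 1 = (\<Sum>k<l. (a ^ (j - i)) ^ k) * (a ^ (j - i) - 1)"
      unfolding l power_mult by (simp add: power_diff_1_eq mult.commute)
    moreover have "(\<Sum>k<l. (a ^ (j - i)) ^ k) \<in> V" by (intro V_closed(8)[OF V] V_closed(7)[OF V] aV)
    ultimately show ?thesis using b mx_mult[OF V] by simp
  qed
  then show ?thesis by (intro exI[of _ "fact N"]) auto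
qed

end

end

section \<open>Weak approximation\<close>

context transcendental_ext
begin

text \<open>A discrete valuation ring is a maximal proper subring: if \<open>V\<close> lies in
  \<open>W\<close>, then the uniformizer of \<open>V\<close> is either a nonunit of
  \<open>W\<close>, giving \<open>W = V\<close>, or a unit of \<open>W\<close>, giving
  \<open>W = F\<close>.\<close>

lemma valr_incomparable:
  assumes V: "valr V" and W: "valr W" and "V \<noteq> W"
  shows "\<exists>a\<in>V. a \<notin> W"
proof (rule ccontr)
  assume "\<not> ?thesis"
  then have sub: "V \<subseteq> W" by blast
  let ?t = "unif V"
  have "mx W \<subseteq> mx V"
  proof
    fix a assume a: "a \<in> mx W"
    then have aF: "a \<in> F" using mx_subset[OF W] valr_F[OF W] by blast
    have "a \<in> V"
    proof (rule ccontr)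
      assume "a \<notin> V"
      then have "inverse a \<in> W" "a \<noteq> 0" using valr_inverse[OF V aF] sub V_closed(1)[OF V] by auto
      then show False using a by (auto simp: mx_def)
    qed
    moreover have "a = 0 \<or> inverse a \<notin> V" using a sub by (auto simp: mx_def)
    ultimately show "a \<in> mx V" by (simp add: mx_def)
  qed
  have it: "inverse ?t \<in> W"
  proof (rule ccontr)
    assume "inverse ?t \<notin> W"
    then have tW: "?t \<in> mx W" using unif_V[OF V] sub by (auto simp: mx_def)
    have "W \<subseteq> V"
    proof
      fix a assume a: "a \<in> W"
      show "a \<in> V"
      proof (rule ccontr)
        assume "a \<notin> V"
        then have "inverse a \<in> mx V" "a \<noteq> 0" using mx_inverse[OF V] valr_F[OF W] a V_closed(1)[OF V] by auto
        then have "inverse a / ?t \<in> W" using unif(3)[OF V] sub by blast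
        then have "a * (inverse a / ?t) \<in> W" using a V_closed(4)[OF W] by blast
        then have "inverse ?t \<in> W" using \<open>a \<noteq> 0\<close> by (simp add: divide_inverse mult.assoc[symmetric])
        then show False using \<open>inverse ?t \<notin> W\<close> by blast
      qed
    qed
    then show False using sub assms(3) by blast
  qed
  have "F \<subseteq> W"
  proof
    fix z assume z: "z \<in> F"
    show "z \<in> W"
    proof (cases "z = 0")
      case False
      have "z / ?t powi val V z \<in> W" using val_unit[OF V z False] sub by blast
      moreover have "?t powi val V z \<in> W"
        unfolding power_int_def using unif_V[OF V] sub it V_closed(7)[OF W] by auto
      ultimately have "z / ?t powi val V z * ?t powi val V z \<in> W" by (rule V_closed(4)[OF W])
      then show ?thesis using unif(2)[OF V] by simp
    qed (use V_closed(1)[OF W] in simp)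
  qed
  then show False using valr_F[OF W] valr_proper[OF W] by blast
qed

lemma common_exponent:
  assumes "finite S" "\<And>W. W \<in> S \<Longrightarrow> valr W"
  shows "\<exists>k>0. \<forall>W\<in>S. \<forall>a\<in>W - mx W. a ^ k - 1 \<in> mx W"
  using assms
proof (induction S rule: finite_induct)
  case (insert W S)
  then obtain k where k: "k > 0" "\<And>V a. V \<in> S \<Longrightarrow> a \<in> V - mx V \<Longrightarrow> a ^ k - 1 \<in> mx V" by blast
  obtain l where l: "l > 0" "\<And>a. a \<in> W - mx W \<Longrightarrow> a ^ l - 1 \<in> mx W"
    using unit_power_congruent_1[of W] insert by blast
  have "a ^ (k * l) - 1 \<in> mx V" if V: "V \<in> insert W S" and a: "a \<in> V - mx V" for V a
  proof -
    have vV: "valr V" using insert V by blast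
    have "a ^ k \<in> V - mx V" "a ^ l \<in> V - mx V" using unit_power[OF vV a] by blast+
    moreover have "a ^ (k * l) = (a ^ l) ^ k" "a ^ (k * l) = (a ^ k) ^ l"
      by (simp_all add: mult.commute flip: power_mult)
    ultimately show ?thesis using V k(2)[of V "a ^ l"] l(2)[of "a ^ k"] by auto
  qed
  then show ?case using k(1) l(1) by (intro exI[of _ "k * l"]) auto
qed auto

text \<open>
  With \<open>b = a\<^sup>k\<close>, \<open>1 - b + b\<^sup>2\<close> is a unit wherever \<open>a\<close> is integral, since there \<open>b\<close> is congruent to
  \<open>0\<close> or \<open>1\<close>; where \<open>a\<close> has a pole, so has \<open>1 - b + b\<^sup>2\<close>.
\<close>

lemma separating_element:
  assumes S: "finite S" "\<And>W. W \<in> S \<Longrightarrow> valr W" and V: "V \<in> S" and W: "W \<in> S" and ne: "V \<noteq> W"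
  shows "\<exists>c\<in>F. (\<forall>U\<in>S. c \<in> U) \<and> c \<notin> mx V \<and> c \<in> mx W"
proof -
  obtain k where k: "k > 0" "\<And>U a. U \<in> S \<Longrightarrow> a \<in> U - mx U \<Longrightarrow> a ^ k - 1 \<in> mx U"
    using common_exponent[OF S] by blast
  obtain a where a: "a \<in> V" "a \<notin> W" using valr_incomparable[OF S(2) S(2) ne] V W by blast
  have aF: "a \<in> F" using a valr_F S V by blast
  define b where "b = a ^ k"
  define d where "d = 1 - b + b ^ 2"
  have d_unit: "d \<in> U - mx U" if U: "U \<in> S" "a \<in> U" for U
  proof -
    note vU = S(2)[OF U(1)]
    have bU: "b \<in> U" unfolding b_def using V_closed(7)[OF vU U(2)] .
    then have dU: "d \<in> U" unfolding d_def by (intro V_closed(3,6,7,2)[OF vU])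
    have "b * (b - 1) \<in> mx U"
    proof (cases "a \<in> mx U")
      case True
      obtain j where "k = Suc j" using k(1) gr0_implies_Suc by blast
      then have "(b - 1) * a ^ j * a \<in> mx U"
        using True V_closed(2,4,6,7)[OF vU] bU U(2) by (intro mx_mult[OF vU]) auto
      then show ?thesis using \<open>k = Suc j\<close> by (simp add: b_def mult_ac)
    next
      case False
      then show ?thesis using k(2)[OF U(1)] U(2) mx_mult[OF vU bU] unfolding b_def by blast
    qed
    moreover have "d - b * (b - 1) = 1" by (simp add: d_def algebra_simps power2_eq_square)
    ultimately have "d \<notin> mx U" using mx_diff[OF vU, of d "b * (b - 1)"] one_notin_mx[OF vU] by auto
    then show ?thesis using dU by blast
  qed
  have d_pole: "inverse d \<in> mx U \<and> d \<noteq> 0" if U: "U \<in> S" "a \<notin> U" for U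
  proof -
    note vU = S(2)[OF U(1)]
    have ia: "inverse a \<in> mx U" using mx_inverse[OF vU aF U(2)] .
    have a0: "a \<noteq> 0" using U(2) V_closed(1)[OF vU] by blast
    define r where "r = inverse b"
    have b0: "b \<noteq> 0" "r \<noteq> 0" using a0 by (auto simp: b_def r_def)
    have r: "r \<in> mx U"
    proof -
      obtain j where "k = Suc j" using k(1) gr0_implies_Suc by blast
      then have "inverse a ^ j * inverse a \<in> mx U"
        using ia mx_subset[OF vU] V_closed(7)[OF vU] by (intro mx_mult[OF vU]) auto
      then show ?thesis using \<open>k = Suc j\<close> by (simp add: b_def r_def power_inverse mult.commute)
    qed
    then have rU: "r \<in> U" using mx_subset[OF vU] by blast
    have "r ^ 2 * d = 1 - (1 - r) * r" using b0 by (simp add: r_def d_def field_simps power2_eq_square)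
    moreover have e: "(1 - r) * r \<in> mx U" using r rU V_closed(2,6)[OF vU] by (intro mx_mult[OF vU]) auto
    ultimately have u: "r ^ 2 * d \<in> U" "r ^ 2 * d \<notin> mx U"
      using V_closed(2,6)[OF vU] mx_subset[OF vU] mx_add[OF vU _ e, of "1 - (1 - r) * r"] one_notin_mx[OF vU]
      by (auto simp: subset_iff)
    then have i: "inverse (r ^ 2 * d) \<in> U" "r ^ 2 * d \<noteq> 0" using unit_inverse[OF vU] by blast+
    have "inverse (r ^ 2 * d) * r * r \<in> mx U" using i(1) r rU V_closed(4)[OF vU] by (intro mx_mult[OF vU]) auto
    moreover have "inverse (r ^ 2 * d) * r * r = inverse d" using b0 i(2) by (simp add: power2_eq_square field_simps)
    ultimately have "inverse d \<in> mx U" by (simp only:)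
    then show ?thesis using i(2) by auto
  qed
  define c where "c = inverse d"
  have dF: "d \<in> F" using d_unit[OF V a(1)] valr_F[OF S(2)[OF V]] by blast
  have "c \<in> F" unfolding c_def using F_closed(9) dF by blast
  moreover have "c \<in> U" if U: "U \<in> S" for U
    using d_unit[OF U] d_pole[OF U] unit_inverse[OF S(2)[OF U]] mx_subset[OF S(2)[OF U]]
    unfolding c_def by (cases "a \<in> U") auto
  moreover have "c \<notin> mx V"
    using d_unit[OF V a(1)] unfolding c_def mx_def by auto
  moreover have "c \<in> mx W" using d_pole[OF W a(2)] unfolding c_def by blast
  ultimately show ?thesis by blast
qed

lemma separating_family:
  assumes S: "finite S" "\<And>W. W \<in> S \<Longrightarrow> valr W" and V: "V \<in> S"
  shows "\<exists>y\<in>F. (\<forall>U\<in>S. y \<in> U) \<and> y \<notin> mx V \<and> (\<forall>W\<in>S - {V}. y \<in> mx W)"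
proof -
  have "\<forall>W\<in>S - {V}. \<exists>c\<in>F. (\<forall>U\<in>S. c \<in> U) \<and> c \<notin> mx V \<and> c \<in> mx W"
    using separating_element[OF S V] by blast
  then obtain c where c: "\<And>W. W \<in> S - {V} \<Longrightarrow> c W \<in> F \<and> (\<forall>U\<in>S. c W \<in> U) \<and> c W \<notin> mx V \<and> c W \<in> mx W"
    by metis
  define y where "y = prod c (S - {V})"
  have "y \<in> F" unfolding y_def using c by (intro subring_set_prod[OF subring_F]) blast
  moreover have "y \<in> U" if "U \<in> S" for U
    unfolding y_def using c that by (intro subring_set_prod[OF valr_subring[OF S(2)[OF that]]]) blast
  moreover have "y \<in> V - mx V"
  proof -
    have "prod c T \<in> V - mx V" if "finite T" "T \<subseteq> S - {V}" for T
      using that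
    proof (induction T rule: finite_induct)
      case empty
      then show ?case using V_closed(2)[OF S(2)[OF V]] one_notin_mx[OF S(2)[OF V]] by simp
    next
      case (insert W T)
      have "c W \<in> V - mx V" using c insert.prems V by blast
      then show ?case using insert unit_mult[OF S(2)[OF V]] by simp
    qed
    then show ?thesis unfolding y_def using S(1) by blast
  qed
  moreover have "y \<in> mx W" if W: "W \<in> S - {V}" for W
  proof -
    have vW: "valr W" using S W by blast
    have "y = prod c (S - {V} - {W}) * c W" unfolding y_def using S(1) W by (simp add: prod.remove mult.commute)
    moreover have "prod c (S - {V} - {W}) \<in> W"
      using c W by (intro subring_set_prod[OF valr_subring[OF vW]]) blast
    ultimately show ?thesis using c W mx_mult[OF vW] by simp
  qed
  ultimately show ?thesis by blast
qed

text \<open>For \<open>x = y\<^sup>k\<^sup>N\<close>, \<open>1 - (1 - x)\<^sup>N\<close> is close to \<open>1\<close> where \<open>y\<^sup>k\<close> is congruent to \<open>1\<close> and divisible by \<open>x\<close>.\<close>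

lemma approximate_idempotent:
  assumes S: "finite S" "\<And>W. W \<in> S \<Longrightarrow> valr W" and V: "V \<in> S"
  shows "\<exists>e\<in>F. vge V (int N) (e - 1) \<and> (\<forall>W\<in>S - {V}. vge W (int N) e)"
proof -
  obtain y where y: "y \<in> F" "\<And>U. U \<in> S \<Longrightarrow> y \<in> U" "y \<notin> mx V" "\<And>W. W \<in> S - {V} \<Longrightarrow> y \<in> mx W"
    using separating_family[OF S V] by blast
  obtain k where k: "k > 0" "\<And>U a. U \<in> S \<Longrightarrow> a \<in> U - mx U \<Longrightarrow> a ^ k - 1 \<in> mx U"
    using common_exponent[OF S] by blast
  have power: "vge U (int N) (x ^ N)" if U: "valr U" "x \<in> mx U" for U x
  proof -
    have "(x / unif U) ^ N \<in> U" using unif(3)[OF U] V_closed(7)[OF U(1)] by blast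
    then show ?thesis by (simp add: vge_def power_divide)
  qed
  have poly1: "\<exists>s\<in>U. 1 - (1 - x) ^ N = x * s" if U: "valr U" "x \<in> U" for U x
  proof -
    have "1 - (1 - x) ^ N = x * (\<Sum>i<N. (1 - x) ^ i)"
      using one_diff_power_eq[of "1 - x" N] by simp
    moreover have "(\<Sum>i<N. (1 - x) ^ i) \<in> U" using U V_closed(2)[OF U(1)] by (intro V_closed(6-8)[OF U(1)])
    ultimately show ?thesis by blast
  qed
  define x where "x = (y ^ k) ^ N"
  define e where "e = 1 - (1 - x) ^ N"
  note vV = S(2)[OF V]
  have xF: "x \<in> F" unfolding x_def by (intro F_closed(7) y)
  then have "e \<in> F" unfolding e_def by (intro F_closed(6,7,2))
  moreover have "vge V (int N) (e - 1)"
  proof -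
    have yk: "y ^ k - 1 \<in> mx V" "y ^ k \<in> V" using k(2)[OF V] y(2)[OF V] y(3) V_closed(7)[OF vV] by blast+
    have "x - 1 = (\<Sum>i<N. (y ^ k) ^ i) * (y ^ k - 1)"
      unfolding x_def by (simp add: power_diff_1_eq mult.commute)
    moreover have "(\<Sum>i<N. (y ^ k) ^ i) \<in> V" by (rule V_closed(8)[OF vV V_closed(7)[OF vV yk(2)]])
    ultimately have "x - 1 \<in> mx V" using mx_mult[OF vV] yk(1) by simp
    then have "1 - x \<in> mx V" using mx_neg[OF vV] by force
    then have "vge V (int N) (- ((1 - x) ^ N))" using power[OF vV] vge_diff[OF vV vge_0[OF vV]] by force
    then show ?thesis by (simp add: e_def)
  qed
  moreover have "vge W (int N) e" if W: "W \<in> S - {V}" for W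
  proof -
    have vW: "valr W" using S W by blast
    have "y ^ k \<in> mx W"
    proof -
      obtain j where "k = Suc j" using k(1) gr0_implies_Suc by blast
      then show ?thesis using y(4)[OF W] mx_mult[OF vW, of "y ^ j" y] V_closed(7)[OF vW] mx_subset[OF vW]
        by (auto simp: mult.commute subset_iff)
    qed
    then have x: "vge W (int N) x" unfolding x_def by (rule power[OF vW])
    have "x \<in> W" using y(2) W V_closed(7)[OF vW] unfolding x_def by blast
    then obtain s where s: "s \<in> W" "e = x * s" using poly1[OF vW] unfolding e_def by blast
    have "vge W (int N + 0) (x * s)" using s(1) by (intro vge_mult[OF vW x]) (simp add: vge_def)
    then show ?thesis using s(2) by simp
  qed
  ultimately show ?thesis by blast
qed

lemma weak_approximation:
  assumes S: "finite S" "\<And>W. W \<in> S \<Longrightarrow> valr W" and a: "\<And>W. W \<in> S \<Longrightarrow> a W \<in> F"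
  shows "\<exists>z\<in>F. \<forall>W\<in>S. vge W N (z - a W)"
proof -
  \<comment> \<open>Besides the requested precision, \<open>M\<close> absorbs the order of every
    target \<open>a W\<close> at every place of \<open>S\<close>, so the products with the targets
    still reach precision \<open>N\<close>.\<close>
  define M where "M = nat (\<bar>N\<bar> + (\<Sum>W\<in>S. \<Sum>U\<in>S. \<bar>val U (a W)\<bar>))"
  have "\<forall>V\<in>S. \<exists>e. e \<in> F \<and> vge V (int M) (e - 1) \<and> (\<forall>W\<in>S - {V}. vge W (int M) e)"
    using approximate_idempotent[OF S] by blast
  then obtain e where e: "\<And>V. V \<in> S \<Longrightarrow> e V \<in> F" "\<And>V. V \<in> S \<Longrightarrow> vge V (int M) (e V - 1)"
    "\<And>V W. V \<in> S \<Longrightarrow> W \<in> S \<Longrightarrow> W \<noteq> V \<Longrightarrow> vge W (int M) (e V)" by (metis Diff_iff singletonD)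
  have bound: "vge U N (x * a W)" if "U \<in> S" "W \<in> S" "vge U (int M) x" for U W x
  proof (cases "a W = 0")
    case False
    note vU = S(2)[OF that(1)]
    have "N \<le> \<bar>N\<bar>" by simp
    moreover have "\<bar>val U (a W)\<bar> \<le> (\<Sum>U\<in>S. \<bar>val U (a W)\<bar>)"
      using that(1) S(1) by (intro member_le_sum) auto
    moreover have "(\<Sum>U\<in>S. \<bar>val U (a W)\<bar>) \<le> (\<Sum>W\<in>S. \<Sum>U\<in>S. \<bar>val U (a W)\<bar>)"
      using that(2) S(1) by (intro member_le_sum[of W S "\<lambda>W. \<Sum>U\<in>S. \<bar>val U (a W)\<bar>"] sum_nonneg) auto
    ultimately have "int M + val U (a W) \<ge> N" unfolding M_def by linarith
    moreover have "vge U (val U (a W)) (a W)" using vge_iff[OF vU a[OF that(2)]] by simp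
    ultimately show ?thesis using vge_mult[OF vU that(3)] vge_mono[OF vU] by blast
  qed (use that S in \<open>auto intro: vge_0\<close>)
  define z where "z = (\<Sum>V\<in>S. e V * a V)"
  have "vge U N (z - a U)" if U: "U \<in> S" for U
  proof -
    have "z - a U = (e U - 1) * a U + (\<Sum>V\<in>S - {U}. e V * a V)"
      unfolding z_def using S(1) U by (simp add: sum.remove algebra_simps)
    moreover have "vge U N ((e U - 1) * a U)" using bound[OF U U] e(2)[OF U] by blast
    moreover have "vge U N (\<Sum>V\<in>S - {U}. e V * a V)"
      using U e(3) by (intro vge_sum[OF S(2)[OF U]] bound) auto
    ultimately show ?thesis using vge_add[OF S(2)[OF U]] by simp
  qed
  moreover have "z \<in> F" unfolding z_def using e(1) a F_closed(4)
    by (intro F_closed(8)) auto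
  ultimately show ?thesis by blast
qed

text \<open>Weak approximation realizes every choice of the first \<open>val W g\<close> digits at
  each \<open>W\<close>. The elements obtained are incongruent modulo \<open>g\<close> in the
  intersection of the rings, so \<open>incongruent_card_le\<close> bounds their number. This is, in
  multiplicative form, the bound \<open>n * \<delta>\<close> for the degree of the zero divisor of
  \<open>g\<close>.\<close>

lemma sum_of_degrees_le:
  assumes S: "finite S" "\<And>W. W \<in> S \<Longrightarrow> valr W"
    and g: "g = poly f1 u / poly f2 u" "g \<noteq> 0" "\<And>W. W \<in> S \<Longrightarrow> g \<in> W"
    and f12: "f1 \<in> polys_lt K (Suc \<delta>)" "f2 \<in> polys_lt K (Suc \<delta>)"
  shows "(\<Prod>W\<in>S. card (resid W) ^ nat (val W g)) \<le> card K ^ (n * \<delta>)"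
proof -
  have gF: "g \<in> F"
  proof -
    have "poly f1 u \<in> F" "poly f2 u \<in> F" using f12 polys_lt_subset R_poly R_subset_F by blast+
    then show ?thesis unfolding g(1) by (rule F_closed(10))
  qed
  have "\<forall>W\<in>S. \<exists>Z. finite Z \<and> Z \<subseteq> W \<and> card Z = card (resid W) \<and> (\<forall>x\<in>Z. \<forall>y\<in>Z. x - y \<in> mx W \<longrightarrow> x = y)"
    using resid_reps[OF S(2)] by blast
  then obtain Z where Z: "\<And>W. W \<in> S \<Longrightarrow> finite (Z W)" "\<And>W. W \<in> S \<Longrightarrow> Z W \<subseteq> W"
    "\<And>W. W \<in> S \<Longrightarrow> card (Z W) = card (resid W)"
    "\<And>W x y. W \<in> S \<Longrightarrow> x \<in> Z W \<Longrightarrow> y \<in> Z W \<Longrightarrow> x - y \<in> mx W \<Longrightarrow> x = y"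
    by metis
  define v where "v W = nat (val W g)" for W
  have v: "int (v W) = val W g" if "W \<in> S" for W
    using V_iff_val[OF S(2)[OF that] gF] g that unfolding v_def by auto
  define I where "I = PiE S (\<lambda>W. PiE {..<v W} (\<lambda>_. Z W))"
  define s where "s \<phi> W = (\<Sum>i<v W. \<phi> W i * unif W ^ i)" for \<phi> :: "'a set \<Rightarrow> nat \<Rightarrow> 'a" and W
  have sW: "s \<phi> W \<in> W" if "\<phi> \<in> I" "W \<in> S" for \<phi> W
  proof -
    note vW = S(2)[OF that(2)]
    have "\<phi> W i \<in> W" if "i < v W" for i using \<open>\<phi> \<in> I\<close> \<open>W \<in> S\<close> Z(2) that unfolding I_def by fast
    then show ?thesis unfolding s_def using unif_V[OF vW] by (intro V_closed(4,7,8)[OF vW]) auto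
  qed
  \<comment> \<open>A common precision for all places: the sum is at least each single
    \<open>v W\<close>.\<close>
  define N where "N = (\<Sum>W\<in>S. int (v W))"
  have "\<forall>\<phi>\<in>I. \<exists>z\<in>F. \<forall>W\<in>S. vge W N (z - s \<phi> W)"
    using weak_approximation[OF S] sW valr_F S(2) by (metis subsetD)
  then obtain z where z: "\<And>\<phi>. \<phi> \<in> I \<Longrightarrow> z \<phi> \<in> F" "\<And>\<phi> W. \<phi> \<in> I \<Longrightarrow> W \<in> S \<Longrightarrow> vge W N (z \<phi> - s \<phi> W)"
    by metis
  have z': "vge W (int (v W)) (z \<phi> - s \<phi> W)" if "\<phi> \<in> I" "W \<in> S" for \<phi> W
  proof -
    have "int (v W) \<le> N" unfolding N_def using that S(1) by (intro member_le_sum) auto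
    then show ?thesis using z(2)[OF that] vge_mono[OF S(2)[OF that(2)]] by blast
  qed
  define A where "A = F \<inter> \<Inter> S"
  have A: "subring_set A" "A \<subseteq> F"
    using V_closed[OF S(2)] subring_F unfolding A_def subring_set_def by auto
  have zA: "z \<phi> \<in> A" if "\<phi> \<in> I" for \<phi>
  proof -
    have "z \<phi> \<in> W" if W: "W \<in> S" for W
    proof -
      have "z \<phi> - s \<phi> W \<in> W" using vge_mono[OF S(2)[OF W] z'[OF \<open>\<phi> \<in> I\<close> W], of 0] by (simp add: vge_def)
      then have "z \<phi> - s \<phi> W + s \<phi> W \<in> W" using sW[OF \<open>\<phi> \<in> I\<close> W] by (rule V_closed(3)[OF S(2)[OF W]])
      then show ?thesis by simp
    qed
    then show ?thesis using z(1) that unfolding A_def by blast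
  qed
  have incong: "\<phi> = \<psi>" if I: "\<phi> \<in> I" "\<psi> \<in> I" and d: "(z \<phi> - z \<psi>) / g \<in> A" for \<phi> \<psi>
  proof -
    have "\<phi> W i = \<psi> W i" if W: "W \<in> S" and i: "i < v W" for W i
    proof -
      note vW = S(2)[OF W]
      have "vge W (0 + val W g) ((z \<phi> - z \<psi>) / g * g)"
        using d W by (intro vge_mult[OF vW]) (auto simp: vge_def[of W 0] A_def vge_iff[OF vW gF])
      then have "vge W (int (v W)) (z \<phi> - z \<psi>)" using g(2) v[OF W] by simp
      then have "vge W (int (v W)) ((z \<phi> - z \<psi>) - (z \<phi> - s \<phi> W) + (z \<psi> - s \<psi> W))"
        by (rule vge_add[OF vW vge_diff[OF vW _ z'[OF I(1) W]] z'[OF I(2) W]])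
      moreover have "(z \<phi> - z \<psi>) - (z \<phi> - s \<phi> W) + (z \<psi> - s \<psi> W) = (\<Sum>i<v W. (\<phi> W i - \<psi> W i) * unif W ^ i)"
        unfolding s_def by (simp add: sum_subtractf algebra_simps)
      moreover have pW: "\<phi> W j \<in> Z W" "\<psi> W j \<in> Z W" if "j < v W" for j
        using I W that unfolding I_def by fast+
      moreover have "\<phi> W j - \<psi> W j \<in> W" if "j < v W" for j
        using pW[OF that] Z(2)[OF W] V_closed(6)[OF vW] by blast
      ultimately have "\<forall>i<v W. \<phi> W i - \<psi> W i = 0"
        using Z(4)[OF W] by (intro sum_unif_zero[OF vW]) auto
      then show ?thesis using i by simp
    qed
    then have "\<phi> W = \<psi> W" if W: "W \<in> S" for W
      using PiE_mem[OF I(1)[unfolded I_def] W] PiE_mem[OF I(2)[unfolded I_def] W] W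
      by (intro PiE_ext[of _ "{..<v W}" "\<lambda>_. Z W"]) auto
    then show ?thesis by (rule PiE_ext[OF I[unfolded I_def]])
  qed
  have fin: "finite I" unfolding I_def using S(1) Z(1) by (intro finite_PiE) auto
  have inj: "inj_on z I"
    using incong subring_set_closed(1)[OF A(1)] by (intro inj_onI) auto
  have "card (z ` I) \<le> card K ^ (n * \<delta>)"
  proof (rule incongruent_card_le[OF A _ _ g(1,2) _ f12])
    show "g \<in> A" using gF g(3) by (auto simp: A_def)
  qed (use fin zA incong in auto)
  moreover have "card I = (\<Prod>W\<in>S. card (resid W) ^ v W)"
    unfolding I_def using S(1) Z(3) by (simp add: card_PiE)
  ultimately show ?thesis using card_image[OF inj] by (simp add: v_def)
qed

end

section \<open>Existence of valuation rings\<close>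

text \<open>
  A relation of degree at most \<open>m\<close> witnessing that \<open>t\<close> becomes a unit in \<open>V[z]\<close>. As in Chevalley's
  extension theorem, a maximal \<open>V\<close> in which \<open>t\<close> is not a unit is a valuation ring.
\<close>

definition shrinks :: "'a::field set \<Rightarrow> 'a \<Rightarrow> 'a \<Rightarrow> nat \<Rightarrow> bool" where
  "shrinks V t z m \<longleftrightarrow>
     (\<exists>b. (\<forall>i. b i \<in> V) \<and> (\<forall>i>m. b i = 0) \<and> t * (\<Sum>i\<le>m. b i * z ^ i) = 1)"

context
  fixes V :: "'a::field set" and t :: 'a
  assumes V: "subring_set V" and tV: "t \<in> V" and t: "t \<noteq> 0" "inverse t \<notin> V"
begin

text \<open>Multiplying the relation for \<open>1 / z\<close> by \<open>z^M\<close> expresses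
  \<open>(1 - t * c 0) * z^M\<close> through lower powers. The relation for \<open>z\<close>,
  multiplied by \<open>1 - t * c 0\<close>, can then be freed of its top term, and the summand
  \<open>t * c 0\<close> brings the right-hand side back to \<open>1\<close>.\<close>

lemma shrinks_step:
  assumes z: "z \<noteq> 0" and zm: "shrinks V t z (Suc m)" and zl: "shrinks V t (inverse z) l" and l: "l \<le> Suc m"
  shows "shrinks V t z m"
proof -
  obtain b where b: "\<And>i. b i \<in> V" "\<And>i. i > Suc m \<Longrightarrow> b i = 0" "t * (\<Sum>i\<le>Suc m. b i * z ^ i) = 1"
    using zm unfolding shrinks_def by blast
  obtain c where c: "\<And>i. c i \<in> V" "\<And>i. i > l \<Longrightarrow> c i = 0" "t * (\<Sum>i\<le>l. c i * inverse z ^ i) = 1"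
    using zl unfolding shrinks_def by blast
  define M where "M = Suc m"
  have "(\<Sum>i\<le>M. c i * inverse z ^ i) = (\<Sum>i\<le>l. c i * inverse z ^ i)"
    using c(2) l by (intro sum.mono_neutral_right) (auto simp: M_def)
  then have "t * (\<Sum>i\<le>M. c i * inverse z ^ i) = 1" using c(3) by simp
  then have "t * (z ^ M * (\<Sum>i\<le>M. c i * inverse z ^ i)) = z ^ M" by (simp add: algebra_simps)
  also have "z ^ M * (\<Sum>i\<le>M. c i * inverse z ^ i) = (\<Sum>i\<le>M. c i * z ^ (M - i))"
    unfolding sum_distrib_left
  proof (intro sum.cong refl)
    fix i assume "i \<in> {..M}"
    then have "z ^ M = z ^ (M - i) * z ^ i" by (simp flip: power_add)
    then show "z ^ M * (c i * inverse z ^ i) = c i * z ^ (M - i)" using z by (simp add: field_simps)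
  qed
  also have "\<dots> = (\<Sum>i\<le>M. c (M - i) * z ^ i)"
    by (rule sum.reindex_bij_witness[of _ "\<lambda>i. M - i" "\<lambda>i. M - i"]) auto
  also have "\<dots> = c 0 * z ^ M + (\<Sum>i\<le>m. c (M - i) * z ^ i)"
    by (simp add: M_def)
  finally have 1: "t * (\<Sum>i\<le>m. c (M - i) * z ^ i) = (1 - t * c 0) * z ^ M" by (simp add: algebra_simps)
  have 2: "t * (\<Sum>i\<le>m. b i * z ^ i) = 1 - t * b M * z ^ M" using b(3) by (simp add: M_def algebra_simps)
  define b' where "b' i = (if i \<le> m then (if i = 0 then c 0 else 0) + b i * (1 - t * c 0) + c (M - i) * (t * b M) else 0)" for i
  have "b' i \<in> V" for i
    unfolding b'_def using b(1) c(1) tV subring_set_closed[OF V] by simp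
  moreover have "t * (\<Sum>i\<le>m. b' i * z ^ i) = 1"
  proof -
    have "(\<Sum>i\<le>m. b' i * z ^ i) = (\<Sum>i\<le>m. (if i = 0 then c 0 else 0) * z ^ i) + (1 - t * c 0) * (\<Sum>i\<le>m. b i * z ^ i)
       + (t * b M) * (\<Sum>i\<le>m. c (M - i) * z ^ i)"
      unfolding sum_distrib_left sum.distrib[symmetric]
      by (intro sum.cong refl) (simp add: b'_def algebra_simps)
    also have "(\<Sum>i\<le>m. (if i = 0 then c 0 else 0) * z ^ i) = (\<Sum>i\<in>{..m}. if i = 0 then c 0 else 0)"
      by (intro sum.cong) auto
    also have "\<dots> = c 0" by simp
    finally have e: "(\<Sum>i\<le>m. b' i * z ^ i) = c 0 + (1 - t * c 0) * (\<Sum>i\<le>m. b i * z ^ i)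
       + (t * b M) * (\<Sum>i\<le>m. c (M - i) * z ^ i)" .
    have "t * (\<Sum>i\<le>m. b' i * z ^ i) = t * c 0 + (1 - t * c 0) * (t * (\<Sum>i\<le>m. b i * z ^ i))
       + (t * b M) * (t * (\<Sum>i\<le>m. c (M - i) * z ^ i))"
      unfolding e by (simp add: algebra_simps)
    then show ?thesis unfolding 1 2 by (simp add: algebra_simps)
  qed
  ultimately show ?thesis unfolding shrinks_def by (intro exI[of _ b']) (auto simp: b'_def)
qed

text \<open>Descent on \<open>m + l\<close>: the longer relation is shortened by means of the other
  one. Neither length can be \<open>0\<close>, since that would put \<open>inverse t\<close> into
  \<open>V\<close>.\<close>

lemma not_shrinks_both: "z \<noteq> 0 \<Longrightarrow> shrinks V t z m \<Longrightarrow> shrinks V t (inverse z) l \<Longrightarrow> False"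
proof (induction "m + l" arbitrary: z m l rule: less_induct)
  case less
  have n0: "\<not> shrinks V t x 0" for x
  proof
    assume "shrinks V t x 0"
    then obtain b where "b \<in> V" "t * b = 1" unfolding shrinks_def by auto
    then show False using t by (metis inverse_unique)
  qed
  then obtain m' l' where ml: "m = Suc m'" "l = Suc l'" using less.prems(2,3) by (metis not0_implies_Suc)
  show ?case
  proof (cases "l \<le> m")
    case True
    then have "shrinks V t z m'" using shrinks_step[of z m' l] less.prems ml by simp
    then show False using less.hyps[of m' l z] less.prems ml by simp
  next
    case False
    then have "shrinks V t (inverse z) l'" using shrinks_step[of "inverse z" l' m] less.prems ml by simp
    then show False using less.hyps[of m l' z] less.prems ml by simp
  qed
qed

end

section \<open>Chevalley extension, integrality and a place at infinity\<close>

lemma poly_in_subring: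
  assumes S: "subring_set S" and p: "p \<in> polys T" "T \<subseteq> S" and z: "z \<in> S"
  shows "poly p z \<in> S"
  unfolding poly_altdef
proof (intro subring_set_sum[OF S] subring_set_closed(4)[OF S] subring_set_power[OF S z])
  show "Polynomial.coeff p i \<in> S" for i using p by (auto simp: polys_def)
qed

lemma subring_poly_image:
  assumes "subring_set S"
  shows "subring_set ((\<lambda>p. poly p z) ` polys S)" "S \<subseteq> (\<lambda>p. poly p z) ` polys S" "z \<in> (\<lambda>p. poly p z) ` polys S"
proof -
  note c = polys_closed[OF assms]
  show "subring_set ((\<lambda>p. poly p z) ` polys S)"
    unfolding subring_set_def
  proof (intro conjI ballI)
    show "0 \<in> (\<lambda>p. poly p z) ` polys S" using c(1) by (intro image_eqI[of _ _ 0]) auto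
    show "1 \<in> (\<lambda>p. poly p z) ` polys S" using c(2) by (intro image_eqI[of _ _ 1]) auto
  next
    fix a b assume "a \<in> (\<lambda>p. poly p z) ` polys S" "b \<in> (\<lambda>p. poly p z) ` polys S"
    then obtain p q where pq: "a = poly p z" "b = poly q z" "p \<in> polys S" "q \<in> polys S" by blast
    show "a + b \<in> (\<lambda>p. poly p z) ` polys S" using pq c(3) by (intro image_eqI[of _ _ "p + q"]) auto
    show "a * b \<in> (\<lambda>p. poly p z) ` polys S" using pq c(4) by (intro image_eqI[of _ _ "p * q"]) auto
  next
    fix a assume "a \<in> (\<lambda>p. poly p z) ` polys S"
    then obtain p where pq: "a = poly p z" "p \<in> polys S" by blast
    show "- a \<in> (\<lambda>p. poly p z) ` polys S" using pq c(5) by (intro image_eqI[of _ _ "- p"]) auto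
  qed
  show "S \<subseteq> (\<lambda>p. poly p z) ` polys S"
  proof
    fix a assume "a \<in> S"
    then show "a \<in> (\<lambda>p. poly p z) ` polys S" using c(1,8) by (intro image_eqI[of _ _ "[:a:]"]) auto
  qed
  show "z \<in> (\<lambda>p. poly p z) ` polys S"
    using c(1,8) subring_set_closed(1,2)[OF assms] by (intro image_eqI[of _ _ "[:0, 1:]"]) auto
qed

context transcendental_ext
begin

text \<open>Take a maximal subring of \<open>F\<close> above \<open>R0\<close> without
  \<open>inverse t\<close>. Adjoining any further \<open>z\<close> yields \<open>inverse t\<close>,
  that is, a relation in \<open>z\<close>; having one for \<open>z\<close> and one for
  \<open>1 / z\<close> is what \<open>not_shrinks_both\<close> excludes. Tracking the one element
  \<open>t\<close> replaces the prime ideal of the usual formulation.\<close>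

lemma extend_to_valr:
  assumes R0: "subring_set R0" "K \<subseteq> R0" "R0 \<subseteq> F" and t: "t \<in> R0" "t \<noteq> 0" "inverse t \<notin> R0"
  shows "\<exists>V. valr V \<and> R0 \<subseteq> V \<and> t \<in> mx V"
proof -
  define \<A> where "\<A> = {S. subring_set S \<and> R0 \<subseteq> S \<and> S \<subseteq> F \<and> inverse t \<notin> S}"
  have "\<exists>V\<in>\<A>. \<forall>Y\<in>\<A>. V \<subseteq> Y \<longrightarrow> Y = V"
  proof (rule subset_Zorn_nonempty)
    have "R0 \<in> \<A>" unfolding \<A>_def using R0 t by blast
    then show "\<A> \<noteq> {}" by blast
    fix \<C> assume C: "\<C> \<noteq> {}" "subset.chain \<A> \<C>"
    have two: "\<exists>S\<in>\<C>. a \<in> S \<and> b \<in> S" if ab: "a \<in> \<Union>\<C>" "b \<in> \<Union>\<C>" for a b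
    proof -
      obtain S T where "a \<in> S" "b \<in> T" "S \<in> \<C>" "T \<in> \<C>" using ab by blast
      moreover then have "S \<subseteq> T \<or> T \<subseteq> S" using C(2) by (auto simp: subset.chain_def)
      ultimately show ?thesis by blast
    qed
    have CA: "S \<in> \<A>" if "S \<in> \<C>" for S using C(2) that by (auto simp: subset.chain_def)
    have "subring_set (\<Union>\<C>)" unfolding subring_set_def
    proof (intro conjI ballI)
      obtain S where "S \<in> \<C>" using C(1) by blast
      then show "0 \<in> \<Union>\<C>" "1 \<in> \<Union>\<C>" using CA[of S] subring_set_closed(1,2)[of S] by (auto simp: \<A>_def)
    next
      fix a b assume "a \<in> \<Union>\<C>" "b \<in> \<Union>\<C>"
      then obtain S where S: "S \<in> \<C>" "a \<in> S" "b \<in> S" using two by blast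
      then have "subring_set S" using CA by (auto simp: \<A>_def)
      then show "a + b \<in> \<Union>\<C>" "a * b \<in> \<Union>\<C>" using S subring_set_closed(3,4) by blast+
    next
      fix a assume "a \<in> \<Union>\<C>"
      then obtain S where S: "S \<in> \<C>" "a \<in> S" by blast
      then have "subring_set S" using CA by (auto simp: \<A>_def)
      then show "- a \<in> \<Union>\<C>" using S subring_set_closed(5) by blast
    qed
    moreover have "R0 \<subseteq> \<Union>\<C>" "\<Union>\<C> \<subseteq> F" "inverse t \<notin> \<Union>\<C>" using C(1) CA by (fastforce simp: \<A>_def)+
    ultimately show "\<Union>\<C> \<in> \<A>" by (simp add: \<A>_def)
  qed
  then obtain V where V: "subring_set V" "R0 \<subseteq> V" "V \<subseteq> F" "inverse t \<notin> V"
    and max: "\<And>Y. Y \<in> \<A> \<Longrightarrow> V \<subseteq> Y \<Longrightarrow> Y = V" by (auto simp: \<A>_def)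
  have tV: "t \<in> V" using t V by blast
  have shrinks: "\<exists>m. shrinks V t z m" if z: "z \<in> F" "z \<notin> V" for z
  proof -
    let ?X = "(\<lambda>p. poly p z) ` polys V"
    have XF: "?X \<subseteq> F"
      using poly_in_subring[OF subring_F _ V(3) z(1)] by blast
    have "inverse t \<in> ?X"
    proof (rule ccontr)
      assume "inverse t \<notin> ?X"
      then have "?X \<in> \<A>" using subring_poly_image[OF V(1), of z] XF V(2) by (auto simp: \<A>_def)
      then have "?X = V" using max subring_poly_image(2)[OF V(1), of z] by blast
      then show False using subring_poly_image(3)[OF V(1), of z] z by blast
    qed
    then obtain p where p: "p \<in> polys V" "inverse t = poly p z" by blast
    have "t * poly p z = 1" using p(2) t(2) by (metis right_inverse)
    then have "t * (\<Sum>i\<le>Polynomial.degree p. Polynomial.coeff p i * z ^ i) = 1" by (simp add: poly_altdef)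
    then have "shrinks V t z (Polynomial.degree p)"
      unfolding shrinks_def using p(1) Polynomial.coeff_eq_0
      by (intro exI[of _ "Polynomial.coeff p"]) (auto simp: polys_def)
    then show ?thesis by blast
  qed
  have "z \<in> V \<or> inverse z \<in> V" if z: "z \<in> F" for z
  proof (rule ccontr)
    assume n: "\<not> ?thesis"
    then have z0: "z \<noteq> 0" using subring_set_closed(1)[OF V(1)] by auto
    obtain m where m: "shrinks V t z m" using shrinks z n by blast
    obtain l where l: "shrinks V t (inverse z) l"
      using shrinks[of "inverse z"] F_closed(9)[OF z] n by blast
    show False by (rule not_shrinks_both[OF V(1) tV t(2) V(4) z0 m l])
  qed
  moreover have "V \<noteq> F" using V(2-4) t(1) R0(3) F_closed(9) by blast
  ultimately have "valr V" using V R0(2) by (auto simp: valr_def)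
  moreover have "t \<in> mx V" using tV V(4) by (simp add: mx_def)
  ultimately show ?thesis using V(2) by blast
qed

text \<open>If \<open>z\<close> were not in \<open>R[1 / z]\<close>, some valuation ring above
  \<open>R[1 / z]\<close> would have \<open>1 / z\<close> as a nonunit and contradict regularity. So
  \<open>z\<close> is integral over \<open>R\<close>, and a common denominator of finitely many
  powers works for all of them by recursion.\<close>

lemma regular_powers_bounded:
  assumes z: "z \<in> F" and reg: "\<And>V. valr V \<Longrightarrow> u \<in> V \<Longrightarrow> z \<in> V"
  shows "\<exists>d\<in>polys K. d \<noteq> 0 \<and> (\<forall>N. poly d u * z ^ N \<in> R)"
proof (cases "z = 0")
  case True
  have "poly 1 u * z ^ N \<in> R" for N using True R_closed by (cases N) auto
  then show ?thesis using K_polys(2) by (intro bexI[of _ 1]) auto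
next
  case False
  let ?t = "inverse z"
  let ?X = "(\<lambda>p. poly p ?t) ` polys R"
  have tF: "?t \<in> F" using F_closed(9)[OF z] .
  have "z \<in> ?X"
  proof (rule ccontr)
    assume n: "z \<notin> ?X"
    have "?X \<subseteq> F"
      using poly_in_subring[OF subring_F _ R_subset_F tF] by blast
    moreover have "K \<subseteq> ?X" using subring_poly_image(2)[OF subring_R] K_subset_R by blast
    ultimately obtain V where V: "valr V" "?X \<subseteq> V" "?t \<in> mx V"
      using extend_to_valr[OF subring_poly_image(1)[OF subring_R, of ?t], of ?t] subring_poly_image(3)[OF subring_R]
        False n by auto
    have "u \<in> V" using V(2) u_in_R subring_poly_image(2)[OF subring_R] by blast
    then have "z \<in> V" using reg V(1) by blast
    then show False using V(3) False by (simp add: mx_def)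
  qed
  then obtain p where p: "p \<in> polys R" "z = poly p ?t" by blast
  define m where "m = Polynomial.degree p"
  obtain d where d: "d \<in> polys K" "d \<noteq> 0" "\<exists>C. \<forall>x\<in>(\<lambda>i. z ^ i) ` {..m}. poly d u * x \<in> Rlt C"
    using common_denominator[of "(\<lambda>i. z ^ i) ` {..m}"] F_closed(7)[OF z] by auto
  have "poly d u * z ^ N \<in> R" for N
  proof (induction N rule: less_induct)
    case (less N)
    show ?case
    proof (cases "N \<le> m")
      case True
      then show ?thesis using d(3) Rlt_subset by blast
    next
      case False
      then obtain N' where N': "N = Suc N'" "m \<le> N'" by (cases N) auto
      have "z ^ N = z ^ N' * poly p ?t" unfolding N'(1) power_Suc2 using p(2) by simp
      also have "\<dots> = (\<Sum>i\<le>m. Polynomial.coeff p i * z ^ (N' - i))"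
        unfolding poly_altdef m_def[symmetric] sum_distrib_left
      proof (intro sum.cong refl)
        fix i assume "i \<in> {..m}"
        then have "z ^ N' = z ^ (N' - i) * z ^ i" using N' by (simp flip: power_add)
        then show "z ^ N' * (Polynomial.coeff p i * ?t ^ i) = Polynomial.coeff p i * z ^ (N' - i)"
          using False \<open>z \<noteq> 0\<close> by (simp add: field_simps)
      qed
      finally have "poly d u * z ^ N = (\<Sum>i\<le>m. Polynomial.coeff p i * (poly d u * z ^ (N' - i)))"
        by (simp add: sum_distrib_left mult_ac)
      also have "\<dots> \<in> R"
      proof (rule R_sum)
        fix i
        have "Polynomial.coeff p i \<in> R" using p(1) by (auto simp: polys_def)
        moreover have "poly d u * z ^ (N' - i) \<in> R" using less[of "N' - i"] N' by simp
        ultimately show "Polynomial.coeff p i * (poly d u * z ^ (N' - i)) \<in> R"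
          by (rule R_closed(4))
      qed
      finally show ?thesis .
    qed
  qed
  then show ?thesis using d by blast
qed

text \<open>Extend \<open>K[1 / u]\<close> so that \<open>1 / u\<close> becomes a nonunit. This is
  possible because \<open>u = p(1 / u)\<close>, multiplied by a power of \<open>u\<close>, would be
  a polynomial relation for \<open>u\<close>.\<close>

lemma ex_valr_at_infinity: "\<exists>V. valr V \<and> u \<notin> V"
proof -
  let ?t = "inverse u"
  let ?X = "(\<lambda>p. poly p ?t) ` polys K"
  have u0: "u \<noteq> 0" using transcendental_u[of "[:0, 1:]"] K_polys subring_set_closed[OF subring_K] by auto
  have uF: "u \<in> F" using u_in_R R_subset_F by blast
  have tF: "?t \<in> F" using F_closed(9)[OF uF] .
  have KF: "K \<subseteq> F" using K_subset_R R_subset_F by blast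
  have "u \<notin> ?X"
  proof
    assume "u \<in> ?X"
    then obtain p where p: "p \<in> polys K" "u = poly p ?t" by blast
    define m where "m = Polynomial.degree p"
    define r where "r = Polynomial.monom 1 (Suc m) - (\<Sum>i\<le>m. Polynomial.monom (Polynomial.coeff p i) (m - i))"
    have "u ^ Suc m = u ^ m * poly p ?t" using p(2) by simp
    also have "\<dots> = (\<Sum>i\<le>m. Polynomial.coeff p i * u ^ (m - i))"
      unfolding poly_altdef m_def[symmetric] sum_distrib_left
    proof (intro sum.cong refl)
      fix i assume "i \<in> {..m}"
      then have "u ^ m = u ^ (m - i) * u ^ i" by (simp flip: power_add)
      then show "u ^ m * (Polynomial.coeff p i * ?t ^ i) = Polynomial.coeff p i * u ^ (m - i)"
        using u0 by (simp add: field_simps)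
    qed
    finally have "poly r u = 0" by (simp add: r_def poly_sum Polynomial.poly_monom)
    moreover have "r \<in> polys K" unfolding r_def using p(1) subring_set_closed(2)[OF subring_K]
      by (intro K_polys(6) K_polys(9) polys_sum[OF subring_K]) (auto simp: polys_def)
    ultimately have "r = 0" using transcendental_u by blast
    moreover have "Polynomial.coeff r (Suc m) = 1"
    proof -
      have "Polynomial.coeff (Polynomial.monom (Polynomial.coeff p i) (m - i)) (Suc m) = 0" for i by simp
      then show ?thesis unfolding r_def Polynomial.coeff_diff Polynomial.coeff_sum by (simp only: sum.neutral_const) simp
    qed
    ultimately show False by simp
  qed
  moreover have "?X \<subseteq> F"
    using poly_in_subring[OF subring_F _ KF tF] by blast
  ultimately obtain V where "valr V" "?t \<in> mx V"
    using extend_to_valr[OF subring_poly_image(1,2)[OF subring_K, of ?t], of ?t]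
      subring_poly_image(3)[OF subring_K] u0 by auto
  then show ?thesis using u0 by (intro exI[of _ V]) (auto simp: mx_def)
qed

lemma val_sum_distinct:
  assumes V: "valr V" and A: "finite A" "A \<noteq> {}" and a: "\<And>i. i \<in> A \<Longrightarrow> a i \<in> F \<and> a i \<noteq> 0"
    and inj: "inj_on (\<lambda>i. val V (a i)) A"
  shows "sum a A \<noteq> 0 \<and> val V (sum a A) = Min ((\<lambda>i. val V (a i)) ` A)"
proof -
  define M where "M = Min ((\<lambda>i. val V (a i)) ` A)"
  have "M \<in> (\<lambda>i. val V (a i)) ` A" unfolding M_def using A by (intro Min_in) auto
  then obtain i0 where i0: "i0 \<in> A" "M = val V (a i0)" by blast
  have gt: "val V (a i) > M" if "i \<in> A - {i0}" for i
  proof -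
    have "M \<le> val V (a i)" unfolding M_def using A that by (intro Min_le) auto
    moreover have "val V (a i) \<noteq> val V (a i0)" using inj that i0 by (auto simp: inj_on_def)
    ultimately show ?thesis using i0 by simp
  qed
  define x where "x = unif V powi M"
  have x: "x \<noteq> 0" unfolding x_def using unif(2)[OF V] by simp
  have "a i0 / x \<in> V - mx V" unfolding x_def i0(2) using val_unit[OF V] a i0 by blast
  moreover have "(\<Sum>i\<in>A - {i0}. a i) / x \<in> mx V"
  proof -
    have "vge V (M + 1) (\<Sum>i\<in>A - {i0}. a i)"
      using gt vge_iff[OF V] a by (intro vge_sum[OF V]) fastforce
    then have "(\<Sum>i\<in>A - {i0}. a i) / x / unif V \<in> V"
      unfolding vge_def x_def using unif(2)[OF V] by (simp add: power_int_add)
    then show ?thesis using mx_iff_unif[OF V] by blast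
  qed
  moreover have "sum a A / x = a i0 / x + (\<Sum>i\<in>A - {i0}. a i) / x"
    using A(1) i0(1) by (simp add: sum.remove add_divide_distrib)
  ultimately have u: "sum a A / x \<in> V - mx V"
    using V_closed(3)[OF V] mx_subset[OF V] mx_diff[OF V, of "sum a A / x" "(\<Sum>i\<in>A - {i0}. a i) / x"] by auto
  then have "sum a A \<noteq> 0" using zero_in_mx[OF V] by auto
  moreover have "val V (sum a A) = M" using u unfolding x_def by (rule valI[OF V])
  ultimately show ?thesis by (simp add: M_def)
qed

section \<open>Values of polynomials at a pole of \<open>u\<close>\<close>

lemma uF: "u \<in> F" and wF: "w \<in> F" and KF: "K \<subseteq> F"
  using u_in_R w_in_R K_subset_R R_subset_F by auto

lemma poly_F: "g \<in> polys K \<Longrightarrow> poly g u \<in> F"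
  using R_poly R_subset_F by blast

lemma u_nz: "u \<noteq> 0"
  using transcendental_u[of "[:0, 1:]"] K_polys subring_set_closed[OF subring_K] by auto

lemma const_unit: "valr V \<Longrightarrow> c \<in> K \<Longrightarrow> c \<noteq> 0 \<Longrightarrow> c \<in> V - mx V"
  using valr_K[of V] subfield_set_closed(2)[OF subfield_K, of c] by (auto simp: mx_def)

lemma val_poly_at_infinity:
  assumes V: "valr V" "u \<notin> V" and g: "g \<in> polys K" "g \<noteq> 0"
  shows "val V (poly g u) = int (Polynomial.degree g) * val V u"
proof -
  define A where "A = {i. i \<le> Polynomial.degree g \<and> Polynomial.coeff g i \<noteq> 0}"
  have neg: "val V u < 0" using V_iff_val[OF V(1) uF] V(2) u_nz by auto
  have A: "finite A" "Polynomial.degree g \<in> A" using g by (auto simp: A_def)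
  have cK: "Polynomial.coeff g i \<in> K" for i using g by (auto simp: polys_def)
  have c: "Polynomial.coeff g i * u ^ i \<in> F \<and> Polynomial.coeff g i * u ^ i \<noteq> 0" if "i \<in> A" for i
    using that u_nz F_closed(4)[OF subsetD[OF KF cK] F_closed(7)[OF uF]] by (simp add: A_def)
  have v: "val V (Polynomial.coeff g i * u ^ i) = int i * val V u" if "i \<in> A" for i
  proof -
    have "Polynomial.coeff g i \<noteq> 0" using that by (simp add: A_def)
    moreover have "val V (Polynomial.coeff g i) = 0"
      using const_unit[OF V(1) cK] calculation by (intro valI[OF V(1)]) auto
    ultimately show ?thesis
      using val_mult[OF V(1), of "Polynomial.coeff g i" "u ^ i"] val_power[OF V(1) uF u_nz]
        cK KF F_closed(7)[OF uF] u_nz by auto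
  qed
  have inj: "inj_on (\<lambda>i. val V (Polynomial.coeff g i * u ^ i)) A"
    using neg by (intro inj_onI) (simp add: v)
  have "poly g u = (\<Sum>i\<in>A. Polynomial.coeff g i * u ^ i)"
    unfolding poly_altdef A_def by (intro sum.mono_neutral_right) auto
  then have "val V (poly g u) = Min ((\<lambda>i. val V (Polynomial.coeff g i * u ^ i)) ` A)"
    using val_sum_distinct[OF V(1) A(1) _ c inj] A(2) by auto
  also have "(\<lambda>i. val V (Polynomial.coeff g i * u ^ i)) ` A = (\<lambda>i. int i * val V u) ` A"
    using v by (intro image_cong) auto
  also have "Min ((\<lambda>i. int i * val V u) ` A) = int (Polynomial.degree g) * val V u"
    using A neg by (intro Min_eqI) (auto simp: A_def mult_right_mono_neg)
  finally show ?thesis .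
qed

lemma card_K_le_resid: "valr V \<Longrightarrow> card K \<le> card (resid V)"
proof -
  assume V: "valr V"
  have "inj_on (\<lambda>c. {z \<in> V. z - c \<in> mx V}) K"
  proof (rule inj_onI)
    fix b c assume bc: "b \<in> K" "c \<in> K" "{z \<in> V. z - b \<in> mx V} = {z \<in> V. z - c \<in> mx V}"
    then have "b - c \<in> mx V" using resid_class_eq[OF V] valr_K[OF V] by blast
    then show "b = c" using const_unit[OF V, of "b - c"] bc subring_set_closed(6)[OF subring_K] by auto
  qed
  then have cK: "card K = card ((\<lambda>c. {z \<in> V. z - c \<in> mx V}) ` K)" by (rule card_image[symmetric])
  have "(\<lambda>c. {z \<in> V. z - c \<in> mx V}) ` K \<subseteq> resid V" unfolding resid_def[OF V] using valr_K[OF V] by blast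
  then have "card ((\<lambda>c. {z \<in> V. z - c \<in> mx V}) ` K) \<le> card (resid V)"
    by (rule card_mono[OF finite_resid[OF V]])
  then show ?thesis unfolding cK .
qed

end

section \<open>The place at infinity of a superelliptic function field\<close>

text \<open>Squarefreeness is imposed over the algebraic closure, where it says that all roots are
  simple; this is the form in which \<open>dvd_of_power_dvd\<close> takes it. Coprimality of
  \<open>n\<close> and \<open>d\<close> is what produces a single place over
  \<open>u = \<infinity>\<close>.\<close>

locale superelliptic = transcendental_ext K u w f n
  for K :: "'a::field set" and u w :: 'a and f :: "'a poly" and n :: nat +
  fixes p d :: nat
  assumes prime_p: "Factorial_Ring.prime p" and CHAR_p: "CHAR('a) = p" and p_n: "\<not> p dvd n"
    and degree_f: "Polynomial.degree f = d" and d_pos: "d > 0" and coprime_nd: "coprime n d"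
    and squarefree_f: "rsquarefree (map_poly to_ac f)"
begin

lemma f_nz: "f \<noteq> 0"
  using d_pos degree_f by auto

lemma w_nz: "w \<noteq> 0"
proof
  assume "w = 0"
  then have "poly f u = 0" using w_pow n_pos by (metis zero_power)
  then show False using f_K f_nz transcendental_u by blast
qed

text \<open>\<open>n * val V w = d * val V u\<close> with \<open>n\<close> and \<open>d\<close>
  coprime makes \<open>n\<close> divide \<open>val V u\<close>. That the factor \<open>e\<close> is
  \<open>1\<close> follows only from the count in \<open>at_infinity_card\<close>.\<close>

lemma val_w_at_infinity:
  assumes V: "valr V" "u \<notin> V"
  shows "\<exists>e>0. val V u = - int n * int e \<and> val V w = - int d * int e"
proof -
  have neg: "val V u < 0" using V_iff_val[OF V(1) uF] V(2) u_nz by auto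
  have eq: "int n * val V w = int d * val V u"
    using val_power[OF V(1) wF w_nz, of n] val_poly_at_infinity[OF V f_K f_nz] w_pow degree_f by simp
  then have "int n dvd int d * val V u" by (metis dvd_triv_left)
  then have "int n dvd val V u" using coprime_nd by (metis coprime_dvd_mult_right_iff coprime_int_iff)
  then obtain k where k: "val V u = int n * k" by blast
  have "k < 0" using k neg n_pos by (simp add: mult_less_0_iff)
  then have "val V u = - int n * int (nat (- k))" "nat (- k) > 0" using k by auto
  moreover have "val V w = int d * k" using eq k n_pos by simp
  then have "val V w = - int d * int (nat (- k))" using \<open>k < 0\<close> by simp
  ultimately show ?thesis by blast
qed

text \<open>\<open>sum_of_degrees_le\<close> for \<open>1 / u\<close>, with
  \<open>\<delta> = 1\<close>: the inequality between the sum of \<open>e_i f_i\<close> over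
  \<open>u = \<infinity>\<close> and \<open>n\<close>.\<close>

lemma at_infinity_card:
  assumes S: "finite S" "\<And>V. V \<in> S \<Longrightarrow> valr V \<and> u \<notin> V"
  shows "(\<Prod>V\<in>S. card (resid V) ^ nat (- val V u)) \<le> card K ^ n"
proof -
  have "(\<Prod>V\<in>S. card (resid V) ^ nat (val V (inverse u))) \<le> card K ^ (n * 1)"
  proof (rule sum_of_degrees_le[OF S(1)])
    show "inverse u = poly 1 u / poly [:0, 1:] u" by (simp add: divide_inverse)
    have "[:0, 1:] \<in> polys K" using K_polys subring_set_closed[OF subring_K] by auto
    then show "1 \<in> polys_lt K (Suc 1)" "[:0, 1:] \<in> polys_lt K (Suc 1)"
      using K_polys(2) by (auto intro!: polys_in_lt)
  qed (use S u_nz valr_inverse uF in auto)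
  moreover have "nat (val V (inverse u)) = nat (- val V u)" if "V \<in> S" for V
    using val_inverse[OF _ uF u_nz, of V] S(2)[OF that] by simp
  ultimately show ?thesis by simp
qed

text \<open>One place already contributes at least \<open>n\<close> to a total of at most
  \<open>n\<close>. So \<open>e = 1\<close>, the residue field is no larger than \<open>K\<close>,
  and there is no room for a second place (\<open>at_infinity_unique\<close>).\<close>

lemma at_infinity:
  assumes V: "valr V" "u \<notin> V"
  shows "val V u = - int n" "val V w = - int d" "card (resid V) = card K"
proof -
  obtain e where e: "e > 0" "val V u = - int n * int e" "val V w = - int d * int e"
    using val_w_at_infinity[OF V] by blast
  have le: "card (resid V) ^ (n * e) \<le> card K ^ n"
  proof -
    have "nat (- val V u) = n * e" unfolding e(2) by (simp add: nat_mult_distrib)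
    then show ?thesis using at_infinity_card[of "{V}"] V by simp
  qed
  have "card K ^ (n * e) \<le> card (resid V) ^ (n * e)" using card_K_le_resid[OF V(1)] by (rule power_mono) simp
  then have "card K ^ (n * e) \<le> card K ^ n" using le by linarith
  then have "n * e \<le> n" using card_K_gt_1 by simp
  then have e1: "e = 1" using e n_pos by simp
  then show "val V u = - int n" "val V w = - int d" using e by auto
  have "card (resid V) \<le> card K"
    using le n_pos e1 power_mono_iff[of "card (resid V)" "card K" n] by simp
  then show "card (resid V) = card K" using card_K_le_resid[OF V(1)] by simp
qed

lemma at_infinity_unique:
  assumes V: "valr V" "u \<notin> V" and W: "valr W" "u \<notin> W"
  shows "V = W"
proof (rule ccontr)
  assume "V \<noteq> W"
  then have "(\<Prod>V\<in>{V, W}. card (resid V) ^ nat (- val V u)) = card K ^ (n + n)"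
    using at_infinity[OF V] at_infinity[OF W] by (simp add: power_add)
  moreover have "(\<Prod>V\<in>{V, W}. card (resid V) ^ nat (- val V u)) \<le> card K ^ n"
    using V W by (intro at_infinity_card) auto
  ultimately have "card K ^ (n + n) \<le> card K ^ n" by simp
  then have "n + n \<le> n" using card_K_gt_1 by (subst (asm) power_increasing_iff) auto
  then show False using n_pos by simp
qed

definition Vinf :: "'a set" where "Vinf = (SOME V. valr V \<and> u \<notin> V)"

lemma Vinf: "valr Vinf" "u \<notin> Vinf"
  using someI_ex[OF ex_valr_at_infinity] unfolding Vinf_def by blast+

lemma Vinf_unique: "valr V \<Longrightarrow> u \<notin> V \<Longrightarrow> V = Vinf"
  using at_infinity_unique Vinf by blast

lemmas Vinf_vals = at_infinity[OF Vinf]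

text \<open>Pole order of \<open>g_j(u) w^j\<close> at infinity. For \<open>g j = 0\<close> the
  formula gives \<open>d * j\<close>, which is why that case is kept apart wherever weights are
  compared.\<close>

definition weight :: "(nat \<Rightarrow> 'a poly) \<Rightarrow> nat \<Rightarrow> int" where
  "weight g j = int n * int (Polynomial.degree (g j)) + int d * int j"

text \<open>Modulo \<open>n\<close> the weight is \<open>d * j\<close>, which determines
  \<open>j < n\<close>; so no two nonzero terms have the same pole order and they cannot
  cancel.\<close>

lemma coord_val:
  assumes g: "\<And>j. j < n \<Longrightarrow> g j \<in> polys K" and ne: "\<exists>j<n. g j \<noteq> 0"
  shows "coord g \<noteq> 0" and "\<exists>j<n. g j \<noteq> 0 \<and> val Vinf (coord g) = - weight g j \<and> (\<forall>i<n. g i \<noteq> 0 \<longrightarrow> weight g i \<le> weight g j)"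
proof -
  define A where "A = {j. j < n \<and> g j \<noteq> 0}"
  have A: "finite A" "A \<noteq> {}" using ne by (auto simp: A_def)
  have c: "poly (g j) u * w ^ j \<in> F \<and> poly (g j) u * w ^ j \<noteq> 0" if "j \<in> A" for j
    using that g poly_F poly_u_nz w_nz F_closed(4,7) wF by (auto simp: A_def)
  have v: "val Vinf (poly (g j) u * w ^ j) = - weight g j" if "j \<in> A" for j
  proof -
    have gj: "g j \<in> polys K" "g j \<noteq> 0" using that g by (auto simp: A_def)
    have "val Vinf (poly (g j) u * w ^ j) = val Vinf (poly (g j) u) + val Vinf (w ^ j)"
      using gj poly_F poly_u_nz w_nz F_closed(7)[OF wF] by (intro val_mult[OF Vinf(1)]) auto
    then show ?thesis
      using val_poly_at_infinity[OF Vinf gj] val_power[OF Vinf(1) wF w_nz, of j] Vinf_vals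
      by (simp add: weight_def mult.commute)
  qed
  have inj: "inj_on (weight g) A"
  proof (rule inj_onI)
    fix i j assume ij: "i \<in> A" "j \<in> A" "weight g i = weight g j"
    then have "int d * (int i - int j) = int n * (int (Polynomial.degree (g j)) - int (Polynomial.degree (g i)))"
      by (simp add: weight_def algebra_simps)
    then have "int n dvd int d * (int i - int j)" by simp
    then have "int n dvd int i - int j" using coprime_nd by (metis coprime_dvd_mult_right_iff coprime_int_iff)
    moreover have "\<bar>int i - int j\<bar> < int n" using ij by (auto simp: A_def)
    ultimately show "i = j" using dvd_imp_le_int[of "int i - int j" "int n"] by auto
  qed
  have inj': "inj_on (\<lambda>j. val Vinf (poly (g j) u * w ^ j)) A"
    using inj by (simp add: inj_on_def v)
  have cs: "coord g = (\<Sum>j\<in>A. poly (g j) u * w ^ j)"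
    unfolding coord_def A_def by (intro sum.mono_neutral_right) auto
  show "coord g \<noteq> 0" using val_sum_distinct[OF Vinf(1) A c inj'] unfolding cs by blast
  have "val Vinf (coord g) = Min ((\<lambda>j. val Vinf (poly (g j) u * w ^ j)) ` A)"
    using val_sum_distinct[OF Vinf(1) A c inj'] unfolding cs by blast
  also have "(\<lambda>j. val Vinf (poly (g j) u * w ^ j)) ` A = (\<lambda>j. - weight g j) ` A"
    using v by (intro image_cong) auto
  finally have m: "val Vinf (coord g) = Min ((\<lambda>j. - weight g j) ` A)" .
  have "Min ((\<lambda>j. - weight g j) ` A) \<in> (\<lambda>j. - weight g j) ` A" using A by (intro Min_in) auto
  then obtain j where j: "j \<in> A" "val Vinf (coord g) = - weight g j" using m by auto
  have "weight g i \<le> weight g j" if "i \<in> A" for i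
  proof -
    have "Min ((\<lambda>j. - weight g j) ` A) \<le> - weight g i" using A that by (intro Min_le) auto
    then show ?thesis using j(2) m by linarith
  qed
  then show "\<exists>j<n. g j \<noteq> 0 \<and> val Vinf (coord g) = - weight g j \<and> (\<forall>i<n. g i \<noteq> 0 \<longrightarrow> weight g i \<le> weight g j)"
    using j unfolding A_def by blast
qed

lemma coord_inj:
  assumes g: "\<And>j. j < n \<Longrightarrow> g j \<in> polys K" and h: "\<And>j. j < n \<Longrightarrow> h j \<in> polys K" and eq: "coord g = coord h" and j: "j < n"
  shows "g j = h j"
proof (rule ccontr)
  assume "g j \<noteq> h j"
  then have "coord (\<lambda>j. g j - h j) \<noteq> 0"
    using g h K_polys(6) j by (intro coord_val(1)) auto
  then show False using eq by (simp add: coord_diff)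
qed

lemma vge_coord_iff:
  assumes g: "\<And>j. j < n \<Longrightarrow> g j \<in> polys K"
  shows "vge Vinf (- int k) (coord g) \<longleftrightarrow> (\<forall>j<n. g j = 0 \<or> weight g j \<le> int k)"
proof (cases "\<exists>j<n. g j \<noteq> 0")
  case True
  have F: "coord g \<in> F" unfolding coord_def using g poly_F wF
    by (intro F_closed(8) F_closed(4) F_closed(7)) auto
  obtain j where j: "j < n" "g j \<noteq> 0" "val Vinf (coord g) = - weight g j" "\<And>i. i < n \<Longrightarrow> g i \<noteq> 0 \<Longrightarrow> weight g i \<le> weight g j"
    using coord_val(2)[of g, OF g True] by blast
  have "vge Vinf (- int k) (coord g) \<longleftrightarrow> weight g j \<le> int k"
    using vge_iff[OF Vinf(1) F] coord_val(1)[of g, OF g True] j(3) by auto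
  then show ?thesis using j by (metis order_trans)
next
  case False
  then have "coord g = 0" by (simp add: coord_def)
  then show ?thesis using False vge_0[OF Vinf(1)] by auto
qed

text \<open>
  If \<open>z\<close> has no finite poles, then the denominators of the powers of \<open>z\<close> are bounded. Taking
  \<open>p\<^sup>s\<close>-th powers acts on the coordinates separately and permutes them, because \<open>p\<close> does not divide \<open>n\<close>.
\<close>

lemma regular_in_R:
  assumes z: "z \<in> F" and reg: "\<And>V. valr V \<Longrightarrow> u \<in> V \<Longrightarrow> z \<in> V"
  shows "z \<in> R"
proof -
  obtain b where b: "b \<in> polys K" "b \<noteq> 0" "\<And>N. poly b u * z ^ N \<in> R"
    using regular_powers_bounded[OF z reg] by blast
  obtain h where h: "h \<in> polys K" "h \<noteq> 0" "poly h u * z \<in> R" using F_denominator[OF z] by blast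
  obtain g where g: "poly h u * z = coord g" "\<And>j. g j \<in> polys K" using h(3) by (auto simp: R_def)
  \<comment> \<open>The exponent serves to make \<open>N > n * degree b\<close>, the threshold from
    which \<open>dvd_of_power_dvd\<close> works.\<close>
  define N where "N = p ^ Suc (n * Polynomial.degree b)"
  have N: "N > n * Polynomial.degree b"
  proof -
    have "p \<ge> 2" using prime_p by (rule prime_ge_2_nat)
    then have "Suc (n * Polynomial.degree b) < N" unfolding N_def
      using less_exp order_less_le_trans power_mono by (metis zero_le_numeral)
    then show ?thesis by simp
  qed
  have cop: "coprime n N"
    using p_n prime_p prime_imp_coprime[of p n] unfolding N_def by (metis coprime_commute coprime_power_right_iff)
  obtain e where e: "poly b u * z ^ N = coord e" "\<And>j. e j \<in> polys K" using b(3)[of N] by (auto simp: R_def)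
  define \<pi> where "\<pi> j = (j * N) mod n" for j
  have \<pi>: "\<pi> j < n" for j using n_pos by (simp add: \<pi>_def)
  have \<pi>_inj: "i = j" if "i < n" "j < n" "\<pi> i = \<pi> j" for i j
  proof -
    have "int (i * N) mod int n = int (j * N) mod int n" using that(3) unfolding zmod_int[symmetric] \<pi>_def by simp
    then have "int n dvd int N * (int i - int j)" by (simp add: mod_eq_dvd_iff algebra_simps)
    then have "int n dvd int i - int j" using cop by (metis coprime_dvd_mult_right_iff coprime_int_iff)
    moreover have "\<bar>int i - int j\<bar> < int n" using that by auto
    ultimately show ?thesis using dvd_imp_le_int[of "int i - int j" "int n"] by auto
  qed
  \<comment> \<open>The coefficient at position \<open>\<pi> j\<close> of \<open>b(u)\<close> times
    the \<open>N\<close>-th power of the \<open>j\<close>-th term, after reduction by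
    \<open>w^n = f(u)\<close>.\<close>
  define G where "G j = b * g j ^ N * f ^ ((j * N) div n)" for j
  have GK: "G j \<in> polys K" for j unfolding G_def by (intro K_polys(4,10) b g f_K)
  have "coord (\<lambda>i. h ^ N * e i) = poly h u ^ N * (poly b u * z ^ N)"
    by (simp add: coord_smult e(1))
  also have "\<dots> = poly b u * (poly h u * z) ^ N" by (simp add: power_mult_distrib)
  also have "(poly h u * z) ^ N = (\<Sum>j<n. (poly (g j) u * w ^ j) ^ N)"
    unfolding g(1) coord_def N_def
    by (rule freshmans_dream_sum'[where n = "Suc (n * Polynomial.degree b)"]) (simp_all only: CHAR_p prime_p)
  also have "poly b u * \<dots> = (\<Sum>j<n. poly (G j) u * w ^ \<pi> j)"
    unfolding sum_distrib_left
  proof (intro sum.cong refl)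
    fix j
    have "w ^ (j * N) = poly (f ^ ((j * N) div n)) u * w ^ \<pi> j" unfolding \<pi>_def by (rule w_pow_reduce)
    then show "poly b u * (poly (g j) u * w ^ j) ^ N = poly (G j) u * w ^ \<pi> j"
      by (simp add: G_def power_mult_distrib mult_ac flip: power_mult)
  qed
  also have "\<dots> = coord (\<lambda>i. \<Sum>j<n. if \<pi> j = i then G j else 0)"
  proof -
    have "coord (\<lambda>i. \<Sum>j<n. if \<pi> j = i then G j else 0) = (\<Sum>i<n. \<Sum>j<n. if i = \<pi> j then poly (G j) u * w ^ i else 0)"
      unfolding coord_def poly_sum sum_distrib_right by (intro sum.cong refl) auto
    also have "\<dots> = (\<Sum>j<n. \<Sum>i<n. if i = \<pi> j then poly (G j) u * w ^ i else 0)" by (rule sum.swap)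
    also have "\<dots> = (\<Sum>j<n. poly (G j) u * w ^ \<pi> j)" using \<pi> by (intro sum.cong refl) simp
    finally show ?thesis by simp
  qed
  finally have eq: "coord (\<lambda>i. h ^ N * e i) = coord (\<lambda>i. \<Sum>j<n. if \<pi> j = i then G j else 0)" .
  have "h dvd g j" if j: "j < n" for j
  proof -
    have "h ^ N * e (\<pi> j) = (\<Sum>i<n. if \<pi> i = \<pi> j then G i else 0)"
      using K_polys(4,10) h(1) e(2) K_polys(1) GK
      by (intro coord_inj[OF _ _ eq \<pi>] polys_sum[OF subring_K]) auto
    also have "\<dots> = (\<Sum>i<n. if i = j then G i else 0)"
      using \<pi>_inj j by (intro sum.cong refl) auto
    also have "\<dots> = G j" using j by simp
    finally have "h ^ N dvd G j" by (metis dvd_triv_left)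
    moreover have "n * ((j * N) div n) \<le> (n - 1) * N"
    proof -
      have "n * ((j * N) div n) \<le> j * N" by (rule times_div_less_eq_dividend)
      also have "\<dots> \<le> (n - 1) * N" using j by (intro mult_right_mono) auto
      finally show ?thesis .
    qed
    ultimately show ?thesis
      using dvd_of_power_dvd[OF h(2) b(2) squarefree_f n_pos _ N] unfolding G_def by blast
  qed
  then have "\<exists>s\<in>polys K. g j = h * s" if "j < n" for j
    using polys_dvdE[OF subfield_K h(1,2) g(2)] that by blast
  then obtain s where s: "\<And>j. j < n \<Longrightarrow> s j \<in> polys K \<and> g j = h * s j" by metis
  have "poly h u * z = coord (\<lambda>j. h * (if j < n then s j else 0))"
    unfolding g(1) using s by (intro coord_cong) auto
  then have "z = coord (\<lambda>j. if j < n then s j else 0)"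
    using poly_u_nz[OF h(1,2)] by (simp add: coord_smult)
  then show ?thesis using s K_polys(1) coord_in_R[of "\<lambda>j. if j < n then s j else 0"] by auto
qed

section \<open>Functions with poles only at infinity\<close>

definition Lk :: "nat \<Rightarrow> 'a set" where
  "Lk k = {z \<in> F. (\<forall>V. valr V \<and> u \<in> V \<longrightarrow> z \<in> V) \<and> vge Vinf (- int k) z}"

text \<open>The number of \<open>i\<close> with \<open>n * i + d * j \<le> k\<close>, that is, of
  monomials \<open>u^i w^j\<close> in \<open>Lk k\<close> for fixed \<open>j\<close>.\<close>

definition monomials :: "nat \<Rightarrow> nat \<Rightarrow> nat" where
  "monomials k j = (if d * j \<le> k then Suc ((k - d * j) div n) else 0)"

lemma weight_le_iff:
  assumes "g j \<in> polys K"
  shows "g j = 0 \<or> weight g j \<le> int k \<longleftrightarrow> g j \<in> polys_lt K (monomials k j)"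
proof (cases "g j = 0")
  case False
  have "weight g j \<le> int k \<longleftrightarrow> n * Polynomial.degree (g j) + d * j \<le> k"
    unfolding weight_def by (simp flip: of_nat_mult of_nat_add)
  also have "\<dots> \<longleftrightarrow> Polynomial.degree (g j) < monomials k j"
    using n_pos by (auto simp: monomials_def less_Suc_eq_le less_eq_div_iff_mult_less_eq mult.commute)
  finally show ?thesis using polys_lt_iff[OF False] assms False by blast
qed (use polys_lt_closed(1)[OF subring_K] in auto)

lemma Lk_eq: "Lk k = coord ` (PiE {..<n} (\<lambda>j. polys_lt K (monomials k j)))"
proof (intro equalityI subsetI)
  fix z assume "z \<in> Lk k"
  then have z: "z \<in> F" "\<And>V. valr V \<Longrightarrow> u \<in> V \<Longrightarrow> z \<in> V" "vge Vinf (- int k) z" by (auto simp: Lk_def)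
  obtain g where g: "z = coord g" "\<And>j. g j \<in> polys K" using regular_in_R[OF z(1,2)] by (auto simp: R_def)
  have "restrict g {..<n} \<in> PiE {..<n} (\<lambda>j. polys_lt K (monomials k j))"
    using vge_coord_iff[of g k] z(3) g weight_le_iff by auto
  moreover have "z = coord (restrict g {..<n})" unfolding g(1) by (rule coord_cong) auto
  ultimately show "z \<in> coord ` (PiE {..<n} (\<lambda>j. polys_lt K (monomials k j)))" by blast
next
  fix z assume "z \<in> coord ` (PiE {..<n} (\<lambda>j. polys_lt K (monomials k j)))"
  then obtain g where g: "z = coord g" "\<And>j. j < n \<Longrightarrow> g j \<in> polys_lt K (monomials k j)" by auto
  have gK: "g j \<in> polys K" if "j < n" for j using g(2)[OF that] polys_lt_subset by blast
  have "coord g = coord (\<lambda>j. if j < n then g j else 0)" by (rule coord_cong) auto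
  then have zR: "z \<in> R" unfolding g(1) using gK K_polys(1) coord_in_R[of "\<lambda>j. if j < n then g j else 0"] by auto
  have "vge Vinf (- int k) z" unfolding g(1) using g(2) gK weight_le_iff by (subst vge_coord_iff) auto
  then show "z \<in> Lk k" using zR R_subset_F R_subset_V by (auto simp: Lk_def)
qed

lemma card_Lk: "finite (Lk k)" "card (Lk k) = card K ^ (\<Sum>j<n. monomials k j)"
proof -
  let ?P = "PiE {..<n} (\<lambda>j. polys_lt K (monomials k j))"
  have fin: "finite ?P" by (intro finite_PiE) (auto simp: finite_card_polys_lt[OF subring_K finite_K])
  then show "finite (Lk k)" unfolding Lk_eq by simp
  have "inj_on coord ?P"
  proof (rule inj_onI)
    fix g h assume gh: "g \<in> ?P" "h \<in> ?P" "coord g = coord h"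
    have "g j \<in> polys K" "h j \<in> polys K" if "j < n" for j
      using PiE_mem[OF gh(1)] PiE_mem[OF gh(2)] that polys_lt_subset by blast+
    then have "g j = h j" if "j < n" for j using coord_inj[OF _ _ gh(3)] that by blast
    then show "g = h" using PiE_ext[OF gh(1,2)] by auto
  qed
  then have "card (Lk k) = card ?P" unfolding Lk_eq by (rule card_image)
  also have "\<dots> = card K ^ (\<Sum>j<n. monomials k j)"
    by (simp add: card_PiE finite_card_polys_lt[OF subring_K finite_K] power_sum)
  finally show "card (Lk k) = card K ^ (\<Sum>j<n. monomials k j)" .
qed

text \<open>The remainders of \<open>k - d * j\<close> modulo \<open>n\<close> run through all
  residues once, so they sum to \<open>n (n - 1) / 2\<close>, and this evaluates the sum of the
  quotients exactly. The bound on \<open>k\<close> keeps every \<open>k - d * j\<close> nonnegative;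
  doubling avoids halves.\<close>

lemma sum_monomials:
  assumes k: "k \<ge> d * n"
  shows "2 * int (\<Sum>j<n. monomials k j) = 2 * (int k + 1) - (int n - 1) * (int d - 1)"
proof -
  have le: "d * j \<le> k" if "j < n" for j using that k by (meson less_imp_le mult_le_mono2 order_trans)
  define r where "r j = (k - d * j) mod n" for j
  have inj: "inj_on r {..<n}"
  proof (rule inj_onI)
    fix i j assume ij: "i \<in> {..<n}" "j \<in> {..<n}" "r i = r j"
    have "int (k - d * i) mod int n = int (k - d * j) mod int n"
      using ij(3) unfolding r_def by (simp flip: of_nat_mod)
    then have "int n dvd (int k - int d * int i) - (int k - int d * int j)"
      using le ij by (simp add: of_nat_diff mod_eq_dvd_iff)
    then have "int n dvd int d * (int j - int i)" by (simp add: algebra_simps)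
    then have "int n dvd int j - int i" using coprime_nd by (metis coprime_dvd_mult_right_iff coprime_int_iff)
    moreover have "\<bar>int j - int i\<bar> < int n" using ij by auto
    ultimately show "i = j" using dvd_imp_le_int[of "int j - int i" "int n"] by auto
  qed
  have "r ` {..<n} = {..<n}"
  proof (rule card_subset_eq)
    show "r ` {..<n} \<subseteq> {..<n}" using n_pos by (auto simp: r_def)
    show "card (r ` {..<n}) = card {..<n}" by (rule card_image[OF inj])
  qed simp
  then have sr: "(\<Sum>j<n. r j) = (\<Sum>j<n. j)" using sum.reindex[OF inj, of "\<lambda>j. j"] by simp
  have gauss: "2 * (\<Sum>j<n. int j) = int n * (int n - 1)"
    by (induction n) (auto simp: algebra_simps)
  have m: "int n * int (monomials k j) = int k - int d * int j - int (r j) + int n" if "j < n" for j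
  proof -
    have "n * ((k - d * j) div n) + r j = k - d * j" unfolding r_def by simp
    then have "int n * int ((k - d * j) div n) + int (r j) = int k - int d * int j"
      using le[OF that] by (metis of_nat_add of_nat_diff of_nat_mult)
    then show ?thesis using le[OF that] by (simp add: monomials_def algebra_simps)
  qed
  have "int n * int (\<Sum>j<n. monomials k j) = (\<Sum>j<n. int k - int d * int j - int (r j) + int n)"
    using m by (simp add: sum_distrib_left)
  also have "\<dots> = int n * int k - int d * (\<Sum>j<n. int j) - (\<Sum>j<n. int (r j)) + int n * int n"
    by (simp add: sum.distrib sum_subtractf sum_distrib_left)
  also have "(\<Sum>j<n. int (r j)) = (\<Sum>j<n. int j)" using arg_cong[OF sr, of int] by simp
  finally have "int n * (2 * int (\<Sum>j<n. monomials k j))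
      = 2 * int n * int k - int d * (2 * (\<Sum>j<n. int j)) - 2 * (\<Sum>j<n. int j) + 2 * int n * int n"
    by (simp add: algebra_simps)
  then have "int n * (2 * int (\<Sum>j<n. monomials k j)) = int n * (2 * (int k + 1) - (int n - 1) * (int d - 1))"
    unfolding gauss by (simp add: algebra_simps)
  then show ?thesis using n_pos by simp
qed

end

section \<open>Places and divisors\<close>

lemma (in ring) card_dimension:
  assumes K: "subfield K R" "finite K" and "dimension n K E"
  shows "finite E \<and> card E = card K ^ n"
  using assms(3,1,2)
proof (induct rule: dimension.induct)
  case (Suc_dim v E n K)
  note E = space_subgroup_props[OF Suc_dim(5) Suc_dim(3)]
  note Kc = subfieldE(3)[OF Suc_dim(5)] subringE[OF subfieldE(1)[OF Suc_dim(5)]]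
  have "line_extension K v E = (\<lambda>(k, e). k \<otimes> v \<oplus> e) ` (K \<times> E)"
    using line_extension_mem_iff[of _ K v E] by auto
  moreover have "inj_on (\<lambda>(k, e). k \<otimes> v \<oplus> e) (K \<times> E)"
  proof (rule inj_onI, clarify)
    fix k e k' e'
    assume h: "k \<in> K" "e \<in> E" "k' \<in> K" "e' \<in> E" "k \<otimes> v \<oplus> e = k' \<otimes> v \<oplus> e'"
    have c: "k \<in> carrier R" "k' \<in> carrier R" "e \<in> carrier R" "e' \<in> carrier R" "v \<in> carrier R"
      using h Kc(1) E(1) Suc_dim(1) by auto
    have "(k \<ominus> k') \<otimes> v = (k \<otimes> v \<oplus> e) \<ominus> (k' \<otimes> v \<oplus> e) " using c by algebra
    also have "\<dots> = e' \<ominus> e" unfolding h(5) using c by algebra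
    finally have "(k \<ominus> k') \<otimes> v \<in> E" using h E(3,4) unfolding a_minus_def by simp
    moreover have "k \<ominus> k' \<in> K" using h Kc(6,8) unfolding a_minus_def by simp
    ultimately have "k \<ominus> k' = \<zero>" using E(6)[of "k \<ominus> k'" v] Suc_dim(1,2) by blast
    then have "k = k'" using c by (metis r_right_minus_eq)
    moreover have "e = e'" using h(5) c unfolding \<open>k = k'\<close> by simp
    ultimately show "k = k' \<and> e = e'" by simp
  qed
  ultimately show ?case using Suc_dim by (simp add: card_image card_cartesian_product)
qed simp

text \<open>A finite \<open>E\<close> spans itself, hence is finite-dimensional, and its size
  determines the dimension over the finite field \<open>K\<close>. The predicate
  \<open>subalgebra\<close> means a \<open>K\<close>-subspace here.\<close>

lemma (in ring) card_subalgebra: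
  assumes K: "subfield K R" "finite K" and E: "subalgebra K E R" "finite E"
  shows "card E = card K ^ dim K E"
proof -
  obtain Us where Us: "set Us = E" using finite_list[OF E(2)] by blast
  have "E \<subseteq> carrier R" using subalgebra_in_carrier[OF E(1)] .
  then have "finite_dimension K (Span K Us)" using Span_finite_dimension[OF K(1)] Us by simp
  moreover have "Span K Us = E"
    using subalgebra_Span_incl[OF K(1) E(1), of Us] Span_base_incl[OF K(1), of Us] Us \<open>E \<subseteq> carrier R\<close> by auto
  ultimately have "finite_dimension K E" by simp
  then have "dimension ((dim over K) E) K E" by (rule finite_dimensionE[OF K(1)])
  then show ?thesis using card_dimension[OF K] by (auto simp: over_def)
qed

text \<open>The common form of the field, its subfields and the valuation rings: the operations of
  the type class with a varying carrier. It links the development on sets to the definitions on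
  structures.\<close>

definition ring_of :: "'a::field set \<Rightarrow> 'a ring" where
  "ring_of S = ring_of_type_algebra\<lparr>carrier := S\<rparr>"

lemma ring_of_simps [simp]:
  "carrier (ring_of S) = S" "a \<otimes>\<^bsub>ring_of S\<^esub> b = a * b" "a \<oplus>\<^bsub>ring_of S\<^esub> b = a + b"
  "\<one>\<^bsub>ring_of S\<^esub> = 1" "\<zero>\<^bsub>ring_of S\<^esub> = 0" "ring_of S\<lparr>carrier := T\<rparr> = ring_of T"
  by (simp_all add: ring_of_def ring_of_type_algebra_def)

lemma cring_ring_of: "subring_set S \<Longrightarrow> cring (ring_of S)"
proof (intro cringI abelian_groupI comm_monoidI)
  fix x assume "subring_set S" "x \<in> carrier (ring_of S)"
  then show "\<exists>y\<in>carrier (ring_of S). y \<oplus>\<^bsub>ring_of S\<^esub> x = \<zero>\<^bsub>ring_of S\<^esub>"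
    using subring_set_closed(5)[of S x] by (intro bexI[of _ "- x"]) auto
qed (auto intro: subring_set_closed simp: algebra_simps)

lemma field_ring_of: "subfield_set S \<Longrightarrow> field (ring_of S)"
  using subfield_set_closed(1,2)[of S]
  by (intro cring.cring_fieldI2 cring_ring_of) (auto intro!: bexI[of _ "inverse _"])

lemma a_inv_ring_of:
  assumes "subring_set S" "x \<in> S"
  shows "\<ominus>\<^bsub>ring_of S\<^esub> x = - x"
proof -
  interpret cring "ring_of S" using cring_ring_of assms by blast
  show ?thesis
    using minus_equality[of "- x" x] assms subring_set_closed(5)[OF assms] by simp
qed

lemma inv_ring_of:
  assumes "subring_set S" "x \<in> S" "inverse x \<in> S" "x \<noteq> 0"
  shows "inv\<^bsub>ring_of S\<^esub> x = inverse x"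
proof -
  interpret cring "ring_of S" using cring_ring_of assms by blast
  show ?thesis using inv_unique'[of x "inverse x"] assms by simp
qed

lemma pow_ring_of: "x [^]\<^bsub>ring_of S\<^esub> (k::nat) = x ^ k"
  by (induction k) (simp_all add: mult.commute)

lemma int_pow_ring_of:
  assumes "subfield_set S" "x \<in> S" "x \<noteq> 0"
  shows "x [^]\<^bsub>ring_of S\<^esub> (k::int) = x powi k"
proof -
  note S = subfield_set_closed[OF assms(1)]
  have p: "rec_nat \<one>\<^bsub>ring_of S\<^esub> (\<lambda>u b. b \<otimes>\<^bsub>ring_of S\<^esub> x) j = x ^ j" for j
    by (induction j) (simp_all add: mult.commute)
  have "inv\<^bsub>ring_of S\<^esub> (x ^ j) = inverse x ^ j" for j
    using assms subring_set_power[OF S(1) assms(2)] S(2) by (subst inv_ring_of[OF S(1)]) (auto simp: power_inverse)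
  then show ?thesis unfolding int_pow_def Let_def p power_int_def by auto
qed

lemma subring_ring_of_iff:
  assumes "subring_set S"
  shows "subring T (ring_of S) \<longleftrightarrow> subring_set T \<and> T \<subseteq> S"
proof
  interpret cring "ring_of S" using cring_ring_of assms by blast
  {
    assume "subring T (ring_of S)"
    note T = subringE[OF this]
    have "- x \<in> T" if "x \<in> T" for x
      using T(5)[OF that] a_inv_ring_of[OF assms, of x] T(1) that by auto
    then show "subring_set T \<and> T \<subseteq> S" using T by (auto simp: subring_set_def)
  next
    assume T: "subring_set T \<and> T \<subseteq> S"
    then show "subring T (ring_of S)"
      using subring_set_closed[of T] a_inv_ring_of[OF assms] by (intro subringI) auto
  }
qed

lemma subfield_ring_of:
  assumes S: "subring_set S" and T: "subfield_set T" "T \<subseteq> S"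
  shows "subfield T (ring_of S)"
proof -
  interpret cring "ring_of S" using cring_ring_of S by blast
  note T' = subfield_set_closed[OF T(1)]
  have "subring T (ring_of S)" using subring_ring_of_iff[OF S] T T'(1) by blast
  then have "subcring T (ring_of S)" by (intro subcringI) (use T(2) in \<open>auto simp: mult.commute\<close>)
  moreover have "Units (ring_of S\<lparr>carrier := T\<rparr>) = T - {\<zero>\<^bsub>ring_of S\<^esub>}"
  proof -
    have "x \<in> Units (ring_of T)" if "x \<in> T" "x \<noteq> 0" for x
      using that T'(2)[of x] unfolding Units_def by (auto intro!: bexI[of _ "inverse x"])
    moreover have "x \<in> T - {0}" if "x \<in> Units (ring_of T)" for x
      using that unfolding Units_def by auto
    ultimately show ?thesis by auto
  qed
  ultimately show ?thesis by (rule subfieldI)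
qed

lemma additive_subgroup_ring_of:
  assumes S: "subring_set S" and G: "G \<subseteq> S" "0 \<in> G" "\<And>a b. a \<in> G \<Longrightarrow> b \<in> G \<Longrightarrow> a + b \<in> G" "\<And>a. a \<in> G \<Longrightarrow> - a \<in> G"
  shows "subgroup G (add_monoid (ring_of S))"
proof -
  interpret cring "ring_of S" using cring_ring_of S by blast
  show ?thesis
  proof (rule add.subgroupI)
    show "\<ominus>\<^bsub>ring_of S\<^esub> a \<in> G" if "a \<in> G" for a using that G a_inv_ring_of[OF S, of a] by auto
  qed (use G in auto)
qed

context transcendental_ext
begin

abbreviation FF :: "'a ring" where "FF \<equiv> ring_of F"

lemma K_nontrivial: "valr V \<Longrightarrow> K \<noteq> V"
proof
  assume V: "valr V" "K = V"
  have "F \<subseteq> V"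
  proof
    fix z assume "z \<in> F"
    then show "z \<in> V" using valr_inverse[OF V(1)] subfield_set_closed(2)[OF subfield_K, of "inverse z"] V(2) by auto
  qed
  then show False using valr_F[OF V(1)] valr_proper[OF V(1)] by blast
qed

lemma valuation_ring_iff: "valuation_ring FF K V \<longleftrightarrow> valr V"
proof
  assume "valr V"
  note V = this
  have "inv\<^bsub>FF\<^esub> z = inverse z" if "z \<in> F" "z \<noteq> 0" for z
    using that inv_ring_of[OF subring_F] F_closed(9) by blast
  then show "valuation_ring FF K V"
    using K_nontrivial[OF V] valr_inverse[OF V] V unfolding valuation_ring_def valr_def
    by (auto simp: subring_ring_of_iff[OF subring_F])
next
  assume "valuation_ring FF K V"
  then have V: "subring_set V" "V \<subset> F" "K \<subset> V" "\<And>z. z \<in> F \<Longrightarrow> z \<noteq> 0 \<Longrightarrow> z \<in> V \<or> inv\<^bsub>FF\<^esub> z \<in> V"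
    by (auto simp: valuation_ring_def subring_ring_of_iff[OF subring_F])
  have "z \<in> V \<or> inverse z \<in> V" if z: "z \<in> F" for z
  proof (cases "z = 0")
    case False
    then show ?thesis using V(4)[OF z] inv_ring_of[OF subring_F z] F_closed(9)[OF z] by simp
  qed (use subring_set_closed(1)[OF V(1)] in simp)
  then show "valr V" using V by (auto simp: valr_def)
qed

context
  fixes V assumes V: "valr V"
begin

lemma cring_V: "cring (ring_of V)"
  using cring_ring_of valr_subring[OF V] by blast

lemma ideal_mx: "ideal (mx V) (ring_of V)"
proof (rule idealI)
  show "ring (ring_of V)" using cring_V cring_def by blast
  show "subgroup (mx V) (add_monoid (ring_of V))"
    using mx_subset[OF V] zero_in_mx[OF V] mx_add[OF V] mx_neg[OF V]
    by (intro additive_subgroup_ring_of valr_subring[OF V]) auto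
  show "x \<otimes>\<^bsub>ring_of V\<^esub> a \<in> mx V" "a \<otimes>\<^bsub>ring_of V\<^esub> x \<in> mx V" if "a \<in> mx V" "x \<in> carrier (ring_of V)" for a x
    using mx_mult[OF V, of x a] that by (simp_all add: mult.commute)
qed

lemma maximalideal_iff: "maximalideal P (ring_of V) \<longleftrightarrow> P = mx V"
proof -
  have proper: "J \<subseteq> mx V" if J: "ideal J (ring_of V)" "J \<noteq> V" for J
  proof
    fix z assume z: "z \<in> J"
    interpret ideal J "ring_of V" by fact
    have JV: "J \<subseteq> V" using a_subset by simp
    show "z \<in> mx V"
    proof (rule ccontr)
      assume "z \<notin> mx V"
      then have i: "inverse z \<in> V" "z \<noteq> 0" using unit_inverse[OF V] z JV by blast+
      have "V \<subseteq> J"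
      proof
        fix y assume "y \<in> V"
        then have "(y * inverse z) * z \<in> J" using I_l_closed[OF z, of "y * inverse z"] i(1) V_closed(4)[OF V] by simp
        moreover have "(y * inverse z) * z = y" using i(2) by simp
        ultimately show "y \<in> J" by (simp only:)
      qed
      then show False using J(2) JV by blast
    qed
  qed
  have max: "maximalideal (mx V) (ring_of V)"
  proof (rule maximalidealI[OF ideal_mx])
    show "carrier (ring_of V) \<noteq> mx V" using one_notin_mx[OF V] V_closed(2)[OF V] by auto
    show "J = mx V \<or> J = carrier (ring_of V)" if "ideal J (ring_of V)" "mx V \<subseteq> J" for J
      using proper[OF that(1)] that(2) by auto
  qed
  moreover have "P = mx V" if P: "maximalideal P (ring_of V)"
  proof -
    interpret maximalideal P "ring_of V" by fact
    have "P \<subseteq> mx V" using proper[OF is_ideal] I_notcarr by auto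
    then show ?thesis using I_maximal[OF ideal_mx] mx_subset[OF V] one_notin_mx[OF V] V_closed(2)[OF V] by auto
  qed
  ultimately show ?thesis by blast
qed

lemma place_ring_mx: "place_ring FF (mx V) = ring_of V"
proof -
  have "{z \<in> F. z = 0 \<or> inv\<^bsub>FF\<^esub> z \<notin> mx V} = V"
  proof (intro equalityI subsetI)
    fix z assume z: "z \<in> {z \<in> F. z = 0 \<or> inv\<^bsub>FF\<^esub> z \<notin> mx V}"
    show "z \<in> V"
    proof (rule ccontr)
      assume n: "z \<notin> V"
      then have "z \<noteq> 0" using V_closed(1)[OF V] by auto
      then have "inv\<^bsub>FF\<^esub> z = inverse z" using z inv_ring_of[OF subring_F] F_closed(9) by blast
      then show False using z n mx_inverse[OF V] \<open>z \<noteq> 0\<close> by auto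
    qed
  next
    fix z assume z: "z \<in> V"
    then have zF: "z \<in> F" using valr_F[OF V] by blast
    then show "z \<in> {z \<in> F. z = 0 \<or> inv\<^bsub>FF\<^esub> z \<notin> mx V}"
      using z inv_ring_of[OF subring_F zF] F_closed(9)[OF zF] by (auto simp: mx_def)
  qed
  then show ?thesis by (simp add: place_ring_def)
qed

lemma units_V: "Units (ring_of V) = V - mx V"
proof (intro equalityI subsetI)
  fix z assume "z \<in> Units (ring_of V)"
  then obtain y where "z \<in> V" "y \<in> V" "y * z = 1" by (auto simp: Units_def)
  then show "z \<in> V - mx V" using mx_mult[OF V, of y z] one_notin_mx[OF V] by auto
next
  fix z assume "z \<in> V - mx V"
  then show "z \<in> Units (ring_of V)" using unit_inverse[OF V, of z]
    by (auto simp: Units_def intro!: bexI[of _ "inverse z"])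
qed

lemma prime_element_val: "prime_element FF (mx V) t \<Longrightarrow> t \<in> V \<and> t \<noteq> 0 \<and> val V t = 1"
proof -
  assume "prime_element FF (mx V) t"
  then have t: "t \<in> V" "mx V = (\<lambda>x. x * t) ` V"
    by (auto simp: prime_element_def place_ring_mx cgenideal_def)
  have tm: "t \<in> mx V" unfolding t(2) using V_closed(2)[OF V] by (intro image_eqI[of _ _ 1]) auto
  obtain s where s: "s \<in> V" "unif V = s * t" using unif(1)[OF V] unfolding t(2) by blast
  have nz: "s \<noteq> 0" "t \<noteq> 0" using s(2) unif(2)[OF V] by auto
  have F: "s \<in> F" "t \<in> F" using s(1) t(1) valr_F[OF V] by auto
  have "1 = val V s + val V t" using val_mult[OF V F(1) nz(1) F(2) nz(2)] val_unif[OF V] s(2) by simp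
  moreover have "val V s \<ge> 0" "val V t \<ge> 1" using V_iff_val[OF V F(1)] mx_iff_val[OF V F(2)] s(1) tm nz by auto
  ultimately show ?thesis using t(1) nz by auto
qed

lemma prime_element_unif: "prime_element FF (mx V) (unif V)"
proof -
  have "mx V = (\<lambda>x. x * unif V) ` V"
  proof (intro equalityI subsetI)
    fix z assume "z \<in> mx V"
    then show "z \<in> (\<lambda>x. x * unif V) ` V"
      using unif(2,3)[OF V] by (intro image_eqI[of _ _ "z / unif V"]) auto
  qed (use mx_mult[OF V] unif(1)[OF V] in auto)
  also have "\<dots> = PIdl\<^bsub>ring_of V\<^esub> (unif V)" by (auto simp: cgenideal_def)
  finally have "mx V = PIdl\<^bsub>ring_of V\<^esub> (unif V)" .
  moreover have "unif V \<in> carrier (ring_of V)" using unif_V[OF V] by simp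
  ultimately show ?thesis unfolding prime_element_def place_ring_mx by (rule conjI[rotated])
qed

lemma val_powi:
  assumes "a \<in> F" "a \<noteq> 0"
  shows "val V (a powi k) = k * val V a"
  unfolding power_int_def
  using assms val_power[OF V] val_inverse[OF V assms] F_closed(9)[OF assms(1)] by auto

text \<open>\<open>place_val\<close> allows any prime element in the representation; the exponent is
  unique because every prime element has value \<open>1\<close>.\<close>

lemma place_val_mx:
  assumes z: "z \<in> F" "z \<noteq> 0"
  shows "place_val FF (mx V) z = val V z"
  unfolding place_val_def place_ring_mx units_V
proof (rule the_equality)
  let ?t = "unif V"
  have "z = ?t [^]\<^bsub>FF\<^esub> val V z \<otimes>\<^bsub>FF\<^esub> (z / ?t powi val V z)"
    using unif(2)[OF V] int_pow_ring_of[OF subfield_F unif_F[OF V]] by simp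
  then show "\<exists>t u. prime_element FF (mx V) t \<and> u \<in> V - mx V \<and> z = t [^]\<^bsub>FF\<^esub> val V z \<otimes>\<^bsub>FF\<^esub> u"
    using prime_element_unif val_unit[OF V z] by blast
next
  fix k :: int assume "\<exists>t u. prime_element FF (mx V) t \<and> u \<in> V - mx V \<and> z = t [^]\<^bsub>FF\<^esub> k \<otimes>\<^bsub>FF\<^esub> u"
  then obtain t u where tu: "prime_element FF (mx V) t" "u \<in> V - mx V" "z = t [^]\<^bsub>FF\<^esub> k \<otimes>\<^bsub>FF\<^esub> u" by blast
  have t: "t \<in> F" "t \<noteq> 0" "val V t = 1" using prime_element_val[OF tu(1)] valr_F[OF V] by auto
  have u: "u \<in> F" "u \<noteq> 0" "val V u = 0"
    using tu(2) valr_F[OF V] zero_in_mx[OF V] by (auto intro!: valI[OF V])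
  have "z = t powi k * u" using tu(3) int_pow_ring_of[OF subfield_F t(1,2)] by simp
  moreover have "t powi k \<in> F" "t powi k \<noteq> 0"
    using t F_closed(7,9) by (auto simp: power_int_def)
  ultimately show "k = val V z" using val_mult[OF V _ _ u(1,2)] val_powi[OF t(1,2)] t(3) u(3) by simp
qed

text \<open>The residue field has \<open>card (resid V)\<close> elements and the embedded copy of
  \<open>K\<close> has \<open>card K\<close>, nonzero constants being units;
  \<open>card_subalgebra\<close> converts this into the degree.\<close>

lemma card_resid_degree: "card (resid V) = card K ^ place_degree FF K (mx V)"
proof -
  interpret I: maximalideal "mx V" "ring_of V" using maximalideal_iff by simp
  let ?Q = "ring_of V Quot mx V"
  let ?h = "\<lambda>k. mx V +>\<^bsub>ring_of V\<^esub> k"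
  have Q: "field ?Q" using I.quotient_is_field cring_V by blast
  interpret Q: field ?Q by (rule Q)
  interpret h: ring_hom_ring "ring_of V" ?Q ?h using I.rcos_ring_hom_ring .
  have coset: "?h x = {z \<in> V. z - x \<in> mx V}" if "x \<in> V" for x
  proof -
    have "?h x = (\<lambda>y. y + x) ` mx V" unfolding a_r_coset_def' by auto
    also have "\<dots> = {z \<in> V. z - x \<in> mx V}"
    proof (intro equalityI subsetI)
      fix z assume "z \<in> {z \<in> V. z - x \<in> mx V}"
      then show "z \<in> (\<lambda>y. y + x) ` mx V" by (intro image_eqI[of _ _ "z - x"]) auto
    qed (use that mx_subset[OF V] V_closed(3)[OF V] in auto)
    finally show ?thesis .
  qed
  have carr: "carrier ?Q = resid V"
    unfolding FactRing_def A_RCOSETS_def' resid_def[OF V] using coset by auto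
  have sK: "subfield K (ring_of V)"
    using subfield_ring_of[OF valr_subring[OF V] subfield_K valr_K[OF V]] .
  have "subfield (?h ` K) ?Q" by (rule h.img_is_subfield[OF sK Q.one_not_zero])
  moreover have "subalgebra (?h ` K) (carrier ?Q) ?Q"
    using Q.carrier_is_subalgebra h.hom_closed valr_K[OF V] by (intro Q.carrier_is_subalgebra) auto
  ultimately have "card (resid V) = card (?h ` K) ^ Q.dim (?h ` K) (carrier ?Q)"
    using Q.card_subalgebra[of "?h ` K" "carrier ?Q"] finite_K finite_resid[OF V] carr by simp
  moreover have "card (?h ` K) = card K"
  proof (rule card_image, rule inj_onI)
    fix b c assume bc: "b \<in> K" "c \<in> K" "?h b = ?h c"
    then have bV: "b \<in> V" "c \<in> V" using valr_K[OF V] by auto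
    then have "b - c \<in> mx V" using resid_class_eq[OF V bV] bc(3) coset by simp
    then show "b = c" using const_unit[OF V, of "b - c"] bc subring_set_closed(6)[OF subring_K] by auto
  qed
  ultimately show ?thesis by (simp add: place_degree_def place_ring_mx)
qed

lemma place_degree_pos: "place_degree FF K (mx V) > 0"
proof (rule ccontr)
  assume "\<not> ?thesis"
  then have "card (resid V) = 1" using card_resid_degree by simp
  then show False using card_K_le_resid[OF V] card_K_gt_1 by simp
qed

end

lemma places_eq: "places FF K = mx ` {V. valr V}"
  unfolding places_def using maximalideal_iff by (auto simp: valuation_ring_iff)

lemma mx_inj: "valr V \<Longrightarrow> valr W \<Longrightarrow> mx V = mx W \<Longrightarrow> V = W"
  using place_ring_mx by (metis ring_of_simps(1))

lemma riemann_roch_iff: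
  "riemann_roch_space FF K A =
     {z \<in> F. \<forall>V. valr V \<longrightarrow> vge V (- Poly_Mapping.lookup A (mx V)) z}"
proof -
  have "(z = 0 \<or> (\<forall>P\<in>places FF K. - Poly_Mapping.lookup A P \<le> place_val FF P z)) \<longleftrightarrow>
        (\<forall>V. valr V \<longrightarrow> vge V (- Poly_Mapping.lookup A (mx V)) z)" if z: "z \<in> F" for z
    using vge_iff[OF _ z] place_val_mx[OF _ z] unfolding places_eq by (cases "z = 0") auto
  then show ?thesis unfolding riemann_roch_space_def by auto
qed

end

lemma card_le_card_mult_fibre:
  fixes M :: "'a::field set"
  assumes T: "finite T" "f ` S \<subseteq> T" and M: "finite M" "\<And>x y. x \<in> S \<Longrightarrow> y \<in> S \<Longrightarrow> f x = f y \<Longrightarrow> x - y \<in> M"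
  shows "card S \<le> card T * card M"
proof -
  define r where "r = inv_into S f"
  have fin: "finite (f ` S)" using T finite_subset by blast
  have "S \<subseteq> (\<Union>c\<in>f ` S. (\<lambda>m. r c + m) ` M)"
  proof
    fix x assume x: "x \<in> S"
    have "r (f x) \<in> S" "f (r (f x)) = f x" using x by (auto simp: r_def inv_into_into f_inv_into_f)
    then have "x - r (f x) \<in> M" using M(2) x by simp
    then show "x \<in> (\<Union>c\<in>f ` S. (\<lambda>m. r c + m) ` M)"
      using x by (intro UN_I[of "f x"]) (auto intro: image_eqI[of _ _ "x - r (f x)"])
  qed
  then have "card S \<le> card (\<Union>c\<in>f ` S. (\<lambda>m. r c + m) ` M)"
    by (rule card_mono[OF finite_UN_I[OF fin finite_imageI[OF M(1)]]])
  also have "\<dots> \<le> (\<Sum>c\<in>f ` S. card ((\<lambda>m. r c + m) ` M))" using fin by (rule card_UN_le)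
  also have "\<dots> \<le> (\<Sum>c\<in>f ` S. card M)" by (intro sum_mono card_image_le M)
  also have "\<dots> = card (f ` S) * card M" by simp
  also have "\<dots> \<le> card T * card M" using T by (intro mult_right_mono card_mono) auto
  finally show ?thesis .
qed

context transcendental_ext
begin

section \<open>Dimensions of Riemann-Roch spaces and degrees of divisors\<close>

abbreviation pdeg :: "'a set \<Rightarrow> nat" where "pdeg V \<equiv> place_degree FF K (mx V)"

abbreviation RR :: "('a set \<Rightarrow>\<^sub>0 int) \<Rightarrow> 'a set" where "RR \<equiv> riemann_roch_space FF K"

abbreviation ell :: "('a set \<Rightarrow>\<^sub>0 int) \<Rightarrow> nat" where "ell A \<equiv> ring.dim FF K (RR A)"

lemma vge_K_mult: "valr V \<Longrightarrow> c \<in> K \<Longrightarrow> vge V k z \<Longrightarrow> vge V k (c * z)"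
  using vge_mult[of V 0 c k z] valr_K[of V] by (auto simp: vge_def[of V 0 c])

lemma subalgebra_RR: "subalgebra K (RR A) FF"
proof (intro subalgebra.intro subalgebra_axioms.intro)
  show "subgroup (RR A) (add_monoid FF)"
  proof (rule additive_subgroup_ring_of[OF subring_F])
    show "- z \<in> RR A" if "z \<in> RR A" for z
      using that vge_diff[OF _ vge_0] F_closed(5) unfolding riemann_roch_iff
      by (fastforce dest: vge_diff[OF _ vge_0])
  qed (use vge_add vge_0 F_closed(1-6) in \<open>auto simp: riemann_roch_iff\<close>)
  show "c \<otimes>\<^bsub>FF\<^esub> z \<in> RR A" if "c \<in> K" "z \<in> RR A" for c z
    using that vge_K_mult KF F_closed(4) by (auto simp: riemann_roch_iff)
qed

lemma card_RR: "finite (RR A) \<Longrightarrow> card (RR A) = card K ^ ell A"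
proof -
  assume fin: "finite (RR A)"
  interpret FF: field FF by (rule field_ring_of[OF subfield_F])
  show ?thesis
    using FF.card_subalgebra[OF subfield_ring_of[OF subring_F subfield_K KF] finite_K subalgebra_RR fin] .
qed

lemma RR_mono: "(\<And>V. valr V \<Longrightarrow> Poly_Mapping.lookup A (mx V) \<le> Poly_Mapping.lookup B (mx V)) \<Longrightarrow> RR A \<subseteq> RR B"
  unfolding riemann_roch_iff using vge_mono by fastforce

text \<open>Dividing by the power \<open>-(a + 1)\<close> of the uniformizer and reducing maps the
  larger space to the residue field; elements with the same image differ by an element of
  \<open>RR A\<close>. Counting fibres replaces the exact sequence.\<close>

lemma ell_add_place:
  assumes V: "valr V" and fin: "finite (RR (A + Poly_Mapping.single (mx V) 1))"
  shows "ell (A + Poly_Mapping.single (mx V) 1) \<le> ell A + pdeg V"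
proof -
  let ?B = "A + Poly_Mapping.single (mx V) 1"
  define a where "a = Poly_Mapping.lookup A (mx V)"
  define t where "t = unif V powi (- (a + 1))"
  have sub: "RR A \<subseteq> RR ?B" by (intro RR_mono) (simp add: lookup_add lookup_single when_def)
  then have finA: "finite (RR A)" using fin finite_subset by blast
  have B: "z / t \<in> V" if "z \<in> RR ?B" for z
    using that V unfolding riemann_roch_iff vge_def t_def a_def by (auto simp: lookup_add)
  define \<phi> where "\<phi> z = {z' \<in> V. z' - z / t \<in> mx V}" for z
  have "card (RR ?B) \<le> card (resid V) * card (RR A)"
  proof (rule card_le_card_mult_fibre[of _ \<phi>])
    show "\<phi> ` RR ?B \<subseteq> resid V" unfolding \<phi>_def resid_def[OF V] using B by blast
    fix x y assume xy: "x \<in> RR ?B" "y \<in> RR ?B" "\<phi> x = \<phi> y"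
    have "x / t - y / t \<in> mx V" using resid_class_eq[OF V B B] xy unfolding \<phi>_def by blast
    then have "(x - y) / t / unif V \<in> V" using mx_iff_unif[OF V] by (simp add: diff_divide_distrib)
    moreover have "t * unif V = unif V powi (- a)"
      unfolding t_def using unif(2)[OF V] power_int_add_1[of "unif V" "- (a + 1)"] by simp
    ultimately have v: "vge V (- a) (x - y)" unfolding vge_def by (simp add: divide_divide_eq_left)
    have "vge W (- Poly_Mapping.lookup A (mx W)) (x - y)" if W: "valr W" for W
    proof (cases "W = V")
      case False
      then have "Poly_Mapping.lookup ?B (mx W) = Poly_Mapping.lookup A (mx W)"
        using mx_inj[OF W V] by (auto simp: lookup_add lookup_single when_def)
      then show ?thesis using xy(1,2) W vge_diff[OF W] unfolding riemann_roch_iff by fastforce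
    qed (use v in \<open>simp add: a_def\<close>)
    then show "x - y \<in> RR A"
      using xy(1,2) F_closed(6) by (auto simp: riemann_roch_iff)
  qed (use finite_resid[OF V] finA in auto)
  then have "card K ^ ell ?B \<le> card K ^ (pdeg V + ell A)"
    using card_RR[OF fin] card_RR[OF finA] card_resid_degree[OF V] by (simp add: power_add)
  then show ?thesis using card_K_gt_1 by simp
qed

lemma divisor_degree_superset:
  assumes "finite S" "Poly_Mapping.keys A \<subseteq> S"
  shows "divisor_degree FF K A = (\<Sum>P\<in>S. Poly_Mapping.lookup A P * int (place_degree FF K P))"
  unfolding divisor_degree_def using assms by (intro sum.mono_neutral_left) (auto simp: in_keys_iff)

lemma divisor_degree_add: "divisor_degree FF K (A + B) = divisor_degree FF K A + divisor_degree FF K B"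
proof -
  let ?S = "Poly_Mapping.keys A \<union> Poly_Mapping.keys B"
  have "Poly_Mapping.keys (A + B) \<subseteq> ?S" by (rule Poly_Mapping.keys_add)
  then show ?thesis
    using divisor_degree_superset[of ?S] by (simp add: lookup_add sum.distrib algebra_simps)
qed

lemma divisor_degree_single: "divisor_degree FF K (Poly_Mapping.single P k) = k * int (place_degree FF K P)"
  using divisor_degree_superset[of "{P}" "Poly_Mapping.single P k"] by simp

lemma divisor_degree_0: "divisor_degree FF K 0 = 0"
  by (simp add: divisor_degree_def)

text \<open>One place is added at a time. Finiteness of the largest space is assumed since
  \<open>ell\<close> is evaluated through \<open>card_RR\<close>; it passes to the smaller
  ones.\<close>

lemma ell_add_effective:
  assumes "Poly_Mapping.keys C \<subseteq> places FF K" "\<And>P. Poly_Mapping.lookup C P \<ge> 0" "finite (RR (A + C))"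
  shows "int (ell (A + C)) \<le> int (ell A) + divisor_degree FF K C"
  using assms
proof (induction "nat (\<Sum>P\<in>Poly_Mapping.keys C. Poly_Mapping.lookup C P)" arbitrary: C)
  case 0
  have "C = 0"
  proof (rule ccontr)
    assume "C \<noteq> 0"
    then obtain P where P: "P \<in> Poly_Mapping.keys C" by (metis all_not_in_conv keys_eq_empty)
    then have "Poly_Mapping.lookup C P > 0" using "0.prems"(2)[of P] by (simp add: in_keys_iff order_less_le)
    moreover have "Poly_Mapping.lookup C P \<le> (\<Sum>P\<in>Poly_Mapping.keys C. Poly_Mapping.lookup C P)"
      using P "0.prems"(2) by (intro member_le_sum) auto
    ultimately show False using "0.hyps" by simp
  qed
  then show ?case by (simp add: divisor_degree_0)
next
  case (Suc N)
  have "Poly_Mapping.keys C \<noteq> {}" using Suc.hyps(2) by auto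
  then obtain P where P: "P \<in> Poly_Mapping.keys C" by blast
  then obtain V where V: "valr V" "P = mx V" using Suc.prems(1) by (auto simp: places_eq)
  have pos: "Poly_Mapping.lookup C P \<ge> 1" using P Suc.prems(2)[of P] by (simp add: in_keys_iff)
  define C' where "C' = C - Poly_Mapping.single P 1"
  have C: "C = C' + Poly_Mapping.single P 1" by (simp add: C'_def)
  have lk: "Poly_Mapping.lookup C' Q = Poly_Mapping.lookup C Q - (if Q = P then 1 else 0)" for Q
    by (simp add: C'_def lookup_minus lookup_single when_def)
  have sub: "Poly_Mapping.keys C' \<subseteq> Poly_Mapping.keys C" using P by (auto simp: in_keys_iff lk split: if_splits)
  have nn: "Poly_Mapping.lookup C' Q \<ge> 0" for Q using Suc.prems(2)[of Q] pos by (simp add: lk)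
  have "(\<Sum>Q\<in>Poly_Mapping.keys C'. Poly_Mapping.lookup C' Q) = (\<Sum>Q\<in>Poly_Mapping.keys C. Poly_Mapping.lookup C' Q)"
    using sub by (intro sum.mono_neutral_left) (auto simp: in_keys_iff)
  also have "\<dots> = (\<Sum>Q\<in>Poly_Mapping.keys C. Poly_Mapping.lookup C Q) - 1"
    using P by (simp add: lk sum_subtractf)
  finally have N: "N = nat (\<Sum>Q\<in>Poly_Mapping.keys C'. Poly_Mapping.lookup C' Q)"
    using Suc.hyps(2) by simp
  have e: "A + C = (A + C') + Poly_Mapping.single (mx V) 1" using C V(2) by (simp add: add.assoc)
  have "RR (A + C') \<subseteq> RR (A + C)" unfolding e by (intro RR_mono) (simp add: lookup_add lookup_single when_def)
  then have fin: "finite (RR (A + C'))" using Suc.prems(3) finite_subset by blast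
  have "int (ell (A + C')) \<le> int (ell A) + divisor_degree FF K C'"
    using Suc.hyps(1)[OF N _ nn fin] sub Suc.prems(1) by blast
  moreover have "ell (A + C) \<le> ell (A + C') + pdeg V"
    using ell_add_place[OF V(1), of "A + C'"] Suc.prems(3) unfolding e by blast
  moreover have "divisor_degree FF K C = divisor_degree FF K C' + int (pdeg V)"
    using C V(2) by (simp add: divisor_degree_add divisor_degree_single)
  ultimately show ?case by linarith
qed

lemma vge_shift:
  assumes V: "valr V" and a: "a \<in> F" "a \<noteq> 0"
  shows "vge V (k + val V a) (a * z) \<longleftrightarrow> vge V k z"
proof
  assume "vge V k z"
  moreover have "vge V (val V a) a" using vge_iff[OF V a(1)] by simp
  ultimately show "vge V (k + val V a) (a * z)" using vge_mult[OF V] by (metis add.commute)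
next
  assume h: "vge V (k + val V a) (a * z)"
  have iF: "inverse a \<in> F" using F_closed(9)[OF a(1)] .
  have "vge V (- val V a) (inverse a)" using vge_iff[OF V iF] val_inverse[OF V a] by simp
  then have "vge V (- val V a + (k + val V a)) (inverse a * (a * z))" using h by (rule vge_mult[OF V])
  then show "vge V k z" using a(2) by (simp add: mult.assoc[symmetric])
qed

text \<open>A polynomial that clears the denominator of \<open>1 / unif V\<close> is divisible by
  \<open>unif V\<close> in \<open>V\<close>.\<close>

lemma polynomial_in_place:
  assumes V: "valr V" "u \<in> V"
  shows "\<exists>g\<in>polys K. g \<noteq> 0 \<and> poly g u \<in> mx V"
proof -
  have "inverse (unif V) \<in> F" using F_closed(9)[OF unif_F[OF V(1)]] .
  then obtain g where g: "g \<in> polys K" "g \<noteq> 0" "poly g u * inverse (unif V) \<in> R" using F_denominator by blast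
  then have "(poly g u * inverse (unif V)) * unif V \<in> mx V"
    using mx_mult[OF V(1)] R_subset_V[OF V] unif(1)[OF V(1)] by blast
  moreover have "(poly g u * inverse (unif V)) * unif V = poly g u" using unif(2)[OF V(1)] by simp
  ultimately have "poly g u \<in> mx V" by (simp only:)
  then show ?thesis using g by blast
qed

lemma polynomial_with_zeros:
  assumes T: "finite T" "\<And>V. V \<in> T \<Longrightarrow> valr V \<and> u \<in> V"
  shows "\<exists>g\<in>polys K. g \<noteq> 0 \<and> (\<forall>V\<in>T. int (k V) \<le> val V (poly g u))"
proof -
  obtain g where g: "\<And>V. V \<in> T \<Longrightarrow> g V \<in> polys K \<and> g V \<noteq> 0 \<and> poly (g V) u \<in> mx V"
    using polynomial_in_place T(2) by metis
  define h where "h = (\<Prod>V\<in>T. g V ^ k V)"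
  have hK: "h \<in> polys K" unfolding h_def using g by (intro polys_prod[OF subring_K] K_polys(10)) auto
  have h0: "h \<noteq> 0" unfolding h_def using g T(1) by auto
  have "int (k V) \<le> val V (poly h u)" if V: "V \<in> T" for V
  proof -
    have vV: "valr V" "u \<in> V" using T(2) V by auto
    define s where "s = (\<Prod>W\<in>T - {V}. g W ^ k W)"
    have hs: "h = g V ^ k V * s" unfolding h_def s_def using T(1) V by (simp add: prod.remove)
    have sK: "s \<in> polys K" unfolding s_def using g by (intro polys_prod[OF subring_K] K_polys(10)) auto
    have nz: "g V ^ k V \<noteq> 0" "s \<noteq> 0" using hs h0 by auto
    have gK: "g V \<in> polys K" "g V \<noteq> 0" using g V by auto
    have gu: "poly (g V) u \<in> F" "poly (g V) u \<noteq> 0" using gK poly_F poly_u_nz by auto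
    have su: "poly s u \<in> F" "poly s u \<noteq> 0" using sK nz poly_F poly_u_nz by auto
    have "val V (poly h u) = val V (poly (g V) u ^ k V) + val V (poly s u)"
      unfolding hs using gu su F_closed(7)[OF gu(1)] by (simp add: val_mult[OF vV(1)])
    also have "val V (poly (g V) u ^ k V) = int (k V) * val V (poly (g V) u)" using val_power[OF vV(1) gu] .
    finally have "val V (poly h u) = int (k V) * val V (poly (g V) u) + val V (poly s u)" .
    moreover have "val V (poly (g V) u) \<ge> 1" using g[OF V] mx_iff_val[OF vV(1) gu(1)] gu(2) by auto
    moreover have "val V (poly s u) \<ge> 0"
      using R_subset_V[OF vV] R_poly[OF sK] V_iff_val[OF vV(1) su(1)] su(2) by auto
    moreover have "int (k V) * 1 \<le> int (k V) * val V (poly (g V) u)"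
      using calculation(2) by (intro mult_left_mono) auto
    ultimately show ?thesis by simp
  qed
  then show ?thesis using hK h0 by blast
qed

text \<open>\<open>sum_of_degrees_le\<close> with denominator \<open>1\<close>. It is applied to
  finite sets of zeros first: every zero contributes at least \<open>1\<close>, so the bound itself
  shows that \<open>Z\<close> is finite.\<close>

lemma zeros_of_polynomial:
  assumes g: "g \<in> polys K" "g \<noteq> 0"
  defines "Z \<equiv> {V. valr V \<and> u \<in> V \<and> poly g u \<in> mx V}"
  shows "finite Z" "(\<Sum>V\<in>Z. val V (poly g u) * int (pdeg V)) \<le> int (n * Polynomial.degree g)"
proof -
  define \<delta> where "\<delta> = Polynomial.degree g"
  have gu: "poly g u \<in> F" "poly g u \<noteq> 0" using g poly_F poly_u_nz by auto
  have ge1: "val V (poly g u) \<ge> 1" if "V \<in> Z" for V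
    using that mx_iff_val[OF _ gu(1)] gu(2) by (auto simp: Z_def)
  have le: "(\<Sum>V\<in>S. nat (val V (poly g u)) * pdeg V) \<le> n * \<delta>" if S: "finite S" "S \<subseteq> Z" for S
  proof -
    have "(\<Prod>V\<in>S. card (resid V) ^ nat (val V (poly g u))) \<le> card K ^ (n * \<delta>)"
    proof (rule sum_of_degrees_le[OF S(1) _ _ gu(2)])
      show "poly g u = poly g u / poly 1 u" by simp
      show "g \<in> polys_lt K (Suc \<delta>)" "1 \<in> polys_lt K (Suc \<delta>)"
        using g by (auto simp: \<delta>_def intro: polys_in_lt polys_lt_one[OF subring_K])
    qed (use S(2) mx_subset in \<open>auto simp: Z_def\<close>)
    also have "(\<Prod>V\<in>S. card (resid V) ^ nat (val V (poly g u))) = (\<Prod>V\<in>S. card K ^ (nat (val V (poly g u)) * pdeg V))"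
      using S(2) by (intro prod.cong refl) (auto simp: Z_def card_resid_degree mult.commute simp flip: power_mult)
    finally have "card K ^ (\<Sum>V\<in>S. nat (val V (poly g u)) * pdeg V) \<le> card K ^ (n * \<delta>)"
      by (simp add: power_sum)
    then show ?thesis using card_K_gt_1 by simp
  qed
  have card: "card S \<le> n * \<delta>" if S: "finite S" "S \<subseteq> Z" for S
  proof -
    have "1 \<le> nat (val V (poly g u)) * pdeg V" if "V \<in> S" for V
    proof -
      have "V \<in> Z" using that S by blast
      then have "nat (val V (poly g u)) > 0" "pdeg V > 0"
        using ge1[of V] place_degree_pos[of V] by (auto simp: Z_def)
      then show ?thesis by (metis One_nat_def Suc_leI nat_0_less_mult_iff)
    qed
    then have "(\<Sum>V\<in>S. 1) \<le> (\<Sum>V\<in>S. nat (val V (poly g u)) * pdeg V)" by (rule sum_mono)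
    then show ?thesis using le[OF S] by simp
  qed
  show fin: "finite Z"
  proof (rule ccontr)
    assume "infinite Z"
    then obtain S where "S \<subseteq> Z" "finite S" "card S = Suc (n * \<delta>)" using infinite_arbitrarily_large by blast
    then show False using card[of S] by simp
  qed
  have "(\<Sum>V\<in>Z. val V (poly g u) * int (pdeg V)) = (\<Sum>V\<in>Z. int (nat (val V (poly g u)) * pdeg V))"
    using ge1 by (intro sum.cong refl) fastforce
  also have "\<dots> = int (\<Sum>V\<in>Z. nat (val V (poly g u)) * pdeg V)" by (rule of_nat_sum[symmetric])
  also have "\<dots> \<le> int (n * \<delta>)" using le[OF fin order_refl] by (rule of_nat_mono)
  finally show "(\<Sum>V\<in>Z. val V (poly g u) * int (pdeg V)) \<le> int (n * Polynomial.degree g)" by (simp add: \<delta>_def)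
qed

end

section \<open>The genus of a superelliptic function field\<close>

context superelliptic
begin

lemma pdeg_Vinf: "pdeg Vinf = 1"
  using card_resid_degree[OF Vinf(1)] Vinf_vals(3) card_K_gt_1
  by (metis power_inject_exp power_one_right)

lemma RR_Vinf: "RR (Poly_Mapping.single (mx Vinf) (int k)) = Lk k"
proof -
  have "vge V (- Poly_Mapping.lookup (Poly_Mapping.single (mx Vinf) (int k)) (mx V)) z \<longleftrightarrow>
      (if V = Vinf then vge Vinf (- int k) z else z \<in> V)" if "valr V" for V z
    using mx_inj[OF that Vinf(1)] by (auto simp: lookup_single when_def vge_def)
  moreover have "V = Vinf \<longleftrightarrow> u \<notin> V" if "valr V" for V using that Vinf Vinf_unique by blast
  ultimately show ?thesis unfolding riemann_roch_iff Lk_def using Vinf by auto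
qed

lemma dim_Lk:
  assumes "k \<ge> d * n"
  shows "2 * int (ell (Poly_Mapping.single (mx Vinf) (int k))) = 2 * (int k + 1) - (int n - 1) * (int d - 1)"
proof -
  have "card K ^ ell (Poly_Mapping.single (mx Vinf) (int k)) = card K ^ (\<Sum>j<n. monomials k j)"
    using card_RR[of "Poly_Mapping.single (mx Vinf) (int k)"] card_Lk[of k] by (simp add: RR_Vinf)
  then have "ell (Poly_Mapping.single (mx Vinf) (int k)) = (\<Sum>j<n. monomials k j)"
    using card_K_gt_1 by (simp add: power_inject_exp)
  then show ?thesis using sum_monomials[OF assms] by simp
qed

text \<open>Going from \<open>A\<close> up to \<open>B\<close> raises \<open>ell\<close> by at most
  the degree of \<open>B - A\<close>. So the difference of degree and dimension for \<open>A\<close>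
  is at most that for \<open>B\<close>, where both terms are controlled.\<close>

lemma riemann_inequality:
  assumes A: "Poly_Mapping.keys A \<subseteq> places FF K"
  shows "2 * (divisor_degree FF K A - int (ell A) + 1) \<le> (int n - 1) * (int d - 1)"
proof -
  define T where "T = {V. valr V \<and> u \<in> V \<and> mx V \<in> Poly_Mapping.keys A}"
  have finT: "finite T"
  proof (rule inj_on_finite[of mx])
    show "inj_on mx T" using mx_inj by (auto simp: inj_on_def T_def)
  qed (auto simp: T_def)
  obtain g where g: "g \<in> polys K" "g \<noteq> 0"
    "\<And>V. V \<in> T \<Longrightarrow> int (nat \<bar>Poly_Mapping.lookup A (mx V)\<bar>) \<le> val V (poly g u)"
    using polynomial_with_zeros[OF finT, of "\<lambda>V. nat \<bar>Poly_Mapping.lookup A (mx V)\<bar>"] by (auto simp: T_def)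
  define Z where "Z = {V. valr V \<and> u \<in> V \<and> poly g u \<in> mx V}"
  note Z = zeros_of_polynomial[OF g(1,2), folded Z_def]
  \<comment> \<open>At infinity \<open>B\<close> must dominate \<open>A\<close>; the extra
    \<open>d * n\<close> puts \<open>k\<close> into the range where \<open>dim_Lk\<close> is exact.
    Multiplication by \<open>g(u)\<close> shifts the pole order \<open>j\<close> to
    \<open>k\<close>.\<close>
  define j where "j = nat \<bar>Poly_Mapping.lookup A (mx Vinf)\<bar> + d * n"
  define k where "k = n * Polynomial.degree g + j"
  have gu: "poly g u \<in> F" "poly g u \<noteq> 0" using g poly_F poly_u_nz by auto
  define B where "B = (\<Sum>V\<in>Z. Poly_Mapping.single (mx V) (val V (poly g u))) + Poly_Mapping.single (mx Vinf) (int j)"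
  have B_fin: "Poly_Mapping.lookup B (mx V) = val V (poly g u)" if V: "valr V" "u \<in> V" for V
  proof -
    have ne: "mx V \<noteq> mx Vinf" using mx_inj[OF V(1) Vinf(1)] V(2) Vinf(2) by blast
    have "Poly_Mapping.lookup B (mx V) = (\<Sum>W\<in>Z. if W = V then val W (poly g u) else 0)"
      unfolding B_def lookup_add lookup_sum using ne mx_inj[OF _ V(1)]
      by (auto simp: lookup_single when_def Z_def intro!: sum.cong)
    also have "\<dots> = (if V \<in> Z then val V (poly g u) else 0)" using Z(1) by simp
    also have "\<dots> = val V (poly g u)"
    proof (cases "V \<in> Z")
      case False
      then have "poly g u \<in> V" "poly g u \<notin> mx V" using V R_subset_V[OF V] R_poly[OF g(1)] by (auto simp: Z_def)
      then have "val V (poly g u) = 0" by (intro valI[OF V(1)]) simp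
      then show ?thesis using False by simp
    qed simp
    finally show ?thesis .
  qed
  have B_inf: "Poly_Mapping.lookup B (mx Vinf) = int j"
  proof -
    have "Poly_Mapping.lookup (Poly_Mapping.single (mx W) (val W (poly g u))) (mx Vinf) = 0" if "W \<in> Z" for W
      using that mx_inj[OF _ Vinf(1)] Vinf(2) by (auto simp: lookup_single when_def Z_def)
    then show ?thesis unfolding B_def lookup_add lookup_sum by (simp add: lookup_single when_def)
  qed
  have val_inf: "val Vinf (poly g u) = - int (n * Polynomial.degree g)"
    using val_poly_at_infinity[OF Vinf g(1,2)] Vinf_vals(1) by simp
  have RB: "RR B = (\<lambda>z. z / poly g u) ` Lk k"
  proof -
    have iff: "z \<in> RR B \<longleftrightarrow> poly g u * z \<in> Lk k" if z: "z \<in> F" for z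
    proof -
      have c: "vge V (- Poly_Mapping.lookup B (mx V)) z \<longleftrightarrow> (if V = Vinf then vge Vinf (- int k) (poly g u * z) else poly g u * z \<in> V)"
        if V: "valr V" for V
      proof (cases "V = Vinf")
        case True
        have "- int j + val Vinf (poly g u) = - int k" using val_inf by (simp add: k_def)
        then show ?thesis using True vge_shift[OF Vinf(1) gu, of "- int j" z] B_inf by simp
      next
        case False
        then have "u \<in> V" using V Vinf_unique by blast
        then show ?thesis using False vge_shift[OF V gu, of "- val V (poly g u)" z] B_fin[OF V] by (simp add: vge_def[of V 0])
      qed
      have "poly g u * z \<in> F" using F_closed(4)[OF gu(1) z] .
      moreover have "V = Vinf \<longleftrightarrow> u \<notin> V" if "valr V" for V using that Vinf Vinf_unique by blast
      ultimately show ?thesis unfolding riemann_roch_iff Lk_def using z c Vinf(1) by auto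
    qed
    show ?thesis
    proof (intro equalityI subsetI)
      fix z assume z: "z \<in> RR B"
      then have "z \<in> F" by (auto simp: riemann_roch_iff)
      then show "z \<in> (\<lambda>z. z / poly g u) ` Lk k" using iff z gu(2) by (intro image_eqI[of _ _ "poly g u * z"]) auto
    next
      fix z assume "z \<in> (\<lambda>z. z / poly g u) ` Lk k"
      then obtain y where y: "y \<in> Lk k" "z = y / poly g u" by blast
      have "y \<in> F" using y(1) by (auto simp: Lk_def)
      then have "z \<in> F" using y(2) gu F_closed(10) by blast
      moreover have "poly g u * z = y" using y(2) gu(2) by simp
      ultimately show "z \<in> RR B" using iff y(1) by simp
    qed
  qed
  have finB: "finite (RR B)" unfolding RB using card_Lk(1) by simp
  have "inj_on (\<lambda>z. z / poly g u) (Lk k)" using gu(2) by (auto simp: inj_on_def)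
  then have "card (RR B) = card (RR (Poly_Mapping.single (mx Vinf) (int k)))" unfolding RB RR_Vinf by (rule card_image)
  then have "card K ^ ell B = card K ^ ell (Poly_Mapping.single (mx Vinf) (int k))"
    using card_RR[OF finB] card_RR[of "Poly_Mapping.single (mx Vinf) (int k)"] card_Lk(1)[of k] by (simp add: RR_Vinf)
  then have ellB: "ell B = ell (Poly_Mapping.single (mx Vinf) (int k))"
    using card_K_gt_1 by (simp add: power_inject_exp)
  have "k \<ge> d * n" by (simp add: k_def j_def)
  then have dimB: "2 * int (ell B) = 2 * (int k + 1) - (int n - 1) * (int d - 1)" unfolding ellB by (rule dim_Lk)
  have degsum: "divisor_degree FF K (\<Sum>V\<in>Y. Poly_Mapping.single (mx V) (val V (poly g u))) = (\<Sum>V\<in>Y. val V (poly g u) * int (pdeg V))"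
    if "finite Y" for Y
    using that by (induction Y rule: finite_induct) (simp_all add: divisor_degree_add divisor_degree_single divisor_degree_0)
  have "divisor_degree FF K B = (\<Sum>V\<in>Z. val V (poly g u) * int (pdeg V)) + int j"
    unfolding B_def divisor_degree_add degsum[OF Z(1)] divisor_degree_single using pdeg_Vinf by simp
  \<comment> \<open>Only an upper bound for the zero divisor is known, and it suffices because the
    degree of \<open>B\<close> enters with a positive sign.\<close>
  then have degB: "divisor_degree FF K B \<le> int k" using Z(2) by (simp add: k_def)
  define C where "C = B - A"
  have BC: "B = A + C" by (simp add: C_def)
  have "Poly_Mapping.keys B \<subseteq> places FF K"
  proof
    fix P assume P: "P \<in> Poly_Mapping.keys B"
    show "P \<in> places FF K"
    proof (rule ccontr)
      assume n: "P \<notin> places FF K"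
      then have ne: "mx V \<noteq> P" if "valr V" for V using that by (auto simp: places_eq)
      have "(\<Sum>V\<in>Z. Poly_Mapping.lookup (Poly_Mapping.single (mx V) (val V (poly g u))) P) = 0"
        using ne by (intro sum.neutral) (simp add: Z_def lookup_single when_def)
      then have "Poly_Mapping.lookup B P = 0"
        unfolding B_def lookup_add lookup_sum using ne[OF Vinf(1)] by (simp add: lookup_single when_def)
      then show False using P by (simp add: in_keys_iff)
    qed
  qed
  then have "Poly_Mapping.keys C \<subseteq> places FF K"
    unfolding C_def using A Poly_Mapping.keys_diff[of B A] by blast
  moreover have "Poly_Mapping.lookup C P \<ge> 0" for P
  proof (cases "P \<in> places FF K")
    case True
    then obtain V where V: "valr V" "P = mx V" by (auto simp: places_eq)
    show ?thesis
    proof (cases "u \<in> V")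
      case uV: True
      have "Poly_Mapping.lookup A P \<le> val V (poly g u)"
      proof (cases "P \<in> Poly_Mapping.keys A")
        case True
        then show ?thesis using g(3)[of V] V uV by (auto simp: T_def)
      next
        case False
        then have "Poly_Mapping.lookup A P = 0" by (simp add: in_keys_iff)
        moreover have "val V (poly g u) \<ge> 0"
          using R_subset_V[OF V(1) uV] R_poly[OF g(1)] V_iff_val[OF V(1) gu(1)] gu(2) by auto
        ultimately show ?thesis by simp
      qed
      then show ?thesis using B_fin[OF V(1) uV] V(2) by (simp add: C_def lookup_minus)
    next
      case False
      then have "V = Vinf" using Vinf_unique V(1) by blast
      moreover have "Poly_Mapping.lookup A (mx Vinf) \<le> int j"
        unfolding j_def of_nat_add by (rule order_trans[OF abs_ge_self]) simp
      ultimately show ?thesis using B_inf V(2) by (simp add: C_def lookup_minus)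
    qed
  next
    case False
    then have "P \<notin> Poly_Mapping.keys C" using \<open>Poly_Mapping.keys C \<subseteq> places FF K\<close> by blast
    then show ?thesis by (simp add: in_keys_iff)
  qed
  ultimately have "int (ell (A + C)) \<le> int (ell A) + divisor_degree FF K C"
    using finB unfolding BC by (intro ell_add_effective) auto
  moreover have "divisor_degree FF K B = divisor_degree FF K A + divisor_degree FF K C"
    using divisor_degree_add[of A C] BC by simp
  ultimately have "divisor_degree FF K A - int (ell A) \<le> int k - int (ell B)"
    using degB BC by simp
  then have "2 * (divisor_degree FF K A - int (ell A) + 1) \<le> 2 * (int k - int (ell B) + 1)" by simp
  also have "\<dots> = (int n - 1) * (int d - 1)" using dimB by (simp add: right_diff_distrib distrib_left)
  finally show ?thesis .
qed

text \<open>By \<open>riemann_inequality\<close> no divisor exceeds this value; the multiple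
  \<open>d * n\<close> of the place at infinity attains it.\<close>

theorem genus_superelliptic: "2 * genus FF K = (int n - 1) * (int d - 1)"
proof -
  define k where "k = d * n"
  define A where "A = Poly_Mapping.single (mx Vinf) (int k)"
  have A: "A \<in> divisors FF K" unfolding A_def using Vinf(1) by (auto simp: places_eq)
  have deg: "divisor_degree FF K A = int k" unfolding A_def using divisor_degree_single pdeg_Vinf by simp
  have dimA: "2 * int (ell A) = 2 * (int k + 1) - (int n - 1) * (int d - 1)"
    unfolding A_def by (rule dim_Lk) (simp add: k_def)
  define g where "g = divisor_degree FF K A - int (ell A) + 1"
  have g2: "2 * g = (int n - 1) * (int d - 1)"
    using dimA unfolding g_def deg by (simp add: distrib_left right_diff_distrib)
  have "genus FF K = g"
    unfolding genus_def
  proof (rule Greatest_equality)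
    show "\<exists>A\<in>divisors FF K. g = divisor_degree FF K A - int (ell A) + 1" using A by (auto simp: g_def)
    fix h assume "\<exists>A\<in>divisors FF K. h = divisor_degree FF K A - int (ell A) + 1"
    then obtain D where "Poly_Mapping.keys D \<subseteq> places FF K" "h = divisor_degree FF K D - int (ell D) + 1" by auto
    then have "2 * h \<le> 2 * g" using riemann_inequality unfolding g2 by blast
    then show "h \<le> g" by simp
  qed
  then show ?thesis using g2 by simp
qed

end

section \<open>Finite rings and algebraic generators\<close>

lemma finite_subring_subfield:
  assumes V: "subring_set V" "finite V"
  shows "subfield_set V"
  unfolding subfield_set_def
proof (intro conjI ballI V(1))
  fix z assume z: "z \<in> V"
  show "inverse z \<in> V"
  proof (cases "z = 0")
    case False
    have "range (\<lambda>i. z ^ i) \<subseteq> V" using subring_set_power[OF V(1) z] by blast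
    then have "\<not> inj (\<lambda>i::nat. z ^ i)" using V(2) finite_subset range_inj_infinite by blast
    then obtain i j where "z ^ i = z ^ j" "i \<noteq> j" unfolding inj_on_def by blast
    then obtain i j :: nat where ij: "i < j" "z ^ i = z ^ j" by (metis linorder_neqE_nat)
    have "z ^ j = z ^ i * z ^ (j - i)" using ij(1) by (simp flip: power_add)
    then have "z ^ i * 1 = z ^ i * z ^ (j - i)" using ij(2) by simp
    then have "z ^ (j - i) = 1" using False by simp
    moreover obtain k where "j - i = Suc k" using ij(1) by (metis Suc_diff_Suc)
    ultimately have "inverse z = z ^ k" by (metis inverse_unique power_Suc)
    then show ?thesis using subring_set_power[OF V(1) z] by simp
  qed (use z in simp)
qed

text \<open>Meant for a contradiction: reduction modulo \<open>g\<close> bounds the degrees of all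
  coordinates, so an algebraic \<open>u\<close> leaves only finitely many elements in
  \<open>R\<close>.\<close>

lemma (in integral_ext) finite_R_of_algebraic:
  assumes g: "g \<in> polys K" "g \<noteq> 0" "poly g u = 0"
  shows "finite R"
proof -
  have "R \<subseteq> Rlt (Polynomial.degree g)"
  proof
    fix z assume "z \<in> R"
    then obtain h where h: "z = coord h" "\<And>j. h j \<in> polys K" by (auto simp: R_def)
    have "\<exists>r\<in>polys_lt K (Polynomial.degree g). poly (h j) u = poly r u" for j
      using polys_div_mod_ex[OF subfield_K g(1,2) h(2)[of j]] g(3) by force
    then obtain r where r: "\<And>j. r j \<in> polys_lt K (Polynomial.degree g)" "\<And>j. poly (h j) u = poly (r j) u" by metis
    have "z = coord r" unfolding h(1) coord_def by (simp add: r(2))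
    then show "z \<in> Rlt (Polynomial.degree g)" unfolding Rlt_def using r(1) by blast
  qed
  then show ?thesis using finite_Rlt finite_subset by blast
qed

section \<open>The Hermitian function field in coordinates adapted to \<open>\<sigma>\<close>\<close>

text \<open>The carrier of \<open>H\<close> is the whole type. Transcendence of \<open>x\<close>
  over the finite field \<open>K\<close> enters through the distinctness of its powers, and
  \<open>generated\<close> expresses \<open>H = K(x, y)\<close> by minimality among
  subfields.\<close>

locale hermitian = finite_subfield K for K :: "'a::field set" +
  fixes p r q :: nat and x y a :: 'a
  assumes prime_p: "Factorial_Ring.prime p" and odd_p: "odd p" and r_pos: "r > 0" and q_def: "q = p ^ r"
    and CHAR_p: "CHAR('a) = p"
    and inj_x: "inj (\<lambda>i::nat. x ^ i)" and curve: "y ^ q + y = x ^ (q + 1)"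
    and generated: "\<And>S. subfield_set S \<Longrightarrow> K \<subseteq> S \<Longrightarrow> x \<in> S \<Longrightarrow> y \<in> S \<Longrightarrow> S = UNIV"
    and a_K: "a \<in> K" and a_pow: "a ^ (q\<^sup>2 - 1) = 1"
    and a_prim: "\<And>k. 0 < k \<Longrightarrow> k < q\<^sup>2 - 1 \<Longrightarrow> a ^ k \<noteq> 1" and card_K: "card K = q\<^sup>2"
begin

lemmas K_sub = subring_set_closed[OF subring_K] subring_set_power[OF subring_K]
  subfield_set_closed(2,3)[OF subfield_K]

lemma q_ge_3: "q \<ge> 3"
proof -
  have "p \<ge> 2" using prime_p by (rule prime_ge_2_nat)
  then have "p \<ge> 3" using odd_p by (cases "p = 2") auto
  moreover have "p ^ 1 \<le> p ^ r" using r_pos \<open>p \<ge> 2\<close> by (intro power_increasing) auto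
  ultimately show ?thesis by (simp add: q_def)
qed

lemma odd_q: "odd q"
  using odd_p by (simp add: q_def)

definition N :: nat where "N = q\<^sup>2 - 1"

lemma N_eq: "N = (q - 1) * (q + 1)"
  by (simp add: N_def power2_eq_square algebra_simps)

lemma N_pos: "N > 0"
  using q_ge_3 unfolding N_eq by simp

lemma a_N: "a ^ N = 1"
  using a_pow by (simp add: N_def)

lemma frob_add: "(b + c) ^ q = b ^ q + (c :: 'a) ^ q"
  using freshmans_dream'[of q r b c] prime_p CHAR_p by (simp add: q_def)

lemma frob_minus: "(- b :: 'a) ^ q = - (b ^ q)"
  using odd_q by (simp add: power_minus_odd)

lemma a_nz: "a \<noteq> 0"
  using a_N N_pos by (metis zero_neq_one zero_power)

lemma a_pow_eq_1: "a ^ k = 1 \<longleftrightarrow> N dvd k"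
proof
  assume "a ^ k = 1"
  moreover have "a ^ k = a ^ (N * (k div N) + k mod N)" by simp
  ultimately have "a ^ (k mod N) = 1" unfolding power_add power_mult a_N by simp
  then have "\<not> 0 < k mod N" using a_prim[of "k mod N", folded N_def] N_pos by auto
  then show "N dvd k" by (simp add: dvd_eq_mod_eq_0)
qed (auto simp: power_mult a_N)

lemma K_powers: "b \<in> K \<Longrightarrow> b \<noteq> 0 \<Longrightarrow> \<exists>k. b = a ^ k"
proof -
  assume b: "b \<in> K" "b \<noteq> 0"
  have inj: "inj_on (\<lambda>k. a ^ k) {..<N}"
  proof (rule inj_onI)
    have aux: "i = j" if "i \<le> j" "j < N" "a ^ i = a ^ j" for i j
    proof -
      have "a ^ j = a ^ i * a ^ (j - i)" using that(1) by (simp flip: power_add)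
      then have "a ^ i * 1 = a ^ i * a ^ (j - i)" using that(3) by simp
      then have "a ^ (j - i) = 1" using a_nz by simp
      then have "N dvd (j - i)" by (simp add: a_pow_eq_1)
      then have "j - i = 0" using that(2)
        by (metis diff_le_self dvd_imp_le le_trans linorder_not_less zero_less_iff_neq_zero)
      then show ?thesis using that(1) by simp
    qed
    fix i j assume "i \<in> {..<N}" "j \<in> {..<N}" "a ^ i = a ^ j"
    then show "i = j" using aux[of i j] aux[of j i] by (cases "i \<le> j") auto
  qed
  have "(\<lambda>k. a ^ k) ` {..<N} = K - {0}"
  proof (rule card_subset_eq)
    show "finite (K - {0})" using finite_K by simp
    show "(\<lambda>k. a ^ k) ` {..<N} \<subseteq> K - {0}" using K_sub(7)[OF a_K] a_nz by auto
    show "card ((\<lambda>k. a ^ k) ` {..<N}) = card (K - {0})"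
      using card_image[OF inj] card_K finite_K K_sub(1) by (simp add: N_def)
  qed
  then show ?thesis using b by blast
qed

lemma K_frob2: "b \<in> K \<Longrightarrow> b \<noteq> 0 \<Longrightarrow> b ^ N = 1"
proof -
  assume "b \<in> K" "b \<noteq> 0"
  then obtain k where "b = a ^ k" using K_powers by blast
  then have "b ^ N = (a ^ N) ^ k" by (simp add: mult.commute flip: power_mult)
  then show ?thesis by (simp add: a_N)
qed

definition e :: 'a where "e = a + a ^ q"

lemma a_frob2: "(a ^ q) ^ q = a"
proof -
  have "q * q = Suc N" using N_pos by (simp add: N_def power2_eq_square)
  then have "(a ^ q) ^ q = a ^ Suc N" by (simp only: power_mult[symmetric])
  then show ?thesis by (simp add: a_N)
qed

lemma e_K: "e \<in> K" and e_frob: "e ^ q = e"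
  using a_K K_sub(3,7) by (simp_all add: e_def frob_add a_frob2 add.commute)

text \<open>Otherwise \<open>a^(q - 1) = -1\<close>, so the order of \<open>a\<close> divides
  \<open>2 (q - 1)\<close>, which is too small because \<open>q + 1 > 2\<close>.\<close>

lemma e_nz: "e \<noteq> 0"
proof
  assume "e = 0"
  then have "a ^ q = - a" by (simp add: e_def eq_neg_iff_add_eq_0 add.commute)
  moreover have "a ^ q = a * a ^ (q - 1)" using q_ge_3 by (metis One_nat_def Suc_diff_1 add_lessD1 le_add_diff_inverse less_add_one numeral_3_eq_3 plus_nat.simps(2) power_Suc zero_less_Suc)
  ultimately have "a * a ^ (q - 1) = a * (- 1)" by simp
  then have "a ^ (q - 1) = - 1" using a_nz by (metis mult_left_cancel)
  then have "a ^ ((q - 1) * 2) = 1" unfolding power_mult by simp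
  then have "N dvd (q - 1) * 2" by (simp add: a_pow_eq_1)
  then have "(q - 1) * (q + 1) \<le> (q - 1) * 2" unfolding N_eq using q_ge_3 by (intro dvd_imp_le) auto
  then have "q + 1 \<le> 2" using q_ge_3 by (simp only: mult_le_cancel1)
  then show False using q_ge_3 by simp
qed

text \<open>Surjectivity of the norm onto the field with \<open>q\<close> elements:
  \<open>1 / e\<close> is fixed by the \<open>q\<close>-th power map, which forces its exponent as a
  power of \<open>a\<close> to be divisible by \<open>q + 1\<close>.\<close>

lemma ex_s0: "\<exists>s0\<in>K. s0 \<noteq> 0 \<and> e * s0 ^ (q + 1) = 1"
proof -
  obtain k where k: "inverse e = a ^ k" using K_powers[of "inverse e"] e_K e_nz K_sub(8) by auto
  have "e ^ q = e * e ^ (q - 1)" using q_ge_3 by (cases q) auto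
  then have "e ^ (q - 1) = 1" using e_frob e_nz by simp
  then have "a ^ (k * (q - 1)) = 1" unfolding power_mult k[symmetric] by (simp add: power_inverse)
  then have "(q - 1) * (q + 1) dvd (q - 1) * k" unfolding a_pow_eq_1 N_eq by (simp only: mult.commute)
  then have "q + 1 dvd k" using q_ge_3 by (simp only: dvd_mult_cancel1 nat_mult_dvd_cancel_disj) auto
  then obtain l where l: "k = (q + 1) * l" by blast
  have "(a ^ l) ^ (q + 1) = a ^ k" unfolding l by (simp only: power_mult[symmetric] mult.commute)
  then have "e * (a ^ l) ^ (q + 1) = e * inverse e" by (simp only: k)
  then have "e * (a ^ l) ^ (q + 1) = 1" using e_nz by simp
  then show ?thesis using K_sub(7)[OF a_K] a_nz by (intro bexI[of _ "a ^ l"]) auto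
qed

definition s0 :: 'a where "s0 = (SOME s. s \<in> K \<and> s \<noteq> 0 \<and> e * s ^ (q + 1) = 1)"

lemma s0: "s0 \<in> K" "s0 \<noteq> 0" "e * s0 ^ (q + 1) = 1"
proof -
  have "s0 \<in> K \<and> s0 \<noteq> 0 \<and> e * s0 ^ (q + 1) = 1"
    unfolding s0_def by (rule someI_ex) (use ex_s0 in blast)
  then show "s0 \<in> K" "s0 \<noteq> 0" "e * s0 ^ (q + 1) = 1" by auto
qed

lemma two_nz: "(2 :: 'a) \<noteq> 0"
proof
  assume "(2 :: 'a) = 0"
  then have "of_nat 2 = (0 :: 'a)" by simp
  then have "CHAR('a) dvd 2" using of_nat_eq_0_iff_char_dvd by blast
  then have "p dvd 2" using CHAR_p by simp
  then have "p \<le> 2" by (rule dvd_imp_le) simp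
  then show False using odd_p prime_ge_2_nat[OF prime_p] by (cases "p = 2") auto
qed

lemma half: "(1 / 2 :: 'a) \<in> K" "(1 / 2 :: 'a) ^ q = 1 / 2"
proof -
  have "(1 + 1 :: 'a) \<in> K" using K_sub(2,3) by blast
  then have "(2 :: 'a) \<in> K" by simp
  then show "(1 / 2 :: 'a) \<in> K" using K_sub(2,9) by blast
  have "(1 + 1 :: 'a) ^ q = 1 + 1" by (subst frob_add) simp
  then show "(1 / 2 :: 'a) ^ q = 1 / 2" by (simp add: power_divide)
qed

text \<open>Else \<open>x^(q + 1)\<close> would be a nonzero element of the finite field
  \<open>K\<close>, and some positive power of \<open>x\<close> would equal
  \<open>1\<close>.\<close>

lemma y_notin_K: "y \<notin> K"
proof
  assume "y \<in> K"
  then have xK: "x ^ (q + 1) \<in> K" unfolding curve[symmetric] using K_sub(3,7) by blast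
  have "x ^ (q + 1) \<noteq> 0"
  proof
    assume "x ^ (q + 1) = 0"
    then have "x = 0" by (simp only: power_eq_0_iff)
    then have "x ^ 1 = x ^ 2" by simp
    then have "(1 :: nat) = 2" using inj_x unfolding inj_def by blast
    then show False by simp
  qed
  then have "x ^ ((q + 1) * N) = x ^ 0" 
    unfolding power_mult power_0 by (rule K_frob2[OF xK])
  then have "(q + 1) * N = 0" using inj_x unfolding inj_def by blast
  then show False using N_pos by simp
qed

definition A :: 'a where "A = 1 + a ^ q * y"
definition B :: 'a where "B = 1 - a * y"
definition D :: 'a where "D = a ^ (q + 1) * y + (a - a ^ q)"

lemma linear_nz: "b \<in> K \<Longrightarrow> c \<in> K \<Longrightarrow> b \<noteq> 0 \<Longrightarrow> b * y + c \<noteq> 0"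
proof
  assume h: "b \<in> K" "c \<in> K" "b \<noteq> 0" "b * y + c = 0"
  then have "y = (- c) / b" by (simp add: field_simps eq_neg_iff_add_eq_0)
  then show False using y_notin_K K_sub(5,9) h by metis
qed

lemma A_nz: "A \<noteq> 0" and B_nz: "B \<noteq> 0" and D_nz: "D \<noteq> 0"
  using linear_nz[of "a ^ q" 1] linear_nz[of "- a" 1] linear_nz[of "a ^ (q + 1)" "a - a ^ q"]
    a_K K_sub a_nz by (auto simp: A_def B_def D_def add.commute)

text \<open>Since \<open>a^(q^2) = a\<close>, \<open>A^q = 1 + a y^q\<close> and
  \<open>B^q = 1 - a^q y^q\<close>. In the difference the terms \<open>a^(q+1) y^(q+1)\<close>
  cancel, and \<open>e (y^q + y)\<close> is left.\<close>

lemma AB: "A ^ (q + 1) - B ^ (q + 1) = e * x ^ (q + 1)"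
proof -
  have "A ^ (q + 1) = (1 + a * y ^ q) * A"
    by (simp add: A_def frob_add power_mult_distrib a_frob2)
  moreover have "B ^ (q + 1) = (1 - a ^ q * y ^ q) * B"
    unfolding B_def diff_conv_add_uminus power_add frob_add by (simp add: frob_minus power_mult_distrib)
  ultimately show ?thesis unfolding curve[symmetric] by (simp add: A_def B_def e_def algebra_simps)
qed

definition s :: 'a where "s = x / A"
definition t :: 'a where "t = B / A"

lemma st: "e * s ^ (q + 1) = 1 - t ^ (q + 1)"
proof -
  have "A ^ (q + 1) \<noteq> 0" using A_nz by simp
  moreover have "e * x ^ (q + 1) / A ^ (q + 1) = (A ^ (q + 1) - B ^ (q + 1)) / A ^ (q + 1)"
    using AB by (simp only:)
  moreover have "A ^ (q + 1) / A ^ (q + 1) = 1" using \<open>A ^ (q + 1) \<noteq> 0\<close> by (rule divide_self)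
  ultimately show ?thesis
    unfolding s_def t_def power_divide times_divide_eq_right diff_divide_distrib by (simp only:)
qed

lemma t_nz: "t \<noteq> 0"
  using A_nz B_nz by (simp add: t_def)

lemma s_ne: "s \<noteq> s0"
  using st s0(3) t_nz by auto

text \<open>Moves the point \<open>(s, t) = (s\<^sub>0, 0)\<close>, which is totally ramified over the \<open>s\<close>-line, to infinity.\<close>

definition z :: 'a where "z = 1 / (s - s0)"
definition v :: 'a where "v = t * z"
definition u :: 'a where "u = - e * (s0 * z + 1 / 2)"

lemma z_nz: "z \<noteq> 0"
  using s_ne by (simp add: z_def)

lemma v_nz: "v \<noteq> 0"
  using t_nz z_nz by (simp add: v_def)

text \<open>Substituting \<open>s = s0 + 1 / z\<close> and multiplying by \<open>z^(q+1)\<close>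
  leaves \<open>z^(q+1)\<close> with the coefficient \<open>1 - e s0^(q+1)\<close>, which the choice
  of \<open>s0\<close> makes vanish. The rest is \<open>-e (s0^q z^q + s0 z + 1)\<close>; halving
  its constant term writes it as \<open>u^q + u\<close>, because \<open>e^q = e\<close>.\<close>

lemma uv: "v ^ (q + 1) = u ^ q + u"
proof -
  have s: "s = s0 + 1 / z" using s_ne by (simp add: z_def)
  have "e * s ^ (q + 1) = e * ((s0 ^ q + 1 / z ^ q) * (s0 + 1 / z))"
    unfolding s by (simp add: frob_add power_divide mult.commute)
  then have t: "t ^ (q + 1) = 1 - e * ((s0 ^ q + 1 / z ^ q) * (s0 + 1 / z))"
    using st by (simp only: eq_diff_eq diff_eq_eq add.commute)
  have "v ^ (q + 1) = (z ^ q * z) * t ^ (q + 1)" by (simp add: v_def power_mult_distrib mult_ac)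
  also have "\<dots> = z ^ q * z - e * ((z ^ q * (s0 ^ q + 1 / z ^ q)) * (z * (s0 + 1 / z)))"
    unfolding t by (simp add: algebra_simps)
  also have "\<dots> = z ^ q * z - e * ((z ^ q * s0 ^ q + 1) * (z * s0 + 1))"
    using z_nz by (simp add: distrib_left)
  finally have "v ^ (q + 1) = z ^ q * z * (1 - e * s0 ^ (q + 1)) - e * (z ^ q * s0 ^ q + z * s0 + 1)"
    by (simp add: algebra_simps)
  then have v: "v ^ (q + 1) = - e * (z ^ q * s0 ^ q + z * s0 + 1)" using s0(3) by simp
  have "u ^ q = - e * (s0 ^ q * z ^ q + 1 / 2)"
    unfolding u_def power_mult_distrib frob_minus frob_add e_frob half(2) ..
  then show ?thesis unfolding v u_def using two_nz by (simp add: field_simps)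
qed

lemma generated_uv:
  assumes S: "subfield_set S" "K \<subseteq> S" "u \<in> S" "v \<in> S"
  shows "S = UNIV"
proof -
  note S1 = subring_set_closed[OF subfield_set_closed(1)[OF S(1)]] subfield_set_closed(3)[OF S(1)]
  have "(u / (- e) - 1 / 2) / s0 = z"
    using e_nz s0(2) by (simp add: u_def field_simps)
  moreover have "(u / (- e) - 1 / 2) / s0 \<in> S"
    using S(3) subsetD[OF S(2) e_K] subsetD[OF S(2) s0(1)] subsetD[OF S(2) half(1)]
    by (intro S1(7)[OF S1(6)[OF S1(7)[OF _ S1(5)]]])
  ultimately have zS: "z \<in> S" by simp
  have "s = s0 + 1 / z" using s_ne by (simp add: z_def)
  then have sS: "s \<in> S" using zS s0(1) S(2) S1(2,3,7) by auto
  have "t = v / z" using z_nz by (simp add: v_def)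
  then have tS: "t \<in> S" using zS S(4) S1(7) by simp
  have tA: "t * A = B" using A_nz by (simp add: t_def)
  \<comment> \<open>\<open>t A = B\<close> is linear in \<open>y\<close>, namely
    \<open>y (a + a^q t) = 1 - t\<close>. Were the coefficient \<open>0\<close>, then
    \<open>t = 1\<close> and \<open>e = 0\<close>.\<close>
  have nz: "a + a ^ q * t \<noteq> 0"
  proof
    assume h: "a + a ^ q * t = 0"
    have "t - 1 = - (y * (a + a ^ q * t))" using tA by (simp add: A_def B_def algebra_simps)
    then have "t = 1" using h by simp
    then show False using h e_nz by (simp add: e_def)
  qed
  have "y * (a + a ^ q * t) = 1 - t" using tA by (simp add: A_def B_def algebra_simps)
  then have "y = (1 - t) / (a + a ^ q * t)" using nz by (simp add: field_simps)
  moreover have "a \<in> S" "a ^ q \<in> S" using a_K K_sub(7)[OF a_K] S(2) by auto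
  then have "a + a ^ q * t \<in> S" using S1(3)[OF _ S1(4)[OF _ tS]] by blast
  then have "(1 - t) / (a + a ^ q * t) \<in> S" by (rule S1(7)[OF S1(6)[OF S1(2) tS]])
  ultimately have yS: "y \<in> S" by (simp only:)
  have "x = s * (1 + a ^ q * y)" using A_nz by (simp add: s_def A_def)
  then have "x \<in> S" using S1(4)[OF sS S1(3)[OF S1(2) S1(4)[OF \<open>a ^ q \<in> S\<close> yS]]] by simp
  then show ?thesis using generated[OF S(1,2)] yS by blast
qed

definition f :: "'a poly" where "f = Polynomial.monom 1 q + Polynomial.monom 1 1"

lemma f_K: "f \<in> polys K"
  unfolding f_def using K_sub(2) by (intro K_polys(3,9))

lemma poly_f: "poly f b = b ^ q + b"
  by (simp add: f_def Polynomial.poly_monom)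

lemma degree_f: "Polynomial.degree f = q"
  unfolding f_def using q_ge_3
  by (subst Polynomial.degree_add_eq_left) (simp_all add: Polynomial.degree_monom_eq)

sublocale UV: integral_ext K u v f "q + 1"
  by unfold_locales (simp, rule f_K, simp only: poly_f uv)

text \<open>If \<open>u\<close> were algebraic, \<open>R\<close> would be a finite domain, hence a
  field containing all generators; then the whole type would be finite, contrary to the distinct
  powers of \<open>x\<close>.\<close>

lemma transcendental_u:
  assumes "g \<in> polys K" "poly g u = 0"
  shows "g = 0"
proof (rule ccontr)
  assume "g \<noteq> 0"
  then have fin: "finite UV.R" using UV.finite_R_of_algebraic assms by blast
  then have "subfield_set UV.R" by (rule finite_subring_subfield[OF UV.subring_R])
  then have "UV.R = UNIV" using generated_uv UV.K_subset_R UV.u_in_R UV.w_in_R by blast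
  then have "finite (UNIV :: 'a set)" using fin by simp
  then have "finite (range (\<lambda>i::nat. x ^ i))" by (rule finite_subset[OF subset_UNIV])
  then show False using range_inj_infinite[OF inj_x] by blast
qed

sublocale UV: transcendental_ext K u v f "q + 1"
  by unfold_locales (rule transcendental_u)

lemma UV_F: "UV.F = UNIV"
  using generated_uv UV.subfield_F UV.K_subset_R UV.u_in_R UV.w_in_R UV.R_subset_F by blast

text \<open>The derivative of \<open>X^q + X\<close> is \<open>1\<close> in characteristic
  \<open>p\<close>, so there are no double roots.\<close>

lemma squarefree_f: "rsquarefree (map_poly to_ac f)"
proof -
  have m: "map_poly to_ac f = Polynomial.monom 1 q + Polynomial.monom 1 1"
    unfolding f_def by (rule poly_eqI) (simp add: Polynomial.coeff_map_poly)
  have "CHAR('a alg_closure) dvd q" using CHAR_p r_pos by (simp add: q_def)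
  then have "of_nat q = (0 :: 'a alg_closure)" using of_nat_eq_0_iff_char_dvd by blast
  then have d: "pderiv (map_poly to_ac f) = 1"
    unfolding m by (simp add: pderiv_add pderiv_monom one_pCons Polynomial.monom_0)
  have f0: "map_poly to_ac f \<noteq> 0" using d by auto
  have "Polynomial.order b (map_poly to_ac f) \<le> 1" for b
  proof (rule ccontr)
    assume "\<not> ?thesis"
    then have "[:- b, 1:] ^ 2 dvd map_poly to_ac f" using Polynomial.order_divides[of b 2 "map_poly to_ac f"] by simp
    then obtain g where g: "map_poly to_ac f = [:- b, 1:] * ([:- b, 1:] * g)"
      by (metis dvdE mult.assoc power2_eq_square)
    have "poly (pderiv (map_poly to_ac f)) b = 0"
      unfolding g by (simp only: pderiv_mult poly_add poly_mult) simp
    then show False using d by simp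
  qed
  then have "Polynomial.order b (map_poly to_ac f) = 0 \<or> Polynomial.order b (map_poly to_ac f) = 1" for b
    using le_Suc_eq by (metis One_nat_def le_0_eq)
  then show ?thesis using f0 by (simp add: rsquarefree_def)
qed

end

section \<open>The fixed field\<close>

definition field_hom_over :: "'a::field set \<Rightarrow> ('a \<Rightarrow> 'a) \<Rightarrow> bool" where
  "field_hom_over K g \<longleftrightarrow> (\<forall>a b. g (a + b) = g a + g b) \<and> (\<forall>a b. g (a * b) = g a * g b) \<and> g 1 = 1 \<and> (\<forall>k\<in>K. g k = k)"

lemma field_hom_simps:
  assumes "field_hom_over K g"
  shows "g (a + b) = g a + g b" "g (a * b) = g a * g b" "g 1 = 1" "k \<in> K \<Longrightarrow> g k = k" "g 0 = 0"
    "g (- a) = - g a" "g (a - b) = g a - g b" "g (inverse a) = inverse (g a)" "g (a / b) = g a / g b"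
    "g (a ^ i) = g a ^ i" "g (sum h S) = (\<Sum>j\<in>S. g (h j))"
proof -
  show add: "g (a + b) = g a + g b" and mult: "g (a * b) = g a * g b" and one: "g 1 = 1"
    and K: "k \<in> K \<Longrightarrow> g k = k" for a b k
    using assms by (auto simp: field_hom_over_def)
  have "g 0 + g 0 = g 0 + 0" using add[of 0 0] by simp
  then show zero: "g 0 = 0" by (simp only: add_left_cancel)
  show neg: "g (- a) = - g a" for a using add[of a "- a"] zero by (simp add: eq_neg_iff_add_eq_0 add.commute)
  show "g (a - b) = g a - g b" using add[of a "- b"] neg by simp
  show inv: "g (inverse a) = inverse (g a)" for a
  proof (cases "a = 0")
    case False
    then have "g a * g (inverse a) = 1" using mult[of a "inverse a"] one by simp
    then show ?thesis by (rule inverse_unique[symmetric])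
  qed (simp add: zero)
  show "g (a / b) = g a / g b" by (simp add: divide_inverse mult inv)
  show "g (a ^ i) = g a ^ i" by (induction i) (simp_all add: one mult)
  show "g (sum h S) = (\<Sum>j\<in>S. g (h j))" by (induction S rule: infinite_finite_induct) (simp_all add: zero add)
qed

lemma field_hom_poly:
  assumes g: "field_hom_over K g" and p: "p \<in> polys K"
  shows "g (poly p b) = poly p (g b)"
  unfolding poly_altdef field_hom_simps(11)[OF g] using p
  by (intro sum.cong refl) (simp add: field_hom_simps[OF g] polys_def)

lemma agree_subfield:
  assumes "field_hom_over K g" "field_hom_over K h"
  shows "subfield_set {b. g b = h b}"
  unfolding subfield_set_def subring_set_def by (simp add: field_hom_simps[OF assms(1)] field_hom_simps[OF assms(2)])

abbreviation type_ring :: "'a::field ring" where "type_ring \<equiv> ring_of_type_algebra"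

lemma type_ring_simps [simp]:
  "carrier type_ring = UNIV" "a \<otimes>\<^bsub>type_ring\<^esub> b = a * b" "a \<oplus>\<^bsub>type_ring\<^esub> b = a + b"
  "\<one>\<^bsub>type_ring\<^esub> = 1" "\<zero>\<^bsub>type_ring\<^esub> = 0" "type_ring\<lparr>carrier := S\<rparr> = ring_of S"
  by (simp_all add: ring_of_type_algebra_def ring_of_def)

lemma type_ring_eq: "(type_ring :: 'a::field ring) = ring_of UNIV"
  by (simp add: ring_of_def ring_of_type_algebra_def)

lemma aut_carrier: "g \<in> carrier (aut_group type_ring K) \<longleftrightarrow> bij g \<and> field_hom_over K g"
  by (auto simp: aut_group_def Bij_def extensional_def field_hom_over_def ring_hom_def)

lemma aut_mult:
  assumes "g \<in> carrier (aut_group type_ring K)" "h \<in> carrier (aut_group type_ring K)"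
  shows "g \<otimes>\<^bsub>aut_group type_ring K\<^esub> h = g \<circ> h"
proof -
  have "g \<in> Bij UNIV" "h \<in> Bij UNIV" using assms by (auto simp: aut_group_def)
  then show ?thesis by (auto simp: aut_group_def BijGroup_def compose_def)
qed

lemma aut_one: "\<one>\<^bsub>aut_group type_ring K\<^esub> = id"
  by (auto simp: aut_group_def BijGroup_def)

lemma group_aut: "group (aut_group (type_ring :: 'a::field ring) K)"
proof (rule groupI)
  let ?G = "aut_group (type_ring :: 'a ring) K"
  show "g \<otimes>\<^bsub>?G\<^esub> h \<in> carrier ?G" if gh: "g \<in> carrier ?G" "h \<in> carrier ?G" for g h
    using gh unfolding aut_mult[OF gh] aut_carrier by (auto simp: bij_comp field_hom_over_def)
  show one: "\<one>\<^bsub>?G\<^esub> \<in> carrier ?G" unfolding aut_one aut_carrier by (simp add: field_hom_over_def)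
  show "\<one>\<^bsub>?G\<^esub> \<otimes>\<^bsub>?G\<^esub> g = g" if "g \<in> carrier ?G" for g
    using aut_mult[OF one that] by (simp add: aut_one)
  show "(g \<otimes>\<^bsub>?G\<^esub> h) \<otimes>\<^bsub>?G\<^esub> k = g \<otimes>\<^bsub>?G\<^esub> (h \<otimes>\<^bsub>?G\<^esub> k)"
    if ghk: "g \<in> carrier ?G" "h \<in> carrier ?G" "k \<in> carrier ?G" for g h k
  proof -
    have "g \<circ> h \<in> carrier ?G" "h \<circ> k \<in> carrier ?G"
      using ghk unfolding aut_carrier by (auto simp: bij_comp field_hom_over_def)
    then show ?thesis using ghk by (simp add: aut_mult comp_assoc)
  qed
  show "\<exists>h\<in>carrier ?G. h \<otimes>\<^bsub>?G\<^esub> g = \<one>\<^bsub>?G\<^esub>" if g: "g \<in> carrier ?G" for g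
  proof -
    have bij: "bij g" and hom: "field_hom_over K g" using g by (auto simp: aut_carrier)
    have surj: "g (inv_into UNIV g a) = a" for a using bij by (simp add: bij_is_surj surj_f_inv_f)
    have inj: "a = b" if "g a = g b" for a b using bij that by (simp add: bij_is_inj inj_eq)
    have "field_hom_over K (inv_into UNIV g)" unfolding field_hom_over_def
      by (intro conjI allI ballI; rule inj) (simp_all add: surj field_hom_simps[OF hom])
    then have i: "inv_into UNIV g \<in> carrier ?G" using bij by (simp add: aut_carrier bij_imp_bij_inv)
    have "inv_into UNIV g \<circ> g = id" using bij by (simp add: bij_is_inj)
    then show ?thesis using aut_mult[OF i g] i aut_one by metis
  qed
qed

text \<open>Multiplication by an element permutes \<open>M\<close>. Comparing the products over
  \<open>M\<close> gives \<open>a^m = 1\<close>. If \<open>m\<close> does not divide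
  \<open>j\<close>, some \<open>a\<close> has \<open>a^j \<noteq> 1\<close>, as
  \<open>X^(j mod m) - 1\<close> has fewer than \<open>m\<close> roots, and substituting
  \<open>a b\<close> for \<open>b\<close> shows that the power sum vanishes.\<close>

lemma sum_powers_subgroup:
  fixes M :: "'a::field set"
  assumes M: "finite M" "card M = m" "0 \<notin> M" "\<And>a b. a \<in> M \<Longrightarrow> b \<in> M \<Longrightarrow> a * b \<in> M" and m: "m > 0"
  shows "a \<in> M \<Longrightarrow> a ^ m = 1" "(\<Sum>a\<in>M. a ^ j) = (if m dvd j then of_nat m else 0)"
proof -
  have perm: "(\<lambda>b. a * b) ` M = M" "inj_on (\<lambda>b. a * b) M" if a: "a \<in> M" for a
  proof -
    have "a \<noteq> 0" using a M(3) by blast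
    then show i: "inj_on (\<lambda>b. a * b) M" by (auto simp: inj_on_def)
    show "(\<lambda>b. a * b) ` M = M"
      using a M(4) by (intro card_subset_eq[OF M(1)]) (auto simp: card_image[OF i])
  qed
  show pow: "a ^ m = 1" if a: "a \<in> M" for a
  proof -
    have "prod (\<lambda>b. b) M = (\<Prod>b\<in>M. a * b)"
      using prod.reindex[OF perm(2)[OF a], of "\<lambda>b. b"] perm(1)[OF a] by (simp add: o_def)
    also have "\<dots> = a ^ m * prod (\<lambda>b. b) M" by (simp add: prod.distrib M(2))
    finally have "1 * prod (\<lambda>b. b) M = a ^ m * prod (\<lambda>b. b) M" by simp
    moreover have "prod (\<lambda>b. b) M \<noteq> 0" using M(1,3) by (simp add: prod_zero_iff)
    ultimately show ?thesis by (metis mult_right_cancel)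
  qed
  show "(\<Sum>a\<in>M. a ^ j) = (if m dvd j then of_nat m else 0)"
  proof (cases "m dvd j")
    case True
    then obtain l where "j = m * l" by blast
    then have "a ^ j = 1" if "a \<in> M" for a using pow[OF that] by (simp add: power_mult)
    then show ?thesis using True M(2) by simp
  next
    case False
    define l where "l = j mod m"
    have l: "0 < l" "l < m" using False m by (auto simp: l_def dvd_eq_mod_eq_0)
    have "\<exists>a\<in>M. a ^ l \<noteq> 1"
    proof (rule ccontr)
      assume "\<not> ?thesis"
      then have "M \<subseteq> {b. poly (Polynomial.monom 1 l - 1) b = 0}" by (auto simp: Polynomial.poly_monom)
      moreover have "Polynomial.coeff (Polynomial.monom 1 l - 1 :: 'a poly) l = 1"
        using l by (simp add: Polynomial.coeff_1)
      then have nz: "Polynomial.monom 1 l - 1 \<noteq> (0 :: 'a poly)" by (metis Polynomial.coeff_0 zero_neq_one)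
      moreover have "Polynomial.degree (Polynomial.monom 1 l - 1 :: 'a poly) \<le> l"
        by (intro Polynomial.degree_diff_le Polynomial.degree_monom_le) simp
      ultimately have "card M \<le> l"
        using card_mono[OF poly_roots_finite[OF nz], of M] card_poly_roots_bound[OF nz] by linarith
      then show False using M(2) l by simp
    qed
    then obtain a where a: "a \<in> M" "a ^ l \<noteq> 1" by blast
    have "a ^ j = a ^ (m * (j div m) + l)" by (simp add: l_def)
    then have "a ^ j = a ^ l" unfolding power_add power_mult pow[OF a(1)] by simp
    then have aj: "a ^ j \<noteq> 1" using a(2) by simp
    have "(\<Sum>b\<in>M. b ^ j) = (\<Sum>b\<in>M. (a * b) ^ j)"
      using sum.reindex[OF perm(2)[OF a(1)], of "\<lambda>b. b ^ j"] perm(1)[OF a(1)] by (simp add: o_def)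
    also have "\<dots> = a ^ j * (\<Sum>b\<in>M. b ^ j)" by (simp add: power_mult_distrib sum_distrib_left)
    finally have "(a ^ j - 1) * (\<Sum>b\<in>M. b ^ j) = 0" by (simp add: algebra_simps)
    then show ?thesis using aj False by simp
  qed
qed

section \<open>The action of \<sigma> on \<open>u\<close> and \<open>v\<close>\<close>

locale hermitian_automorphism = hermitian K p r q x y a
  for K :: "'a::field set" and p r q :: nat and x y a :: 'a +
  fixes \<sigma> :: "'a \<Rightarrow> 'a"
  assumes \<sigma>_aut: "\<sigma> \<in> carrier (aut_group type_ring K)"
    and \<sigma>_x: "\<sigma> x = a * x / (a ^ (q + 1) * y + (a - a ^ q))"
    and \<sigma>_y: "\<sigma> y = 1 / (a ^ (q + 1) * y + (a - a ^ q))"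
begin

abbreviation "Aut \<equiv> aut_group type_ring K"

text \<open>Quotient of the eigenvalues \<open>-a^q\<close> of \<open>B\<close> and \<open>a\<close>
  of \<open>A\<close>.\<close>

definition \<omega> :: 'a where "\<omega> = - (a ^ (q - 1))"

lemma \<sigma>_hom: "field_hom_over K \<sigma>"
  using \<sigma>_aut by (simp add: aut_carrier)

lemmas \<sigma>_simps = field_hom_simps[OF \<sigma>_hom]

lemma a_pow_Suc: "a ^ (q + 1) = a ^ q * a" "a ^ q = a ^ (q - 1) * a"
  using q_ge_3 by (simp_all add: mult.commute flip: power_Suc)

lemma \<omega>_pow: "\<omega> ^ (q + 1) = 1" and \<omega>_K: "\<omega> \<in> K" and \<omega>_nz: "\<omega> \<noteq> 0"
proof -
  have "\<omega> ^ (q + 1) = (a ^ (q - 1)) ^ (q + 1)" using odd_q unfolding \<omega>_def by (intro power_minus_even) simp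
  also have "\<dots> = 1" by (simp only: power_mult[symmetric] N_eq[symmetric] a_N)
  finally show "\<omega> ^ (q + 1) = 1" .
  show "\<omega> \<in> K" unfolding \<omega>_def by (intro K_sub(5) K_sub(7)[OF a_K])
  show "\<omega> \<noteq> 0" using a_nz by (simp add: \<omega>_def)
qed

lemma \<sigma>_A: "\<sigma> A = a * A / D"
proof -
  have "\<sigma> A = 1 + a ^ q * (1 / D)"
    using a_K by (simp add: A_def \<sigma>_simps \<sigma>_y D_def)
  also have "\<dots> = (D + a ^ q) / D" using D_nz by (simp add: add_divide_distrib)
  also have "D + a ^ q = a * A" unfolding D_def A_def a_pow_Suc(1) by (simp add: algebra_simps)
  finally show ?thesis .
qed

lemma \<sigma>_B: "\<sigma> B = - (a ^ q) * B / D"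
proof -
  have "\<sigma> B = 1 - a * (1 / D)"
    using a_K by (simp add: B_def \<sigma>_simps \<sigma>_y D_def)
  also have "\<dots> = (D - a) / D" using D_nz by (simp add: diff_divide_distrib)
  also have "D - a = - (a ^ q) * B" unfolding D_def B_def a_pow_Suc(1) by (simp add: algebra_simps)
  finally show ?thesis .
qed

lemma \<sigma>_s: "\<sigma> s = s"
proof -
  have "\<sigma> x = a * x / D" using \<sigma>_x by (simp only: D_def)
  then show ?thesis using A_nz a_nz D_nz unfolding s_def \<sigma>_simps \<sigma>_A by simp
qed

lemma \<sigma>_t: "\<sigma> t = \<omega> * t"
proof -
  have "\<sigma> t = (- (a ^ q) * B) / (a * A)" using D_nz unfolding t_def \<sigma>_simps \<sigma>_A \<sigma>_B by simp
  also have "\<dots> = \<omega> * t" using a_nz A_nz unfolding a_pow_Suc(2) by (simp add: \<omega>_def t_def field_simps)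
  finally show ?thesis .
qed

lemma \<sigma>_z: "\<sigma> z = z"
  using s0(1) by (simp add: z_def \<sigma>_simps \<sigma>_s)

lemma \<sigma>_v: "\<sigma> v = \<omega> * v"
  by (simp add: v_def \<sigma>_simps \<sigma>_t \<sigma>_z)

lemma \<sigma>_u: "\<sigma> u = u"
  using \<sigma>_simps(4)[OF e_K] \<sigma>_simps(4)[OF s0(1)] \<sigma>_simps(4)[OF half(1)]
  unfolding u_def \<sigma>_simps(1,2,6) \<sigma>_z by (simp only:)

lemma aut_eqI:
  assumes "field_hom_over K g" "field_hom_over K h" "g u = h u" "g v = h v"
  shows "g = h"
proof -
  have "{b. g b = h b} = UNIV"
    using assms by (intro generated_uv agree_subfield[of K]) (auto simp: field_hom_over_def)
  then show ?thesis by auto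
qed

lemma \<sigma>_power: "\<sigma> [^]\<^bsub>Aut\<^esub> (i::nat) \<in> carrier Aut \<and> (\<sigma> [^]\<^bsub>Aut\<^esub> i) u = u \<and> (\<sigma> [^]\<^bsub>Aut\<^esub> i) v = \<omega> ^ i * v"
proof -
  interpret G: group Aut by (rule group_aut)
  show ?thesis
  proof (induction i)
    case (Suc i)
    let ?g = "\<sigma> [^]\<^bsub>Aut\<^esub> i"
    have g: "?g \<in> carrier Aut" using Suc by blast
    have hom: "field_hom_over K ?g" using g by (simp add: aut_carrier)
    have eq: "\<sigma> [^]\<^bsub>Aut\<^esub> Suc i = ?g \<circ> \<sigma>" using aut_mult[OF g \<sigma>_aut] by simp
    moreover have "\<sigma> [^]\<^bsub>Aut\<^esub> Suc i \<in> carrier Aut" by (rule G.nat_pow_closed[OF \<sigma>_aut])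
    moreover have "(?g \<circ> \<sigma>) u = u" "(?g \<circ> \<sigma>) v = \<omega> ^ Suc i * v"
      using Suc by (simp_all add: \<sigma>_u \<sigma>_v field_hom_simps[OF hom] \<omega>_K)
    ultimately show ?case unfolding eq by blast
  next
    case 0
    have "\<sigma> [^]\<^bsub>Aut\<^esub> (0::nat) \<in> carrier Aut" by (rule G.nat_pow_closed[OF \<sigma>_aut])
    moreover have eq: "\<sigma> [^]\<^bsub>Aut\<^esub> (0::nat) = id" by (simp only: G.nat_pow_0 aut_one)
    moreover have "id u = u" "id v = \<omega> ^ 0 * v" by simp_all
    ultimately show ?case unfolding eq by blast
  qed
qed

lemma ord_\<sigma>_dvd: "group.ord Aut \<sigma> dvd q + 1"
proof -
  interpret G: group Aut by (rule group_aut)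
  have "\<sigma> [^]\<^bsub>Aut\<^esub> (q + 1) = \<one>\<^bsub>Aut\<^esub>"
    unfolding aut_one
  proof (rule aut_eqI)
    show "field_hom_over K (\<sigma> [^]\<^bsub>Aut\<^esub> (q + 1))" using \<sigma>_power aut_carrier by blast
    show "field_hom_over K id" by (simp add: field_hom_over_def)
  qed (use \<sigma>_power[of "q + 1"] \<omega>_pow in simp_all)
  then show ?thesis using G.pow_eq_id[OF \<sigma>_aut] by blast
qed

lemma generate_\<sigma>:
  assumes "g \<in> generate Aut {\<sigma>}"
  shows "g \<in> carrier Aut \<and> g u = u \<and> (\<exists>i. g v = \<omega> ^ i * v)"
  using assms
proof (induction rule: generate.induct)
  case one
  interpret G: group Aut by (rule group_aut)
  have "id v = \<omega> ^ 0 * v" by simp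
  moreover have "id u = u" by simp
  ultimately show ?case using G.one_closed unfolding aut_one by blast
next
  case (incl g)
  then show ?case using \<sigma>_aut \<sigma>_u \<sigma>_v by (auto intro!: exI[of _ 1])
next
  case (inv g)
  interpret G: group Aut by (rule group_aut)
  let ?h = "inv\<^bsub>Aut\<^esub> \<sigma>"
  have h: "?h \<in> carrier Aut" using \<sigma>_aut by (rule G.inv_closed)
  have hom: "field_hom_over K ?h" using h by (simp add: aut_carrier)
  have "?h \<circ> \<sigma> = id" using G.l_inv[OF \<sigma>_aut] unfolding aut_mult[OF h \<sigma>_aut] aut_one .
  then have c: "?h (\<sigma> b) = b" for b by (metis comp_apply id_apply)
  have "\<omega> * ?h v = v" using c[of v] unfolding \<sigma>_v field_hom_simps(2)[OF hom] field_hom_simps(4)[OF hom \<omega>_K] .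
  \<comment> \<open>\<open>\<omega>^q\<close> is the inverse of \<open>\<omega>\<close>, so inverses
    too act by nonnegative powers.\<close>
  then have "\<omega> ^ q * (\<omega> * ?h v) = \<omega> ^ q * v" by (simp only:)
  moreover have "\<omega> ^ q * (\<omega> * ?h v) = \<omega> ^ (q + 1) * ?h v" by (simp add: mult_ac)
  ultimately have "?h v = \<omega> ^ q * v" by (simp only: \<omega>_pow mult_1_left)
  then show ?case using inv h c[of u] unfolding \<sigma>_u by auto
next
  case (eng g h)
  then obtain i j where ij: "g v = \<omega> ^ i * v" "h v = \<omega> ^ j * v" by blast
  interpret G: group Aut by (rule group_aut)
  have gh: "g \<in> carrier Aut" "h \<in> carrier Aut" using eng by auto
  have hom: "field_hom_over K g" using gh by (simp add: aut_carrier)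
  have "g (h v) = \<omega> ^ (j + i) * v"
    unfolding ij(2) field_hom_simps(2)[OF hom] field_hom_simps(4)[OF hom K_sub(7)[OF \<omega>_K]] ij(1)
    by (simp add: power_add mult.assoc)
  then have "(g \<circ> h) v = \<omega> ^ (j + i) * v" "(g \<circ> h) u = u" using eng by simp_all
  then show ?case using G.m_closed[OF gh] unfolding aut_mult[OF gh] by blast
qed

end

locale hermitian_subgroup = hermitian_automorphism K p r q x y a \<sigma>
  for K :: "'a::field set" and p r q :: nat and x y a :: 'a and \<sigma> :: "'a \<Rightarrow> 'a" +
  fixes \<G> :: "('a \<Rightarrow> 'a) set" and m :: nat
  assumes m_pos: "m > 0" and m_dvd: "m dvd group.ord Aut \<sigma>"
    and \<G>: "subgroup \<G> (Aut\<lparr>carrier := generate Aut {\<sigma>}\<rparr>)" and card_\<G>: "card \<G> = m"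
begin

lemma \<G>_facts:
  assumes "g \<in> \<G>"
  shows "g \<in> carrier Aut" "field_hom_over K g" "g u = u" "\<exists>\<zeta>\<in>K. \<zeta> \<noteq> 0 \<and> g v = \<zeta> * v"
proof -
  have "g \<in> generate Aut {\<sigma>}" using subgroup.subset[OF \<G>] assms by auto
  then have g: "g \<in> carrier Aut" "g u = u" "\<exists>i. g v = \<omega> ^ i * v" using generate_\<sigma> by auto
  then show "g \<in> carrier Aut" "g u = u" "field_hom_over K g" by (auto simp: aut_carrier)
  obtain i where "g v = \<omega> ^ i * v" using g(3) by blast
  then show "\<exists>\<zeta>\<in>K. \<zeta> \<noteq> 0 \<and> g v = \<zeta> * v"
    using K_sub(7)[OF \<omega>_K, of i] \<omega>_nz by (intro bexI[of _ "\<omega> ^ i"]) simp_all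
qed

text \<open>A faithful character: \<open>g\<close> is determined by its values at \<open>u\<close>
  and \<open>v\<close>, so \<open>\<zeta>\<close> embeds \<open>\<G>\<close> into the
  \<open>m\<close>-th roots of unity of \<open>K\<close>.\<close>

definition \<zeta> :: "('a \<Rightarrow> 'a) \<Rightarrow> 'a" where "\<zeta> g = g v / v"

lemma \<zeta>: assumes "g \<in> \<G>" shows "\<zeta> g \<in> K" "\<zeta> g \<noteq> 0" "g v = \<zeta> g * v"
  using \<G>_facts(4)[OF assms] v_nz by (auto simp: \<zeta>_def)

lemma \<zeta>_inj: "inj_on \<zeta> \<G>"
proof (rule inj_onI)
  fix g h assume gh: "g \<in> \<G>" "h \<in> \<G>" "\<zeta> g = \<zeta> h"
  then show "g = h" using \<G>_facts[OF gh(1)] \<G>_facts[OF gh(2)] \<zeta>[OF gh(1)] \<zeta>[OF gh(2)]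
    by (intro aut_eqI) auto
qed

lemma finite_\<G>: "finite \<G>"
  using card_\<G> m_pos by (simp add: card_ge_0_finite)

lemma \<zeta>_mult: "g \<in> \<G> \<Longrightarrow> h \<in> \<G> \<Longrightarrow> \<zeta> g * \<zeta> h \<in> \<zeta> ` \<G>"
proof -
  assume gh: "g \<in> \<G>" "h \<in> \<G>"
  have "g \<otimes>\<^bsub>Aut\<^esub> h \<in> \<G>" using subgroup.m_closed[OF \<G> gh] by simp
  then have c: "g \<circ> h \<in> \<G>" using aut_mult \<G>_facts(1) gh by metis
  have "(g \<circ> h) v = \<zeta> g * \<zeta> h * v"
    using \<zeta>[OF gh(1)] \<zeta>[OF gh(2)] by (simp add: field_hom_simps[OF \<G>_facts(2)[OF gh(1)]])
  then have "\<zeta> (g \<circ> h) = \<zeta> g * \<zeta> h" using v_nz by (simp add: \<zeta>_def)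
  then show ?thesis using c by (metis imageI)
qed

lemma \<zeta>_sums: "g \<in> \<G> \<Longrightarrow> \<zeta> g ^ m = 1" "(\<Sum>g\<in>\<G>. \<zeta> g ^ j) = (if m dvd j then of_nat m else 0)"
proof -
  have M: "finite (\<zeta> ` \<G>)" "card (\<zeta> ` \<G>) = m" "0 \<notin> \<zeta> ` \<G>"
    using finite_\<G> card_\<G> card_image[OF \<zeta>_inj] \<zeta>(2) by auto
  have mult: "b * c \<in> \<zeta> ` \<G>" if "b \<in> \<zeta> ` \<G>" "c \<in> \<zeta> ` \<G>" for b c using that \<zeta>_mult by blast
  show "\<zeta> g ^ m = 1" if "g \<in> \<G>" using sum_powers_subgroup(1)[OF M mult m_pos] that by blast
  show "(\<Sum>g\<in>\<G>. \<zeta> g ^ j) = (if m dvd j then of_nat m else 0)"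
    using sum_powers_subgroup(2)[OF M mult m_pos, of j] sum.reindex[OF \<zeta>_inj, of "\<lambda>b. b ^ j"] by (simp add: o_def)
qed

lemma m_dvd_q: "m dvd q + 1"
  using m_dvd ord_\<sigma>_dvd dvd_trans by blast

definition n :: nat where "n = (q + 1) div m"

lemma nm: "n * m = q + 1"
  using m_dvd_q by (simp add: n_def)

lemma n_pos: "n > 0"
  using nm by (cases n) auto

lemma p_dvd_q: "p dvd q"
  using r_pos by (simp add: q_def)

lemma not_p_dvd: "\<not> p dvd q + 1"
  using p_dvd_q prime_p by (metis dvd_add_right_iff not_prime_unit)

lemma m_nz: "of_nat m \<noteq> (0 :: 'a)"
proof
  assume "of_nat m = (0 :: 'a)"
  then have "p dvd m" using of_nat_eq_0_iff_char_dvd CHAR_p by metis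
  then show False using not_p_dvd m_dvd_q dvd_trans by blast
qed

sublocale W: superelliptic K u "v ^ m" f n p q
proof unfold_locales
  show "(v ^ m) ^ n = poly f u" using nm by (simp add: poly_f uv[symmetric] mult.commute flip: power_mult)
  show "\<not> p dvd n" using not_p_dvd nm by (metis dvd_mult2)
  show "coprime n q"
  proof (rule coprimeI)
    fix l assume l: "l dvd n" "l dvd q"
    then have "l dvd q + 1" using nm by (metis dvd_mult2)
    then show "is_unit l" using l(2) by (metis dvd_add_right_iff)
  qed
qed (use n_pos f_K transcendental_u prime_p CHAR_p degree_f q_ge_3 squarefree_f in auto)

text \<open>Averaging: summing the images of a fixed numerator over \<open>\<G>\<close> multiplies
  its coefficient at \<open>v^j\<close> by the sum of \<open>\<zeta> g ^ j\<close>, which is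
  \<open>m\<close> if \<open>m\<close> divides \<open>j\<close> and \<open>0\<close> otherwise. As
  \<open>m\<close> is invertible, only powers of \<open>v^m\<close> remain. The numerator of a fixed
  element is fixed because the denominator is a polynomial in \<open>u\<close>.\<close>

lemma fixed_eq: "{b. \<forall>g\<in>\<G>. g b = b} = W.F"
proof (intro equalityI subsetI)
  fix b assume "b \<in> W.F"
  then obtain c d where cd: "b = c / poly d u" "c \<in> W.R" "d \<in> polys K" by (auto simp: W.F_def)
  have "g b = b" if g: "g \<in> \<G>" for g
  proof -
    note hom = \<G>_facts(2)[OF g]
    have id: "field_hom_over K id" by (simp add: field_hom_over_def)
    have "W.R \<subseteq> {b. g b = id b}"
    proof (rule W.R_subset_subring)
      show "subring_set {b. g b = id b}" by (rule subfield_set_closed(1)[OF agree_subfield[OF hom id]])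
      show "v ^ m \<in> {b. g b = id b}"
        using \<zeta>(3)[OF g] \<zeta>_sums(1)[OF g] by (simp add: field_hom_simps[OF hom] power_mult_distrib)
    qed (use field_hom_simps(4)[OF hom] \<G>_facts(3)[OF g] in auto)
    moreover have "poly d u \<in> W.R" using cd(3) by (rule W.R_poly)
    ultimately have "g c = c" "g (poly d u) = poly d u" using cd(2) by auto
    then show ?thesis by (simp add: cd(1) field_hom_simps(9)[OF hom])
  qed
  then show "b \<in> {b. \<forall>g\<in>\<G>. g b = b}" by blast
next
  fix b assume b: "b \<in> {b. \<forall>g\<in>\<G>. g b = b}"
  have "b \<in> UV.F" unfolding UV_F by simp
  then obtain c d where cd: "b = c / poly d u" "c \<in> UV.R" "d \<in> polys K" "d \<noteq> 0"
    unfolding UV.F_def by blast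
  obtain h where h: "c = UV.coord h" "\<And>j. h j \<in> polys K" using cd(2) unfolding UV.R_def by blast
  have c: "c = b * poly d u" using cd UV.poly_u_nz by simp
  have "g c = c" if g: "g \<in> \<G>" for g
    using b g cd(3) \<G>_facts(3)[OF g]
    by (simp add: c field_hom_simps[OF \<G>_facts(2)[OF g]] field_hom_poly[OF \<G>_facts(2)[OF g]])
  then have "(\<Sum>g\<in>\<G>. g c) = (\<Sum>g\<in>\<G>. c)" by (intro sum.cong refl)
  then have "of_nat m * c = (\<Sum>g\<in>\<G>. g c)" by (simp add: card_\<G>)
  also have "\<dots> = (\<Sum>g\<in>\<G>. \<Sum>j<q + 1. poly (h j) u * v ^ j * \<zeta> g ^ j)"
  proof (intro sum.cong refl)
    fix g assume g: "g \<in> \<G>"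
    show "g c = (\<Sum>j<q + 1. poly (h j) u * v ^ j * \<zeta> g ^ j)"
      unfolding h(1) UV.coord_def field_hom_simps(11)[OF \<G>_facts(2)[OF g]]
      using \<zeta>(3)[OF g] h(2) \<G>_facts(3)[OF g]
      by (intro sum.cong refl) (simp add: field_hom_simps[OF \<G>_facts(2)[OF g]] field_hom_poly[OF \<G>_facts(2)[OF g]] power_mult_distrib mult_ac)
  qed
  also have "\<dots> = (\<Sum>j<q + 1. poly (h j) u * v ^ j * (\<Sum>g\<in>\<G>. \<zeta> g ^ j))"
    unfolding sum_distrib_left by (rule sum.swap)
  also have "\<dots> = (\<Sum>j<q + 1. if m dvd j then of_nat m * (poly (h j) u * v ^ j) else 0)"
    unfolding \<zeta>_sums(2) by (intro sum.cong refl) simp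
  also have "\<dots> = (\<Sum>j\<in>(\<lambda>i. m * i) ` {..<n}. of_nat m * (poly (h j) u * v ^ j))"
  proof -
    have eq: "{j \<in> {..<q + 1}. m dvd j} = (\<lambda>i. m * i) ` {..<n}"
    proof (intro equalityI subsetI)
      fix j assume "j \<in> {j \<in> {..<q + 1}. m dvd j}"
      then obtain i where "j = m * i" "m * i < n * m" using nm by auto
      then show "j \<in> (\<lambda>i. m * i) ` {..<n}" by (auto simp: mult.commute)
    next
      fix j assume "j \<in> (\<lambda>i. m * i) ` {..<n}"
      then obtain i where i: "j = m * i" "i < n" by auto
      then have "m * i < n * m" using m_pos by (simp add: mult.commute)
      then show "j \<in> {j \<in> {..<q + 1}. m dvd j}" using nm i(1) by simp
    qed
    show ?thesis unfolding eq[symmetric] by (rule sum.inter_filter[symmetric]) simp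
  qed
  also have "\<dots> = (\<Sum>i<n. of_nat m * (poly (h (m * i)) u * v ^ (m * i)))"
    using m_pos by (subst sum.reindex) (auto simp: inj_on_def)
  also have "\<dots> = of_nat m * W.coord (\<lambda>i. h (m * i))"
    unfolding W.coord_def sum_distrib_left by (simp add: power_mult)
  finally have "c = W.coord (\<lambda>i. h (m * i))" using m_nz by simp
  then have "c \<in> W.R" using h(2) W.coord_in_R by simp
  then show "b \<in> W.F" using W.FI cd by simp
qed

lemma genus_fixed_field: "2 * genus (fixed_field type_ring \<G>) K = (int n - 1) * (int q - 1)"
  using W.genus_superelliptic by (simp add: fixed_field_def fixed_eq)

end

section \<open>From the hypotheses on structures to the locale\<close>

lemma subfield_type_ring:
  assumes "subfield K (type_ring :: 'a::field ring)"
  shows "subfield_set K"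
proof -
  have sK: "subfield K (ring_of (UNIV :: 'a set))" using assms by (simp add: type_ring_eq)
  have U: "subring_set (UNIV :: 'a set)" by (simp add: subring_set_def)
  interpret f: field "ring_of (UNIV :: 'a set)" by (rule field_ring_of) (simp add: subfield_set_def U)
  have S: "subring_set K" using subfieldE(1)[OF sK] subring_ring_of_iff[OF U] by blast
  have "inverse b \<in> K" if b: "b \<in> K" for b
  proof (cases "b = 0")
    case False
    have "inv\<^bsub>ring_of UNIV\<^esub> b \<in> K" using f.subfield_m_inv(1)[OF sK] b False by simp
    then show ?thesis using inv_ring_of[OF U, of b] False by simp
  qed (use b in simp)
  then show ?thesis using S by (simp add: subfield_set_def)
qed

text \<open>Translation by \<open>1\<close> permutes the finite set \<open>K\<close>; comparing the
  sums over \<open>K\<close> shows \<open>card K = 0\<close> in the field, so the characteristic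
  divides a power of \<open>p\<close>.\<close>

lemma CHAR_of_card:
  fixes K :: "'a::field set"
  assumes K: "subring_set K" "card K = p ^ k" and p: "Factorial_Ring.prime p" "k > 0"
  shows "CHAR('a) = p"
proof -
  have fin: "finite K" using K(2) p prime_gt_0_nat[OF p(1)] by (metis card.infinite power_not_zero less_numeral_extra(3))
  have im: "(\<lambda>b. b + 1) ` K = K"
  proof (rule card_subset_eq[OF fin])
    show "(\<lambda>b. b + 1) ` K \<subseteq> K" using subring_set_closed(2,3)[OF K(1)] by auto
    show "card ((\<lambda>b. b + 1) ` K) = card K" by (intro card_image) (simp add: inj_on_def)
  qed
  have "(\<Sum>b\<in>K. b) = (\<Sum>b\<in>K. b + 1)"
    using sum.reindex[of "\<lambda>b. b + 1" K "\<lambda>b. b"] im by (simp add: inj_on_def o_def)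
  then have "of_nat (p ^ k) = (0 :: 'a)" by (simp add: sum.distrib K(2)[symmetric])
  then have "CHAR('a) dvd p ^ k" using of_nat_eq_0_iff_char_dvd by blast
  then have "CHAR('a) > 0" using prime_gt_0_nat[OF p(1)] by (metis dvd_0_left_iff gr0I power_not_zero less_numeral_extra(3))
  then have "Factorial_Ring.prime CHAR('a)" by (rule prime_CHAR_semidom)
  then show ?thesis using \<open>CHAR('a) dvd p ^ k\<close> p(1) by (metis prime_dvd_power primes_dvd_imp_eq)
qed

text \<open>Monomials of different degree are lists of different length, and evaluation at a
  transcendental \<open>x\<close> is injective.\<close>

lemma inj_powers_of_transcendental:
  assumes K: "subfield K (type_ring :: 'a::field ring)" and x: "ring.transcendental type_ring K x"
  shows "inj (\<lambda>i::nat. x ^ i)"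
proof (rule injI)
  interpret f: field "type_ring :: 'a ring" by (rule field_from_type_algebra)
  fix i j :: nat assume eq: "x ^ i = x ^ j"
  let ?mon = "\<lambda>i. f.monom 1 i"
  have one: "1 \<in> K - {\<zero>\<^bsub>type_ring\<^esub>}" using subringE(3)[OF subfieldE(1)[OF K]] by simp
  have mon: "?mon i \<in> carrier (K[X]\<^bsub>type_ring\<^esub>)" for i
    using f.monom_is_polynomial[OF subfieldE(1)[OF K] one] by (simp add: univ_poly_carrier)
  have pow: "b [^]\<^bsub>type_ring\<^esub> i = b ^ i" for b :: 'a and i :: nat
    by (simp add: type_ring_eq pow_ring_of)
  have ev: "f.eval (?mon i) x = x ^ i" for i
    using f.eval_monom[of 1 x i] by (simp add: pow)
  have "?mon i = ?mon j"
    using x mon ev eq unfolding f.transcendental_def inj_on_def by metis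
  then have "length (?mon i) = length (?mon j)" by simp
  then show "i = j" by (simp add: f.monom_def)
qed

theorem theorem5p4:
  fixes p r q m :: nat
    and H :: "'h::field ring"
    and K :: "'h set"
    and x y a c :: 'h
    and \<sigma> :: "'h \<Rightarrow> 'h"
    and \<D> \<G> :: "('h \<Rightarrow> 'h) set"
  assumes "Factorial_Ring.prime p" and "odd p" and "r > 0" and "q = p ^ r"
    and "\<not> 3 dvd q + 1"
    and "H = ring_of_type_algebra"
    and "hermitian_function_field q H K x y"
    and "a \<in> K" and "a ^ (q\<^sup>2 - 1) = 1" and "\<forall>k. 0 < k \<and> k < q\<^sup>2 - 1 \<longrightarrow> a ^ k \<noteq> 1"
    and "c = a - a ^ q"
    and "\<sigma> \<in> carrier (aut_group H K)"
    and "\<sigma> x = a * x / (a ^ (q + 1) * y + c)"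
    and "\<sigma> y = 1 / (a ^ (q + 1) * y + c)"
    and "\<D> = generate (aut_group H K) {\<sigma>}"
    and "m > 0" and "m dvd group.ord (aut_group H K) \<sigma>"
    and "subgroup \<G> (aut_group H K\<lparr>carrier := \<D>\<rparr>)" and "card \<G> = m"
  shows "real_of_int (genus (fixed_field H \<G>) K) =
           (real q - 1) * (real q + 1 - real m) / (2 * real m)"
proof -
  note H = assms(6)
  have herm: "subfield K type_ring" "card K = q\<^sup>2" "ring.transcendental type_ring K x"
    "y [^]\<^bsub>type_ring\<^esub> q + y = x [^]\<^bsub>type_ring\<^esub> (q + 1)"
    "UNIV = generate_field type_ring (K \<union> {x, y})"
    using assms(7) unfolding hermitian_function_field_def H by simp_all
  have K: "subfield_set K" using herm(1) by (rule subfield_type_ring)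
  note Kr = subfield_set_closed(1)[OF K]
  have q2: "card K = p ^ (r * 2)" using herm(2) assms(4) by (simp add: power_mult)
  have CHAR: "CHAR('h) = p" using CHAR_of_card[OF Kr q2 assms(1)] assms(3) by simp
  have "q > 0" using assms(1,4) prime_gt_0_nat by simp
  then have finK: "finite K" using herm(2) by (intro card_ge_0_finite) simp
  have curve: "y ^ q + y = x ^ (q + 1)"
    using herm(4) unfolding type_ring_eq pow_ring_of .
  \<comment> \<open>Minimality is read off the inductive definition of
    \<open>generate_field\<close>: each closure step stays inside a subfield containing the
    generators.\<close>
  have gen: "S = UNIV" if S: "subfield_set S" "K \<subseteq> S" "x \<in> S" "y \<in> S" for S
  proof -
    have U: "subring_set (UNIV :: 'h set)" by (simp add: subring_set_def)
    have "b \<in> S" if "b \<in> generate_field type_ring (K \<union> {x, y})" for b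
      using that
    proof (induction rule: generate_field.induct)
      case (a_inv h)
      have "\<ominus>\<^bsub>type_ring\<^esub> h = - h" using a_inv_ring_of[OF U, of h] by (simp add: type_ring_eq)
      then show ?case using a_inv.IH subring_set_closed(5)[OF subfield_set_closed(1)[OF S(1)]] by simp
    next
      case (m_inv h)
      have "inv\<^bsub>type_ring\<^esub> h = inverse h" using inv_ring_of[OF U, of h] m_inv.hyps by (simp add: type_ring_eq)
      then show ?case using m_inv.IH subfield_set_closed(2)[OF S(1)] by simp
    qed (use S subring_set_closed[OF subfield_set_closed(1)[OF S(1)]] in auto)
    then show ?thesis using herm(5) by blast
  qed
  interpret G: hermitian_subgroup K p r q x y a \<sigma> \<G> m
  proof (intro hermitian_subgroup.intro hermitian_automorphism.intro hermitian.intro finite_subfield.intro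
      hermitian_subgroup_axioms.intro hermitian_automorphism_axioms.intro hermitian_axioms.intro)
    show "inj (\<lambda>i::nat. x ^ i)" using herm(1,3) by (rule inj_powers_of_transcendental)
    show "a ^ k \<noteq> 1" if "0 < k" "k < q\<^sup>2 - 1" for k using assms(10) that by blast
    show "subgroup \<G> (aut_group type_ring K\<lparr>carrier := generate (aut_group type_ring K) {\<sigma>}\<rparr>)"
      using assms(15,18) unfolding H by simp
    show "\<sigma> x = a * x / (a ^ (q + 1) * y + (a - a ^ q))" "\<sigma> y = 1 / (a ^ (q + 1) * y + (a - a ^ q))"
      using assms(11,13,14) by simp_all
    show "\<sigma> \<in> carrier (aut_group type_ring K)" "m dvd group.ord (aut_group type_ring K) \<sigma>"
      using assms(12,17) unfolding H by simp_all
  qed (fact K finK CHAR curve herm(2) assms | rule gen; assumption)+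
  define g where "g = genus (fixed_field H \<G>) K"
  have "2 * g = (int G.n - 1) * (int q - 1)" using G.genus_fixed_field by (simp add: g_def H)
  then have "real_of_int (2 * g) = real_of_int ((int G.n - 1) * (int q - 1))" by (simp only:)
  then have g: "2 * real_of_int g = (real G.n - 1) * (real q - 1)" by simp
  \<comment> \<open>\<open>n * m = q + 1\<close> turns \<open>(n - 1) (q - 1) / 2\<close> into the
    required form.\<close>
  have "real G.n * real m = real q + 1" using G.nm by (metis of_nat_1 of_nat_add of_nat_mult)
  then have "(real q - 1) * (real q + 1 - real m) = (real q - 1) * (real G.n * real m - real m)" by simp
  then have "2 * real_of_int g * real m = (real q - 1) * (real q + 1 - real m)"
    unfolding g by (simp add: algebra_simps)
  then show ?thesis using assms(16) unfolding g_def[symmetric] by (simp add: field_simps)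
qed

end
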